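(* Let $N$ be the Iwasawa manifold with its standard left-invariant metric and fix $\alpha>0$. The set of invariant mixed structures $(J,V)\in\mathcal{F}^+$ on $N$ of class $\mathcal{W}_{34}\cap\mathcal{V}_{345}$ (i.e. $J$ is of class $\mathcal{W}_{34}$ and the almost product structure defined by $V$ is of class $\mathcal{V}_{345}$) is diffeomorphic to a disjoint union $\mathbb{CP}^1\sqcup\mathbb{CP}^2\sqcup(\mathbb{CP}^1\rtimes\mathbb{CP}^1)$, where $\mathbb{CP}^1\rtimes\mathbb{CP}^1$ denotes the total space of a fibre bundle over $\mathbb{CP}^1$ with fibre $\mathbb{CP}^1$. Its image under $\mu_T$ consists of, respectively, the line segment joining $(1+\alpha,-1,-1)$ to $(-1,1+\alpha,-1)$; the filled triangle with vertices $(1+\alpha,1,1)$, $(1,1+\alpha,1)$, $(1,1,1+\alpha)$; and the filled trapezium with vertices $(1,-1-\alpha,-1)$, $(1,-1,-1-\alpha)$, $(-1-\alpha,1,-1)$, $(-1,1,-1-\alpha)$.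
   Context: The Iwasawa manifold. $G_H$ is the complex Heisenberg group of matrices $\begin{pmatrix}1&z^1&z^3\\0&1&z^2\\0&0&1\end{pmatrix}$, $z^k\in\mathbb{C}$; $\Gamma\subset G_H$ is the subgroup with entries in $\mathbb{Z}[i]$; $N=\Gamma\backslash G_H$. Left-invariant real 1-forms $e^1,\dots,e^6$ are defined by $e^1+ie^2=dz^1$, $e^3+ie^4=dz^2$, $e^5+ie^6=-dz^3+z^1dz^2$; they descend to $N$. The metric $g$ on $N$ is the one for which $e^1,\dots,e^6$ are orthonormal, and the orientation is $e^1\wedge\dots\wedge e^6$. All structures are invariant, i.e. have constant coefficients in this frame, so they are identified with structures on $\mathbb{R}^6$ with orthonormal basis $e^1,\dots,e^6$ (tangent and cotangent vectors are identified by $g$). Write $e^{ij}=e^i\wedge e^j$. OCS, OPS, MS. An OCS is an orthogonal $J$ with $J^2=-1$, with 2-form $\omega_J(X,Y)=g(JX,Y)$; $\mathcal{P}^+$ is the set of OCS's inducing the given orientation. $\mathcal{G}=\mathrm{Gr}_2(\mathbb{R}^6)$ is the set of oriented 2-planes $V$; each defines an orthogonal almost product structure (OPS) $TN=\mathcal{V}\oplus\mathcal{H}$ with $\mathcal{V}=V$ and $\mathcal{H}=V^\perp$. If $V$ is $J$-invariant, it is oriented consistently with $J$ if $(v,Jv)$ is a positive basis for $0\neq v\in V$. $\mathcal{F}^+$ is the set of mixed structures (MS's) $(J,V)$ with $J\in\mathcal{P}^+$ and $V\in\mathcal{G}$ a $J$-invariant 2-plane oriented consistently with $J$. For $\alpha>0$,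 $\mathcal{F}^+$ is identified with the $SO(6)$-orbit of $(1+\alpha)e^{12}+e^{34}+e^{56}$ in $\Lambda^2\mathbb{R}^6\cong\mathfrak{so}(6)^*$ by $(J,V)\mapsto\omega_J+\alpha\,v\wedge Jv$, $v\in V$ a unit vector. The map $\mu_T:\mathcal{F}^+\to\mathbb{R}^3$ sends a 2-form to its coefficients along $e^{12},e^{34},e^{56}$ (it is the moment map of the maximal torus of $SO(6)$ of rotations in the planes $\langle e^1,e^2\rangle,\langle e^3,e^4\rangle,\langle e^5,e^6\rangle$). Torsion classes. $J$ is of class $\mathcal{W}_{34}$ (the Gray–Hervella class $\mathcal{W}_3\oplus\mathcal{W}_4$) if it is integrable (its Nijenhuis tensor vanishes). For an OPS with Levi-Civita connection $\nabla$, the intrinsic torsion consists of the tensors $A(v,v',h)=g(\nabla_vv',h)$ and $B(h,h',v)=g(\nabla_hh',v)$ ($v,v'$ sections of $\mathcal{V}$, $h,h'$ sections of $\mathcal{H}$). Their components are $\mathcal{V}_1=\Lambda^2\mathcal{V}\otimes\mathcal{H}$, $\mathcal{V}_2=S^2_0\mathcal{V}\otimes\mathcal{H}$, $\mathcal{V}_3=1_{\mathcal{V}}\otimes\mathcal{H}$ (skew, tracefree symmetric, and trace part of $A$ in $(v,v')$) and $\mathcal{V}_4=\Lambda^2\mathcal{H}\otimes\mathcal{V}$, $\mathcal{V}_5=S_0^2\mathcal{H}\otimes\mathcal{V}$, $\mathcal{V}_6=1_{\mathcal{H}}\otimes\mathcal{V}$ (skew, tracefree symmetric, and trace part of $B$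 in $(h,h')$). An OPS is of class $\mathcal{V}_{ij\dots}$ if its intrinsic torsion lies in $\mathcal{V}_i\oplus\mathcal{V}_j\oplus\cdots$. *)

theory Defs
  imports "HOL-Analysis.Analysis"
begin

text \<open>\<open>Ck_on k U f\<close> (for open \<open>U\<close>): \<open>f\<close> is \<open>k\<close> times continuously differentiable on \<open>U\<close>.\<close>

primrec Ck_on :: "nat \<Rightarrow> 'a::euclidean_space set \<Rightarrow> ('a \<Rightarrow> 'b::euclidean_space) \<Rightarrow> bool" where
  "Ck_on 0 U f = continuous_on U f"
| "Ck_on (Suc k) U f = ((\<forall>x\<in>U. f differentiable (at x)) \<and>
     (\<forall>v. Ck_on k U (\<lambda>x. frechet_derivative f (at x) v)))"

definition smooth_on_open :: "'a::euclidean_space set \<Rightarrow> ('a \<Rightarrow> 'b::euclidean_space) \<Rightarrow> bool" where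
  "smooth_on_open U f \<longleftrightarrow> (\<forall>k. Ck_on k U f)"

text \<open>Embedded submanifolds of Euclidean spaces are treated as plain subsets: a map on an arbitrary
  subset is smooth if it extends locally to a smooth map of the ambient spaces. For embedded
  submanifolds this is smoothness in the sense of manifolds, and a set that is diffeomorphic in
  this sense to an embedded submanifold is itself an embedded submanifold.\<close>

definition smooth_map :: "'a::euclidean_space set \<Rightarrow> ('a \<Rightarrow> 'b::euclidean_space) \<Rightarrow> bool" where
  "smooth_map X f \<longleftrightarrow>
     (\<forall>x\<in>X. \<exists>U F. open U \<and> x \<in> U \<and> smooth_on_open U F \<and> (\<forall>y\<in>X \<inter> U. F y = f y))"

definition diffeomorphism ::
    "'a::euclidean_space set \<Rightarrow> 'b::euclidean_space set \<Rightarrow> ('a \<Rightarrow> 'b) \<Rightarrow> bool" where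
  "diffeomorphism X Y f \<longleftrightarrow> bij_betw f X Y \<and> smooth_map X f \<and> smooth_map Y (inv_into X f)"

definition diffeomorphic :: "'a::euclidean_space set \<Rightarrow> 'b::euclidean_space set \<Rightarrow> bool" where
  "diffeomorphic X Y \<longleftrightarrow> (\<exists>f. diffeomorphism X Y f)"

definition smooth_fibre_bundle ::
    "'a::euclidean_space set \<Rightarrow> ('a \<Rightarrow> 'b::euclidean_space) \<Rightarrow> 'b set \<Rightarrow> 'c::euclidean_space set \<Rightarrow> bool" where
  "smooth_fibre_bundle E p B F \<longleftrightarrow> smooth_map E p \<and> p ` E = B \<and>
     (\<forall>b\<in>B. \<exists>U \<phi>. openin (top_of_set B) U \<and> b \<in> U \<and>
        diffeomorphism {x \<in> E. p x \<in> U} (U \<times> F) \<phi> \<and>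
        (\<forall>x\<in>E. p x \<in> U \<longrightarrow> fst (\<phi> x) = p x))"

text \<open>The complex line through \<open>z \<noteq> 0\<close> is represented by the orthogonal projection onto it, which
  embeds projective space as a submanifold of the space of complex matrices. By the two lemmas
  below this is the quotient of the punctured vector space by nonzero scalars, and the affine
  coordinates \<open>z$j / z$i\<close> of the usual atlas are the functions \<open>P$j$i / P$i$i\<close>, so
  that the smooth structure is the usual one.\<close>

definition line_proj :: "complex^'n \<Rightarrow> complex^'n^'n" where
  "line_proj z = (\<chi> i j. z$i * cnj (z$j) / of_real ((norm z)\<^sup>2))"

definition projective_space :: "(complex^'n^'n) set" where
  "projective_space = line_proj ` (- {0})"

abbreviation CP1 :: "(complex^2^2) set" where "CP1 \<equiv> projective_space"
abbreviation CP2 :: "(complex^3^3) set" where "CP2 \<equiv> projective_space"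

lemma line_proj_affine:
  assumes "z$i \<noteq> 0"
  shows "line_proj z $ i $ i \<noteq> 0" "line_proj z $ j $ i / line_proj z $ i $ i = z$j / z$i"
proof -
  have "z \<noteq> 0" using assms by auto
  then show "line_proj z $ i $ i \<noteq> 0" "line_proj z $ j $ i / line_proj z $ i $ i = z$j / z$i"
    using assms by (auto simp: line_proj_def field_simps)
qed

lemma line_proj_eq_iff:
  fixes z w :: "complex^'n"
  assumes "z \<noteq> 0" "w \<noteq> 0"
  shows "line_proj z = line_proj w \<longleftrightarrow> (\<exists>c. c \<noteq> 0 \<and> w = c *s z)"
proof
  assume eq: "line_proj z = line_proj w"
  from assms(1) obtain i where i: "z$i \<noteq> 0" by (auto simp: vec_eq_iff)
  have "line_proj w $ i $ i \<noteq> 0" using line_proj_affine(1)[of z i] i eq by simp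
  then have wi: "w$i \<noteq> 0" by (auto simp: line_proj_def)
  have "w$j = (w$i / z$i) * z$j" for j
  proof -
    have "z$j / z$i = w$j / w$i"
      using line_proj_affine(2)[of z i j, OF i] line_proj_affine(2)[of w i j, OF wi] eq by simp
    then show ?thesis using i wi by (simp add: field_simps)
  qed
  then have "w = (w$i / z$i) *s z" unfolding vec_eq_iff vector_smult_component by blast
  moreover have "w$i / z$i \<noteq> 0" using i wi by simp
  ultimately show "\<exists>c. c \<noteq> 0 \<and> w = c *s z" by blast
next
  assume "\<exists>c. c \<noteq> 0 \<and> w = c *s z"
  then obtain c where c: "c \<noteq> 0" "w = c *s z" by auto
  have N: "(norm x)\<^sup>2 = (\<Sum>i\<in>UNIV. (cmod (x$i))\<^sup>2)" for x :: "complex^'n"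
    by (simp add: norm_vec_def L2_set_def sum_nonneg)
  have "(norm w)\<^sup>2 = (cmod c)\<^sup>2 * (norm z)\<^sup>2"
    unfolding N by (simp add: c norm_mult power_mult_distrib sum_distrib_left)
  then have n: "complex_of_real ((norm w)\<^sup>2) = c * cnj c * of_real ((norm z)\<^sup>2)"
    by (simp only: of_real_mult complex_norm_square)
  have "w$i * cnj (w$j) / of_real ((norm w)\<^sup>2) = z$i * cnj (z$j) / of_real ((norm z)\<^sup>2)" for i j
  proof -
    have "w$i * cnj (w$j) = (c * cnj c) * (z$i * cnj (z$j))" by (simp add: c)
    then show ?thesis unfolding n using c(1) by simp
  qed
  then show "line_proj z = line_proj w" by (simp only: line_proj_def)
qed

lemma vector_6 [simp]:
  "(vector [a,b,c,d,e,f] :: 'a::zero^6)$1 = a" "(vector [a,b,c,d,e,f] :: 'a^6)$2 = b"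
  "(vector [a,b,c,d,e,f] :: 'a^6)$3 = c" "(vector [a,b,c,d,e,f] :: 'a^6)$4 = d"
  "(vector [a,b,c,d,e,f] :: 'a^6)$5 = e" "(vector [a,b,c,d,e,f] :: 'a^6)$6 = f"
  unfolding vector_def by simp_all

lemma exhaust_6: "x = 1 \<or> x = 2 \<or> x = 3 \<or> x = 4 \<or> x = 5 \<or> x = (6::6)"
proof (induct x)
  case (of_int z)
  then have "0 \<le> z" "z < 6" by simp_all
  then have "z = 0 \<or> z = 1 \<or> z = 2 \<or> z = 3 \<or> z = 4 \<or> z = 5" by arith
  then show ?case by auto
qed

lemma forall_6: "(\<forall>i::6. P i) \<longleftrightarrow> P 1 \<and> P 2 \<and> P 3 \<and> P 4 \<and> P 5 \<and> P 6"
  by (metis exhaust_6)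

text \<open>The point \<open>z\<close> of \<open>complex^3\<close> stands for the group element \<open>heis_matrix z\<close>.\<close>

definition heis_matrix :: "complex^3 \<Rightarrow> complex^3^3" where
  "heis_matrix z = vector [vector [1, z$1, z$3], vector [0, 1, z$2], vector [0, 0, 1]]"

definition heis_mult :: "complex^3 \<Rightarrow> complex^3 \<Rightarrow> complex^3" where
  "heis_mult z w = vector [z$1 + w$1, z$2 + w$2, z$3 + w$3 + z$1 * w$2]"

lemma heis_matrix_mult: "heis_matrix (heis_mult z w) = heis_matrix z ** heis_matrix w"
  by (simp add: heis_matrix_def heis_mult_def matrix_matrix_mult_def vec_eq_iff forall_3 sum_3)

definition gaussian_lattice :: "(complex^3) set" where
  "gaussian_lattice = {z. \<forall>k. Re (z$k) \<in> \<int> \<and> Im (z$k) \<in> \<int>}"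

text \<open>\<open>coframe p u\<close> lists the values at \<open>p\<close> of the six forms on the tangent vector \<open>u\<close>; \<open>frame p\<close> is the
  inverse map, so \<open>\<lambda>p. frame p x\<close> is the left-invariant vector field with constant coefficients
  \<open>x\<close>.\<close>

definition coframe :: "complex^3 \<Rightarrow> complex^3 \<Rightarrow> real^6" where
  "coframe p u = vector [Re (u$1), Im (u$1), Re (u$2), Im (u$2),
     Re (- u$3 + p$1 * u$2), Im (- u$3 + p$1 * u$2)]"

definition frame :: "complex^3 \<Rightarrow> real^6 \<Rightarrow> complex^3" where
  "frame p x = vector [Complex (x$1) (x$2), Complex (x$3) (x$4),
     p$1 * Complex (x$3) (x$4) - Complex (x$5) (x$6)]"

lemma coframe_frame: "coframe p (frame p x) = x"
  unfolding vec_eq_iff forall_6 by (simp add: coframe_def frame_def)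

lemma frame_coframe: "frame p (coframe p u) = u"
  unfolding vec_eq_iff forall_3 by (simp add: coframe_def frame_def complex_eq_iff)

lemma coframe_linear: "linear (coframe p)"
  by (rule linearI; unfold vec_eq_iff forall_6) (simp_all add: coframe_def algebra_simps)

lemma frame_linear: "linear (frame p)"
  by (rule linearI; unfold vec_eq_iff forall_3) (simp_all add: frame_def complex_eq_iff algebra_simps)

lemma bounded_linear_heis:
  "bounded_linear (\<lambda>u::complex^3. vector [u$1, u$2, u$3 + c * u$2] :: complex^3)"
  by (intro linear_conv_bounded_linear[THEN iffD1] linearI)
     (simp_all add: vec_eq_iff forall_3 algebra_simps)

lemma heis_mult_has_derivative:
  "(heis_mult g has_derivative (\<lambda>u. vector [u$1, u$2, u$3 + g$1 * u$2])) (at p)"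
proof -
  have "heis_mult g = (\<lambda>w. g + vector [w$1, w$2, w$3 + g$1 * w$2])"
    by (simp add: fun_eq_iff heis_mult_def vec_eq_iff forall_3 algebra_simps)
  moreover have "((\<lambda>w. g + (vector [w$1, w$2, w$3 + g$1 * w$2] :: complex^3)) has_derivative
      (\<lambda>u. vector [u$1, u$2, u$3 + g$1 * u$2])) (at p)"
    using has_derivative_add[OF has_derivative_const bounded_linear_imp_has_derivative[OF bounded_linear_heis]]
    by simp
  ultimately show ?thesis by simp
qed

text \<open>Left-invariance: the forms descend to the Iwasawa manifold, the quotient of the group by left
  translations by \<open>gaussian_lattice\<close>, and the covering map is a local isometry. The conditions on
  structures below are local and are therefore imposed on the group.\<close>

lemma coframe_left_invariant:
  "coframe (heis_mult g p) (frechet_derivative (heis_mult g) (at p) u) = coframe p u"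
  unfolding frechet_derivative_at[OF heis_mult_has_derivative, symmetric]
  unfolding vec_eq_iff forall_6 by (simp add: coframe_def heis_mult_def algebra_simps)

definition metric :: "complex^3 \<Rightarrow> complex^3 \<Rightarrow> complex^3 \<Rightarrow> real" where
  "metric p u w = coframe p u \<bullet> coframe p w"

lemma metric_sym: "metric p u w = metric p w u"
  by (simp add: metric_def inner_commute)

type_synonym vfield = "complex^3 \<Rightarrow> complex^3"

definition lie_bracket :: "vfield \<Rightarrow> vfield \<Rightarrow> vfield" where
  "lie_bracket X Y p = frechet_derivative Y (at p) (X p) - frechet_derivative X (at p) (Y p)"

text \<open>The Levi-Civita connection of \<open>metric\<close>, in the linear coordinates of \<open>complex^3\<close>:
  \<open>metric_deriv p t u w\<close> is the derivative at \<open>p\<close> in the direction \<open>t\<close> of the component \<open>g(u,w)\<close> of the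
  metric (\<open>u\<close>, \<open>w\<close> constant), and \<open>christoffel p u w\<close> is the Christoffel symbol with its last index
  raised.\<close>

definition metric_deriv :: "complex^3 \<Rightarrow> complex^3 \<Rightarrow> complex^3 \<Rightarrow> complex^3 \<Rightarrow> real" where
  "metric_deriv p t u w = frechet_derivative (\<lambda>q. metric q u w) (at p) t"

definition christoffel :: "complex^3 \<Rightarrow> complex^3 \<Rightarrow> complex^3 \<Rightarrow> complex^3" where
  "christoffel p u w = (THE c. \<forall>t. metric p c t =
     (metric_deriv p u w t + metric_deriv p w u t - metric_deriv p t u w) / 2)"

definition levi_civita :: "vfield \<Rightarrow> vfield \<Rightarrow> vfield" where
  "levi_civita X Y p = frechet_derivative Y (at p) (X p) + christoffel p (X p) (Y p)"

text \<open>\<open>coframe_variation t u\<close> is the derivative of \<open>coframe\<close> in its base point, in the direction \<open>t\<close>,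
  on the constant vector \<open>u\<close>.\<close>

definition coframe_variation :: "complex^3 \<Rightarrow> complex^3 \<Rightarrow> real^6" where
  "coframe_variation t u = vector [0, 0, 0, 0, Re (t$1 * u$2), Im (t$1 * u$2)]"

lemma coframe_variation_linear:
  "coframe_variation (s + t) u = coframe_variation s u + coframe_variation t u" 
  "coframe_variation t (u + w) = coframe_variation t u + coframe_variation t w"
  "coframe_variation (c *\<^sub>R t) u = c *\<^sub>R coframe_variation t u" 
  "coframe_variation t (c *\<^sub>R u) = c *\<^sub>R coframe_variation t u"
  unfolding vec_eq_iff forall_6 by (simp_all add: coframe_variation_def algebra_simps)

lemma coframe_base_deriv:
  assumes "(X has_derivative X') (at p)"
  shows "((\<lambda>q. coframe q (X q)) has_derivative (\<lambda>t. coframe p (X' t) + coframe_variation t (X p))) (at p)"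
proof -
  have d: "((\<lambda>q. q$1) has_derivative (\<lambda>t. t$1)) (at p)" for p :: "complex^3"
    by (intro bounded_linear_imp_has_derivative bounded_linear_vec_nth)
  have X: "((\<lambda>q. X q $ i) has_derivative (\<lambda>t. X' t $ i)) (at p)" for i
    by (rule bounded_linear.has_derivative[OF bounded_linear_vec_nth assms])
  have z: "((\<lambda>q. - X q $3 + q$1 * X q$2) has_derivative
      (\<lambda>t. - X' t $3 + (p$1 * X' t$2 + t$1 * X p$2))) (at p)"
    by (intro derivative_intros d X)
  have "((\<lambda>q. coframe q (X q) $ i) has_derivative (\<lambda>t. (coframe p (X' t) + coframe_variation t (X p))$i)) (at p)" for i
  proof -
    have R: "((\<lambda>q. Re (f q)) has_derivative (\<lambda>t. Re (f' t))) (at p)"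
            "((\<lambda>q. Im (f q)) has_derivative (\<lambda>t. Im (f' t))) (at p)"
         if "(f has_derivative f') (at p)" for f f'
      using that by (intro bounded_linear.has_derivative[OF bounded_linear_Re]
          bounded_linear.has_derivative[OF bounded_linear_Im]; simp)+
    show ?thesis
      using exhaust_6[of i] R[OF X[of 1]] R[OF X[of 2]] R[OF z]
      by (elim disjE; hypsubst) (simp_all add: coframe_def coframe_variation_def algebra_simps)
  qed
  then have "((\<lambda>q. coframe q (X q) $ i *\<^sub>R axis i (1::real)) has_derivative
      (\<lambda>t. (coframe p (X' t) + coframe_variation t (X p))$i *\<^sub>R axis i 1)) (at p)" for i
    by (rule has_derivative_scaleR_left)
  then have "((\<lambda>q. \<Sum>i\<in>UNIV. coframe q (X q) $ i *\<^sub>R axis i (1::real)) has_derivative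
      (\<lambda>t. \<Sum>i\<in>UNIV. (coframe p (X' t) + coframe_variation t (X p))$i *\<^sub>R axis i 1)) (at p)"
    by (intro has_derivative_sum)
  then show ?thesis unfolding scalar_mult_eq_scaleR[symmetric] basis_expansion .
qed

lemma metric_has_derivative:
  assumes "(X has_derivative X') (at p)" "(Y has_derivative Y') (at p)"
  shows "((\<lambda>q. metric q (X q) (Y q)) has_derivative
    (\<lambda>t. metric p (X p) (Y' t) + coframe p (X p) \<bullet> coframe_variation t (Y p)
       + metric p (X' t) (Y p) + coframe_variation t (X p) \<bullet> coframe p (Y p))) (at p)"
  unfolding metric_def
  using has_derivative_inner[OF coframe_base_deriv[OF assms(1)] coframe_base_deriv[OF assms(2)]]
  by (simp add: inner_add_left inner_add_right add.assoc)

lemma metric_deriv_eq: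
  "metric_deriv p t u w = coframe p u \<bullet> coframe_variation t w + coframe_variation t u \<bullet> coframe p w"
proof -
  have "((\<lambda>q. metric q u w) has_derivative (\<lambda>t. coframe p u \<bullet> coframe_variation t w + coframe_variation t u \<bullet> coframe p w)) (at p)"
    using metric_has_derivative[OF has_derivative_const[of u] has_derivative_const[of w], of p]
    by (simp add: metric_def linear_0[OF coframe_linear])
  from frechet_derivative_at[OF this] show ?thesis by (simp add: metric_deriv_def fun_eq_iff)
qed

lemma christoffel_metric:
  "metric p (christoffel p u w) t =
     (metric_deriv p u w t + metric_deriv p w u t - metric_deriv p t u w) / 2"
proof -
  define L where "L t = (metric_deriv p u w t + metric_deriv p w u t - metric_deriv p t u w) / 2" for t
  have "linear L"
    by (intro linearI)
      (simp_all add: L_def metric_deriv_eq coframe_variation_linear linear_add[OF coframe_linear]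
        linear_scale[OF coframe_linear] inner_add_left inner_add_right field_simps)
  then have lin: "linear (L \<circ> frame p)" by (intro linear_compose frame_linear)
  define a where "a = adjoint (L \<circ> frame p) 1"
  have a: "L t = a \<bullet> coframe p t" for t
    using adjoint_works[OF lin, of "coframe p t" 1]
    by (simp add: frame_coframe a_def inner_commute)
  have "\<exists>!c. \<forall>t. metric p c t = L t"
  proof (rule ex1I[of _ "frame p a"])
    show "\<forall>t. metric p (frame p a) t = L t" by (simp add: metric_def coframe_frame a)
  next
    fix c assume c: "\<forall>t. metric p c t = L t"
    have "coframe p c \<bullet> x = a \<bullet> x" for x
      using c[rule_format, of "frame p x"] by (simp add: metric_def a coframe_frame)
    then have "coframe p c = a" using vector_eq_rdot by blast
    then show "c = frame p a" using frame_coframe by metis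
  qed
  from theI'[OF this] show ?thesis unfolding christoffel_def L_def by blast
qed

lemma christoffel_sym: "christoffel p u w = christoffel p w u"
proof -
  have "metric_deriv p t u w = metric_deriv p t w u" for t
    by (simp add: metric_deriv_def metric_sym)
  then show ?thesis unfolding christoffel_def by (simp add: add.commute)
qed

lemma levi_civita_torsion_free:
  "levi_civita X Y p - levi_civita Y X p = lie_bracket X Y p"
  by (simp add: levi_civita_def lie_bracket_def christoffel_sym[of p "X p" "Y p"])

lemma levi_civita_metric:
  assumes "X differentiable (at p)" "Y differentiable (at p)"
  shows "frechet_derivative (\<lambda>q. metric q (X q) (Y q)) (at p) (Z p) =
     metric p (levi_civita Z X p) (Y p) + metric p (X p) (levi_civita Z Y p)"
proof -
  have add: "metric p (a + b) c = metric p a c + metric p b c" for a b c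
    by (simp add: metric_def linear_add[OF coframe_linear] inner_add_left)
  have add': "metric p c (a + b) = metric p c a + metric p c b" for a b c
    by (metis add metric_sym)
  have sym: "metric_deriv p t u w = metric_deriv p t w u" for t u w
    by (simp add: metric_deriv_def metric_sym)
  have "frechet_derivative (\<lambda>q. metric q (X q) (Y q)) (at p) (Z p) =
    metric p (X p) (frechet_derivative Y (at p) (Z p)) +
    metric p (frechet_derivative X (at p) (Z p)) (Y p) + metric_deriv p (Z p) (X p) (Y p)"
    using fun_cong[OF frechet_derivative_at[OF metric_has_derivative[OF
       assms[THEN frechet_derivative_works[THEN iffD1]]]], of "Z p"]
    by (simp add: metric_deriv_eq)
  moreover have "metric p (christoffel p (Z p) (X p)) (Y p) + metric p (X p) (christoffel p (Z p) (Y p))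
     = metric_deriv p (Z p) (X p) (Y p)"
    unfolding metric_sym[of p "X p"] christoffel_metric
    unfolding sym[of "Z p" "Y p"] by (simp add: field_simps)
  ultimately show ?thesis by (simp add: levi_civita_def add add')
qed

text \<open>An invariant endomorphism field is given by its matrix \<open>J\<close> in the frame.\<close>

definition invariant_endo :: "real^6^6 \<Rightarrow> vfield \<Rightarrow> vfield" where
  "invariant_endo J X p = frame p (J *v coframe p (X p))"

text \<open>OCS's inducing the orientation \<open>e\<^sup>1 \<and> \<dots> \<and> e\<^sup>6\<close>: every basis of the form
  \<open>v\<^sub>1, J v\<^sub>1, v\<^sub>2, J v\<^sub>2, v\<^sub>3, J v\<^sub>3\<close> is positive.\<close>

definition positive_ocs :: "(real^6^6) set" where
  "positive_ocs = {J. orthogonal_matrix J \<and> J ** J = - mat 1 \<and>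
     (\<forall>v1 v2 v3. let d = det (vector [v1, J *v v1, v2, J *v v2, v3, J *v v3] :: real^6^6)
        in d \<noteq> 0 \<longrightarrow> d > 0)}"

definition nijenhuis :: "real^6^6 \<Rightarrow> vfield \<Rightarrow> vfield \<Rightarrow> vfield" where
  "nijenhuis J X Y p =
     (let \<J> = invariant_endo J in
        lie_bracket (\<J> X) (\<J> Y) p - lie_bracket X Y p
        - \<J> (lie_bracket (\<J> X) Y) p - \<J> (lie_bracket X (\<J> Y)) p)"

definition class_W34 :: "real^6^6 \<Rightarrow> bool" where
  "class_W34 J \<longleftrightarrow> (\<forall>X Y p. smooth_on_open UNIV X \<longrightarrow> smooth_on_open UNIV Y \<longrightarrow> nijenhuis J X Y p = 0)"

text \<open>\<open>\<nabla>\<close> on left-invariant fields, as a trilinear form on \<open>real^6\<close>. For a distribution and its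
  orthogonal complement the tensors \<open>A\<close> and \<open>B\<close> are the restrictions of this form: they are tensorial,
  so it is enough to evaluate them on invariant sections.\<close>

definition connection_form :: "complex^3 \<Rightarrow> real^6 \<Rightarrow> real^6 \<Rightarrow> real^6 \<Rightarrow> real" where
  "connection_form p x y z =
     metric p (levi_civita (\<lambda>q. frame q x) (\<lambda>q. frame q y) p) (frame p z)"

definition orthonormal_basis_of :: "(real^6) set \<Rightarrow> (real^6) set \<Rightarrow> bool" where
  "orthonormal_basis_of W B \<longleftrightarrow> pairwise orthogonal B \<and> (\<forall>b\<in>B. norm b = 1) \<and> span B = W"

definition skew_part ::
    "(real^6 \<Rightarrow> real^6 \<Rightarrow> real^6 \<Rightarrow> real) \<Rightarrow> real^6 \<Rightarrow> real^6 \<Rightarrow> real^6 \<Rightarrow> real" where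
  "skew_part T x y z = (T x y z - T y x z) / 2"

definition trace_part ::
    "(real^6) set \<Rightarrow> (real^6 \<Rightarrow> real^6 \<Rightarrow> real^6 \<Rightarrow> real) \<Rightarrow> real^6 \<Rightarrow> real^6 \<Rightarrow> real^6 \<Rightarrow> real" where
  "trace_part W T x y z =
     (x \<bullet> y) / real (dim W) * (\<Sum>b\<in>(SOME B. orthonormal_basis_of W B). T b b z)"

definition tracefree_sym_part ::
    "(real^6) set \<Rightarrow> (real^6 \<Rightarrow> real^6 \<Rightarrow> real^6 \<Rightarrow> real) \<Rightarrow> real^6 \<Rightarrow> real^6 \<Rightarrow> real^6 \<Rightarrow> real" where
  "tracefree_sym_part W T x y z = (T x y z + T y x z) / 2 - trace_part W T x y z"

definition vanishes_on ::
    "(real^6) set \<Rightarrow> (real^6) set \<Rightarrow> (real^6 \<Rightarrow> real^6 \<Rightarrow> real^6 \<Rightarrow> real) \<Rightarrow> bool" where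
  "vanishes_on W U T \<longleftrightarrow> (\<forall>x\<in>W. \<forall>y\<in>W. \<forall>z\<in>U. T x y z = 0)"

text \<open>\<open>class_V S W\<close>: the intrinsic torsion of the OPS with vertical distribution \<open>W\<close> lies in the sum
  of the \<open>\<V>\<^sub>i\<close> with \<open>i \<in> S\<close>, that is, its components of all other indices vanish.\<close>

definition class_V :: "nat set \<Rightarrow> (real^6) set \<Rightarrow> bool" where
  "class_V S W \<longleftrightarrow> (\<forall>p. let T = connection_form p; H = orthogonal_comp W in
     (1 \<notin> S \<longrightarrow> vanishes_on W H (skew_part T)) \<and>
     (2 \<notin> S \<longrightarrow> vanishes_on W H (tracefree_sym_part W T)) \<and>
     (3 \<notin> S \<longrightarrow> vanishes_on W H (trace_part W T)) \<and>
     (4 \<notin> S \<longrightarrow> vanishes_on H W (skew_part T)) \<and>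
     (5 \<notin> S \<longrightarrow> vanishes_on H W (tracefree_sym_part H T)) \<and>
     (6 \<notin> S \<longrightarrow> vanishes_on H W (trace_part H T)))"

text \<open>An oriented 2-plane is the set of all its positive ordered bases.\<close>

definition positive_bases :: "real^6 \<Rightarrow> real^6 \<Rightarrow> ((real^6) \<times> (real^6)) set" where
  "positive_bases v w = {(a *\<^sub>R v + b *\<^sub>R w, c *\<^sub>R v + d *\<^sub>R w) | a b c d. a * d - b * c > 0}"

lemma positive_bases_trans:
  assumes "(v, w) \<in> positive_bases x y"
  shows "positive_bases v w = positive_bases x y"
proof -
  have sub: "positive_bases v w \<subseteq> positive_bases x y" if vw: "(v, w) \<in> positive_bases x y" for v w x y
  proof clarify
    fix s t assume "(s, t) \<in> positive_bases v w"
    then obtain a b c d where st: "s = a *\<^sub>R v + b *\<^sub>R w" "t = c *\<^sub>R v + d *\<^sub>R w" "a * d - b * c > 0"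
      by (auto simp: positive_bases_def)
    obtain a' b' c' d' where
      vw': "v = a' *\<^sub>R x + b' *\<^sub>R y" "w = c' *\<^sub>R x + d' *\<^sub>R y" "a' * d' - b' * c' > 0"
      using vw by (auto simp: positive_bases_def)
    have "s = (a*a' + b*c') *\<^sub>R x + (a*b' + b*d') *\<^sub>R y" "t = (c*a' + d*c') *\<^sub>R x + (c*b' + d*d') *\<^sub>R y"
      by (simp_all add: st vw' algebra_simps)
    moreover have "(a*a' + b*c') * (c*b' + d*d') - (a*b' + b*d') * (c*a' + d*c') =
      (a * d - b * c) * (a' * d' - b' * c')" by algebra
    ultimately show "(s, t) \<in> positive_bases x y"
      using mult_pos_pos[OF st(3) vw'(3)] unfolding positive_bases_def mem_Collect_eq
      by (metis (no_types))
  qed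
  from assms obtain a b c d where
    vw: "v = a *\<^sub>R x + b *\<^sub>R y" "w = c *\<^sub>R x + d *\<^sub>R y" and D: "a * d - b * c > 0"
    by (auto simp: positive_bases_def)
  define D where "D = a * d - b * c"
  have D0: "D > 0" using D by (simp add: D_def)
  have "D *\<^sub>R x = d *\<^sub>R v + (-b) *\<^sub>R w" "D *\<^sub>R y = (-c) *\<^sub>R v + a *\<^sub>R w"
    by (simp_all add: vw D_def algebra_simps)
  then have "(1/D) *\<^sub>R (D *\<^sub>R x) = (1/D) *\<^sub>R (d *\<^sub>R v + (-b) *\<^sub>R w)"
    "(1/D) *\<^sub>R (D *\<^sub>R y) = (1/D) *\<^sub>R ((-c) *\<^sub>R v + a *\<^sub>R w)" by simp_all
  then have xy: "x = (d/D) *\<^sub>R v + (-b/D) *\<^sub>R w" "y = (-c/D) *\<^sub>R v + (a/D) *\<^sub>R w"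
    using D0 by (simp_all add: algebra_simps)
  have "(d/D) * (a/D) - (-b/D) * (-c/D) = (a * d - b * c) / (D * D)"
    by (simp add: diff_divide_distrib mult.commute)
  also have "\<dots> > 0" using D0 by (simp add: D_def[symmetric])
  finally have "(x, y) \<in> positive_bases v w" unfolding positive_bases_def using xy by blast
  from sub[OF this] sub[OF assms] show ?thesis by blast
qed

definition oriented_planes :: "((real^6) \<times> (real^6)) set set" where
  "oriented_planes = {positive_bases v w | v w. v \<noteq> w \<and> independent {v, w}}"

definition plane_of :: "((real^6) \<times> (real^6)) set \<Rightarrow> (real^6) set" where
  "plane_of V = span (fst ` V)"

definition mixed_structures :: "((real^6^6) \<times> ((real^6) \<times> (real^6)) set) set" where
  "mixed_structures = {(J, V). J \<in> positive_ocs \<and> V \<in> oriented_planes \<and>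
     (\<forall>v\<in>plane_of V. J *v v \<in> plane_of V) \<and>
     (\<forall>v\<in>plane_of V. v \<noteq> 0 \<longrightarrow> (v, J *v v) \<in> V)}"

text \<open>A 2-form is given by the skew matrix of its values on the frame, so \<open>e\<^sup>i\<^sup>j\<close> has entry \<open>1\<close> in
  position \<open>(i,j)\<close>, which is where the coefficient along \<open>e\<^sup>i\<^sup>j\<close> is read off.\<close>

definition wedge :: "real^6 \<Rightarrow> real^6 \<Rightarrow> real^6^6" where
  "wedge v w = (\<chi> i j. v$i * w$j - v$j * w$i)"

definition fundamental_form :: "real^6^6 \<Rightarrow> real^6^6" where
  "fundamental_form J = (\<chi> i j. (J *v axis i 1) \<bullet> axis j 1)"

definition ms_form :: "real \<Rightarrow> (real^6^6) \<times> ((real^6) \<times> (real^6)) set \<Rightarrow> real^6^6" where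
  "ms_form \<alpha> = (\<lambda>(J, V). let v = (SOME v. v \<in> plane_of V \<and> norm v = 1) in
     fundamental_form J + \<alpha> *\<^sub>R wedge v (J *v v))"

lemma ms_form_contract:
  "x v* (fundamental_form J + \<alpha> *\<^sub>R wedge v w) = J *v x + \<alpha> *\<^sub>R ((v \<bullet> x) *\<^sub>R w - (w \<bullet> x) *\<^sub>R v)"
proof -
  have "(J *v axis i 1) $ j = J $ j $ i" for i j
    by (simp only: matrix_vector_mult_basis column_def vec_lambda_beta)
  then have "(x v* fundamental_form J) $ j = (J *v x) $ j" for j
    by (simp add: vector_matrix_mult_def fundamental_form_def inner_axis)
      (simp add: matrix_vector_mult_def mult.commute)
  moreover have "(x v* wedge v w) $ j = ((v \<bullet> x) *\<^sub>R w - (w \<bullet> x) *\<^sub>R v) $ j" for j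
    by (simp add: vector_matrix_mult_def wedge_def inner_vec_def sum_distrib_right algebra_simps
         sum_subtractf sum_distrib_left)
  ultimately show ?thesis
    by (simp add: vec_eq_iff vector_matrix_mult_def distrib_left sum.distrib
      mult.left_commute[of _ \<alpha>] sum_distrib_left[symmetric])
qed

lemma ms_unit:
  assumes "(J, V) \<in> mixed_structures"
  obtains v where "v \<in> plane_of V" "norm v = 1"
    "ms_form \<alpha> (J, V) = fundamental_form J + \<alpha> *\<^sub>R wedge v (J *v v)"
proof -
  obtain x y where V: "V = positive_bases x y" "x \<noteq> y" "independent {x, y}"
    using assms by (auto simp: mixed_structures_def oriented_planes_def)
  have "x \<noteq> 0" using V(3) dependent_zero by blast
  have "(x, y) = (1 *\<^sub>R x + 0 *\<^sub>R y, 0 *\<^sub>R x + 1 *\<^sub>R y) \<and> 1 * 1 - 0 * 0 > (0::real)" by simp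
  then have "(x, y) \<in> V" unfolding V positive_bases_def by blast
  then have "x \<in> plane_of V" unfolding plane_of_def by (force intro: span_base)
  then have "(1 / norm x) *\<^sub>R x \<in> plane_of V" unfolding plane_of_def by (rule span_mul)
  then have "\<exists>v. v \<in> plane_of V \<and> norm v = 1"
    using \<open>x \<noteq> 0\<close> by (intro exI[of _ "(1 / norm x) *\<^sub>R x"]) simp
  from someI_ex[OF this] show ?thesis
    by (intro that[of "SOME v. v \<in> plane_of V \<and> norm v = 1"]) (auto simp: ms_form_def Let_def)
qed

lemma ms_plane:
  assumes "(J, V) \<in> mixed_structures" "v \<in> plane_of V" "norm v = 1"
  shows "V = positive_bases v (J *v v)" "plane_of V = span {v, J *v v}"
proof -
  have "v \<noteq> 0" using assms(3) by auto
  then have vV: "(v, J *v v) \<in> V" and o: "V \<in> oriented_planes"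
    using assms by (auto simp: mixed_structures_def)
  then show V: "V = positive_bases v (J *v v)"
    using positive_bases_trans unfolding oriented_planes_def by blast
  show "plane_of V = span {v, J *v v}"
  proof
    have "fst ` V \<subseteq> span {v, J *v v}"
      by (subst V) (auto simp: positive_bases_def intro!: span_add span_mul intro: span_base)
    then show "plane_of V \<subseteq> span {v, J *v v}"
      unfolding plane_of_def by (rule span_minimal) simp
    have "J *v v \<in> plane_of V" using assms(1,2) by (auto simp: mixed_structures_def)
    then show "span {v, J *v v} \<subseteq> plane_of V"
      using assms(2) by (intro span_minimal) (auto simp: plane_of_def)
  qed
qed

text \<open>Sets of mixed structures carry the smooth structure of their images under this injection into
  the 2-forms.\<close>

lemma ms_form_inj:
  assumes "\<alpha> > 0"
  shows "inj_on (ms_form \<alpha>) mixed_structures"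
proof -
  have key: "(\<forall>x. J *v x = x v* \<omega> - (\<alpha> / (1 + \<alpha>)) *\<^sub>R (\<pi> x v* \<omega>)) \<and>
      plane_of V = {x. \<pi> x = x}"
    if MS: "(J, V) \<in> mixed_structures" and \<omega>: "\<omega> = ms_form \<alpha> (J, V)"
      and \<pi>: "\<pi> = (\<lambda>x. - (1 / (\<alpha> * (2 + \<alpha>))) *\<^sub>R (x + (x v* \<omega>) v* \<omega>))"
    for J V \<omega> \<pi>
  proof -
    from ms_unit[OF MS, of \<alpha>] obtain v where v: "v \<in> plane_of V" "norm v = 1"
      and form: "\<omega> = fundamental_form J + \<alpha> *\<^sub>R wedge v (J *v v)" unfolding \<omega> by metis
    define w where "w = J *v v"
    have K: "x v* \<omega> = J *v x + \<alpha> *\<^sub>R ((v \<bullet> x) *\<^sub>R w - (w \<bullet> x) *\<^sub>R v)" for x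
      unfolding form w_def ms_form_contract ..
    have orth: "orthogonal_matrix J" and sq: "J ** J = - mat 1"
      using MS by (auto simp: mixed_structures_def positive_ocs_def)
    have JJ: "J *v (J *v x) = - x" for x
      unfolding matrix_vector_mul_assoc sq
      by (metis add.right_inverse add_eq_0_iff matrix_vector_mul_lid matrix_vector_mult_0
          matrix_vector_mult_add_rdistrib)
    have iso: "(J *v x) \<bullet> (J *v y) = x \<bullet> y" for x y
      using orth by (metis orthogonal_transformation_matrix orthogonal_transformation_def
        matrix_of_matrix_vector_mul matrix_vector_mul_linear)
    have skew: "(J *v x) \<bullet> y = - (x \<bullet> (J *v y))" for x y
      using iso[of x "J *v y"] by (simp add: JJ)
    have vv: "v \<bullet> v = 1" using v(2) by (simp add: norm_eq_1)
    have ww: "w \<bullet> w = 1" using iso vv by (simp add: w_def)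
    have vw: "v \<bullet> w = 0" "w \<bullet> v = 0" using skew[of v v] by (simp_all add: w_def inner_commute)
    have Jw: "J *v w = - v" by (simp add: w_def JJ)
    have wJ: "w \<bullet> (J *v x) = v \<bullet> x" and vJ: "v \<bullet> (J *v x) = - (w \<bullet> x)" for x
      using skew[of v x] by (simp_all add: w_def iso)
    have proj: "\<pi> x = (v \<bullet> x) *\<^sub>R v + (w \<bullet> x) *\<^sub>R w" for x
    proof -
      have "x + (x v* \<omega>) v* \<omega> = - (\<alpha> * (2 + \<alpha>)) *\<^sub>R ((v \<bullet> x) *\<^sub>R v + (w \<bullet> x) *\<^sub>R w)"
        unfolding K
        by (simp add: matrix_vector_right_distrib matrix_vector_mult_diff_distrib matrix_vector_mult_scaleR
            JJ Jw w_def[symmetric] wJ vJ vv ww vw inner_add_right inner_diff_right)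
          (simp add: vec_eq_iff algebra_simps)
      then show ?thesis unfolding \<pi> using assms by simp
    qed
    have "\<pi> x v* \<omega> = (1 + \<alpha>) *\<^sub>R ((v \<bullet> x) *\<^sub>R w - (w \<bullet> x) *\<^sub>R v)" for x
      unfolding proj K
      by (simp add: matrix_vector_right_distrib matrix_vector_mult_scaleR Jw w_def[symmetric]
            vv ww vw inner_add_right algebra_simps)
    then have "(\<alpha> / (1 + \<alpha>)) *\<^sub>R (\<pi> x v* \<omega>) = \<alpha> *\<^sub>R ((v \<bullet> x) *\<^sub>R w - (w \<bullet> x) *\<^sub>R v)" for x
      using assms by simp
    then have J: "J *v x = x v* \<omega> - (\<alpha> / (1 + \<alpha>)) *\<^sub>R (\<pi> x v* \<omega>)" for x by (simp add: K)
    have "x \<in> plane_of V \<longleftrightarrow> \<pi> x = x" for x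
    proof
      assume "x \<in> plane_of V"
      then obtain a b where "x - a *\<^sub>R v = b *\<^sub>R w"
        unfolding ms_plane(2)[OF MS v] w_def[symmetric] span_breakdown_eq span_singleton by auto
      then have "x = a *\<^sub>R v + b *\<^sub>R w" by (metis add.commute diff_add_cancel)
      then show "\<pi> x = x" by (simp add: proj inner_add_right vv ww vw)
    next
      assume "\<pi> x = x"
      then have "x = (v \<bullet> x) *\<^sub>R v + (w \<bullet> x) *\<^sub>R w" using proj by metis
      also have "\<dots> \<in> span {v, w}" by (intro span_add span_mul span_base) auto
      finally show "x \<in> plane_of V" unfolding ms_plane(2)[OF MS v] w_def .
    qed
    with J show ?thesis by blast
  qed
  show ?thesis
  proof (rule inj_onI, clarify)
    fix J V J' V' assume MS: "(J, V) \<in> mixed_structures" and MS': "(J', V') \<in> mixed_structures"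
      and eq: "ms_form \<alpha> (J, V) = ms_form \<alpha> (J', V')"
    have J: "J = J'" and P: "plane_of V = plane_of V'"
      using key[OF MS refl refl] key[OF MS' refl refl] unfolding eq by (simp_all add: matrix_eq)
    from ms_unit[OF MS, of \<alpha>] obtain v where v: "v \<in> plane_of V" "norm v = 1" by metis
    have "V = V'" using ms_plane(1)[OF MS v] ms_plane(1)[OF MS' v[unfolded P]] J by simp
    with J show "J = J' \<and> V = V'" by simp
  qed
qed

definition moment_map :: "real^6^6 \<Rightarrow> real^3" where
  "moment_map \<omega> = vector [\<omega>$1$2, \<omega>$3$4, \<omega>$5$6]"

end

theory Submission
  imports Defs
begin

text \<open>
  The frame identifies \<open>real^6\<close> with \<open>complex^3\<close> so that the Lie bracket becomes the complex bilinear map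
  \<open>[z, w] = (0, 0, w\<^sub>1 z\<^sub>2 - z\<^sub>1 w\<^sub>2)\<close>, whose image is the centre \<open>Z\<close>, the third coordinate line. Let \<open>J0\<close> be
  multiplication by \<open>\<i>\<close>.

  \<^emph>\<open>Which \<open>J\<close> are integrable.\<close> The Nijenhuis tensor is tensorial, so integrability is an algebraic condition
  on the matrix \<open>J\<close>. It forces \<open>J Z = Z\<close> (\<open>integrable_preserves_centre\<close>), so \<open>J\<close> acts on \<open>Z\<close> as \<open>\<epsilon> \<i>\<close>
  with a sign \<open>\<epsilon>\<close> and on the orthogonal complement \<open>complex^2\<close> as a complex structure \<open>A\<close>, self-dual or
  anti-self-dual. If \<open>A\<close> is self-dual, the remaining condition gives \<open>A = \<epsilon> \<i>\<close>, so \<open>J = \<epsilon> J0\<close>. If it is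
  anti-self-dual it commutes with \<open>\<i>\<close>, that is, \<open>A = \<i> (1 - 2 Q)\<close> with \<open>Q\<close> the projection onto a complex line
  \<open>\<langle>u\<rangle>\<close>. The orientation then leaves \<open>J0\<close> and the structures with \<open>\<epsilon> = -1\<close>, a projective line
  (\<open>integrable_positive_ocs\<close>), and both kinds are integrable.

  \<^emph>\<open>Which planes occur.\<close> Every \<open>J0\<close>-complex line is of class \<open>\<V>\<^sub>3\<^sub>4\<^sub>5\<close>: it is abelian, its second fundamental form is
  pure trace because the bracket is complex bilinear, and the trace over the complement vanishes because
  \<open>ad z\<close> is nilpotent (\<open>class_V_complex_line\<close>). So \<open>J0\<close> contributes a projective plane. For the other \<open>J\<close>,
  class \<open>\<V>\<^sub>3\<^sub>4\<^sub>5\<close> forces \<open>J = J0\<close> or \<open>J = - J0\<close> on \<open>V\<close>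
  (\<open>twisted_class_V_necessary\<close>). In the first case \<open>V\<close> is the complement of \<open>u\<close> in \<open>complex^2\<close>, determined by \<open>J\<close>,
  and this gives a projective line; in the second case \<open>V\<close> is any complex line in \<open>\<langle>u\<rangle> \<oplus> Z\<close>, and this gives a bundle of
  projective lines over a projective line.

  \<^emph>\<open>The forms.\<close> All resulting 2-forms are \<open>form_of X\<close> with \<open>X\<close> a Hermitian matrix: for the three families \<open>X\<close> is
  \<open>- 1 + (2 + \<alpha>) p\<close>, \<open>1 + \<alpha> P\<close> and \<open>1 - 2 S - \<alpha> P\<close> with projections \<open>p\<close>, \<open>P\<close>, \<open>S\<close>
  (\<open>invariant_mixed_structures_forms\<close>). The first two are affine images of projective spaces. In the third, \<open>S\<close> is the
  projection onto \<open>\<langle>u\<rangle> \<oplus> Z\<close> and \<open>P\<close> a projection onto a line in it; \<open>1 - S\<close> is a spectral projection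
  of \<open>X\<close>, hence a polynomial in \<open>X\<close>, which makes the bundle projection smooth, and a local unit section
  \<open>u\<close> trivializes the bundle. The moment map reads off the diagonal of \<open>X\<close>, which gives the three polygons, and
  the trace of \<open>X\<close> separates the three families.
\<close>

section \<open>Smooth maps\<close>

lemma Ck_on_cong:
  assumes "open U" "\<And>x. x \<in> U \<Longrightarrow> f x = g x" "Ck_on k U f"
  shows "Ck_on k U g"
  using assms(2,3)
proof (induction k arbitrary: f g)
  case 0
  then show ?case unfolding Ck_on.simps by (metis continuous_on_eq)
next
  case (Suc k)
  have d: "(g has_derivative frechet_derivative f (at x)) (at x)" if "x \<in> U" for x
  proof -
    have "(f has_derivative frechet_derivative f (at x)) (at x)"
      using Suc.prems(2) that by (simp add: frechet_derivative_works[symmetric])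
    from has_derivative_transform_within_open[OF this assms(1) that Suc.prems(1)] show ?thesis .
  qed
  then have "frechet_derivative f (at x) v = frechet_derivative g (at x) v" if "x \<in> U" for x v
    using frechet_derivative_at that by metis
  then have "Ck_on k U (\<lambda>x. frechet_derivative g (at x) v)" for v
  proof (rule Suc.IH)
    show "Ck_on k U (\<lambda>x. frechet_derivative f (at x) v)" using Suc.prems(2) by simp
  qed simp
  with d show ?case by (auto simp: differentiable_def)
qed

text \<open>A derivative only has to be exhibited; that it is the \<open>frechet_derivative\<close> of the definition of
  \<open>Ck_on\<close> is then automatic. The closure properties below follow from this by induction on \<open>k\<close>.\<close>

lemma Ck_on_SucI:
  assumes "open U" "\<And>x. x \<in> U \<Longrightarrow> (f has_derivative f' x) (at x)" "\<And>v. Ck_on k U (\<lambda>x. f' x v)"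
  shows "Ck_on (Suc k) U f"
proof -
  have "f' x = frechet_derivative f (at x)" if "x \<in> U" for x
    using assms(2)[OF that] by (rule frechet_derivative_at)
  then have "Ck_on k U (\<lambda>x. frechet_derivative f (at x) v)" for v
    using Ck_on_cong[OF assms(1) _ assms(3)[of v]] by simp
  with assms(2) show ?thesis by (auto simp: differentiable_def)
qed

lemma Ck_on_SucD:
  "Ck_on (Suc k) U f \<Longrightarrow> Ck_on k U f"
proof (induction k arbitrary: f)
  case 0
  then show ?case
    by (auto intro!: continuous_at_imp_continuous_on differentiable_imp_continuous_within)
qed auto

lemma Ck_on_Suc_has_derivative:
  "Ck_on (Suc k) U f \<Longrightarrow> x \<in> U \<Longrightarrow> (f has_derivative frechet_derivative f (at x)) (at x)"
  by (simp add: frechet_derivative_works[symmetric])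

lemma Ck_on_const: "Ck_on k U (\<lambda>_. c)"
  by (induction k arbitrary: c) (simp_all add: frechet_derivative_const)

lemma Ck_on_bounded_linear:
  assumes "open U" "bounded_linear f"
  shows "Ck_on k U f"
proof (cases k)
  case 0
  then show ?thesis using linear_continuous_on[OF assms(2)] by simp
next
  case (Suc j)
  then show ?thesis
    using Ck_on_SucI[OF assms(1) bounded_linear_imp_has_derivative[OF assms(2)] Ck_on_const] by simp
qed

lemma Ck_on_linear_compose:
  assumes "open U" "bounded_linear L" "Ck_on k U f"
  shows "Ck_on k U (\<lambda>x. L (f x))"
  using assms(3)
proof (induction k arbitrary: f)
  case 0
  then show ?case using linear_continuous_on_compose[of U f L] assms(2)
    by (auto simp: linear_conv_bounded_linear)
next
  case (Suc k)
  show ?case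
  proof (rule Ck_on_SucI[OF assms(1)])
    show "((\<lambda>x. L (f x)) has_derivative (\<lambda>v. L (frechet_derivative f (at x) v))) (at x)" if "x \<in> U" for x
      by (rule bounded_linear.has_derivative[OF assms(2) Ck_on_Suc_has_derivative[OF Suc.prems that]])
    show "Ck_on k U (\<lambda>x. L (frechet_derivative f (at x) v))" for v
      by (rule Suc.IH) (use Suc.prems in simp)
  qed
qed

lemma Ck_on_add:
  assumes "open U" "Ck_on k U f" "Ck_on k U g"
  shows "Ck_on k U (\<lambda>x. f x + g x)"
  using assms(2,3)
proof (induction k arbitrary: f g)
  case 0
  then show ?case by (simp add: continuous_on_add)
next
  case (Suc k)
  show ?case
  proof (rule Ck_on_SucI[OF assms(1)])
    show "((\<lambda>x. f x + g x) has_derivative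
        (\<lambda>v. frechet_derivative f (at x) v + frechet_derivative g (at x) v)) (at x)" if "x \<in> U" for x
      by (rule has_derivative_add; rule Ck_on_Suc_has_derivative; fact)
    show "Ck_on k U (\<lambda>x. frechet_derivative f (at x) v + frechet_derivative g (at x) v)" for v
      by (rule Suc.IH) (use Suc.prems in simp_all)
  qed
qed

lemma Ck_on_bounded_bilinear:
  assumes "open U" "bounded_bilinear B" "Ck_on k U f" "Ck_on k U g"
  shows "Ck_on k U (\<lambda>x. B (f x) (g x))"
  using assms(3,4)
proof (induction k arbitrary: f g)
  case 0
  then show ?case by (simp add: bounded_bilinear.continuous_on[OF assms(2)])
next
  case (Suc k)
  note f = Ck_on_Suc_has_derivative[OF Suc.prems(1)] and g = Ck_on_Suc_has_derivative[OF Suc.prems(2)]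
  show ?case
  proof (rule Ck_on_SucI[OF assms(1) bounded_bilinear.FDERIV[OF assms(2) f g]])
    fix v
    have "Ck_on k U (\<lambda>x. B (f x) (frechet_derivative g (at x) v))"
      by (rule Suc.IH) (use Suc.prems Ck_on_SucD[OF Suc.prems(1)] in simp_all)
    moreover have "Ck_on k U (\<lambda>x. B (frechet_derivative f (at x) v) (g x))"
      by (rule Suc.IH) (use Suc.prems Ck_on_SucD[OF Suc.prems(2)] in simp_all)
    ultimately show "Ck_on k U (\<lambda>x. B (f x) (frechet_derivative g (at x) v) + B (frechet_derivative f (at x) v) (g x))"
      by (rule Ck_on_add[OF assms(1)])
  qed
qed

text \<open>The function \<open>r = 1 / sqrt f\<close> satisfies \<open>r' = - r\<^sup>3 f' / 2\<close>. Thus \<open>r'\<close> is polynomial in \<open>r\<close> and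
  \<open>f'\<close>, and the induction closes without a general chain rule. This function normalizes vectors.\<close>

lemma Ck_on_inverse_sqrt:
  fixes f :: "'a::euclidean_space \<Rightarrow> real"
  assumes "open U" "\<And>x. x \<in> U \<Longrightarrow> f x > 0" "Ck_on k U f"
  shows "Ck_on k U (\<lambda>x. 1 / sqrt (f x))"
  using assms(3)
proof (induction k)
  case 0
  have "\<forall>x\<in>U. sqrt (f x) \<noteq> 0" using assms(2) by force
  with 0 show ?case by (simp add: continuous_on_divide continuous_on_real_sqrt)
next
  case (Suc k)
  let ?r = "\<lambda>x. 1 / sqrt (f x)"
  show ?case
  proof (rule Ck_on_SucI[OF assms(1)])
    fix x assume x: "x \<in> U"
    define g where "g = frechet_derivative f (at x)"
    have f: "(f has_derivative g) (at x)"
      unfolding g_def by (rule Ck_on_Suc_has_derivative[OF Suc.prems x])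
    have pos: "f x > 0" by (rule assms(2)[OF x])
    have "((\<lambda>t. 1 / sqrt t) has_real_derivative - (1/2) * (?r x * (?r x * ?r x))) (at (f x))"
      using pos by (auto intro!: derivative_eq_intros simp: field_simps)
    from has_derivative_compose[OF f this[unfolded has_field_derivative_def]]
    show "(?r has_derivative (\<lambda>v. - (1/2) * (?r x * (?r x * ?r x)) * frechet_derivative f (at x) v)) (at x)"
      unfolding g_def .
  next
    fix v
    have r: "Ck_on k U ?r" using Suc.IH Ck_on_SucD[OF Suc.prems] .
    show "Ck_on k U (\<lambda>x. - (1/2) * (?r x * (?r x * ?r x)) * frechet_derivative f (at x) v)"
      by (intro Ck_on_bounded_bilinear[OF assms(1) bounded_bilinear_mult] Ck_on_const r)
        (use Suc.prems in simp)
  qed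
qed

lemma smooth_on_open_const: "smooth_on_open U (\<lambda>_. c)"
  by (simp add: smooth_on_open_def Ck_on_const)

lemma smooth_on_open_linear: "open U \<Longrightarrow> linear f \<Longrightarrow> smooth_on_open U f"
  by (simp add: smooth_on_open_def Ck_on_bounded_linear linear_conv_bounded_linear)

lemma smooth_on_open_linear_compose:
  "open U \<Longrightarrow> linear L \<Longrightarrow> smooth_on_open U f \<Longrightarrow> smooth_on_open U (\<lambda>x. L (f x))"
  by (simp add: smooth_on_open_def Ck_on_linear_compose linear_conv_bounded_linear)

lemma smooth_on_open_add:
  "open U \<Longrightarrow> smooth_on_open U f \<Longrightarrow> smooth_on_open U g \<Longrightarrow> smooth_on_open U (\<lambda>x. f x + g x)"
  by (simp add: smooth_on_open_def Ck_on_add)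

lemma smooth_on_open_bilinear:
  "open U \<Longrightarrow> bilinear B \<Longrightarrow> smooth_on_open U f \<Longrightarrow> smooth_on_open U g \<Longrightarrow>
    smooth_on_open U (\<lambda>x. B (f x) (g x))"
  by (simp add: smooth_on_open_def Ck_on_bounded_bilinear bilinear_conv_bounded_bilinear)

lemma smooth_on_open_inverse_sqrt:
  fixes f :: "'a::euclidean_space \<Rightarrow> real"
  shows "open U \<Longrightarrow> (\<And>x. x \<in> U \<Longrightarrow> f x > 0) \<Longrightarrow> smooth_on_open U f \<Longrightarrow>
    smooth_on_open U (\<lambda>x. 1 / sqrt (f x))"
  by (simp add: smooth_on_open_def Ck_on_inverse_sqrt)

lemma smooth_on_open_diff:
  "open U \<Longrightarrow> smooth_on_open U f \<Longrightarrow> smooth_on_open U g \<Longrightarrow> smooth_on_open U (\<lambda>x. f x - g x)"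
  using smooth_on_open_add[of U f "\<lambda>x. - g x"]
    smooth_on_open_linear_compose[of U uminus g] by (simp add: linear_uminus)

lemma smooth_on_open_scaleR:
  "open U \<Longrightarrow> smooth_on_open U r \<Longrightarrow> smooth_on_open U f \<Longrightarrow> smooth_on_open U (\<lambda>x. r x *\<^sub>R f x)"
  by (rule smooth_on_open_bilinear[where B = scaleR])
    (simp_all add: bilinear_conv_bounded_bilinear bounded_bilinear_scaleR)

lemma smooth_on_open_Pair:
  assumes "open U" "smooth_on_open U f" "smooth_on_open U g"
  shows "smooth_on_open U (\<lambda>x. (f x, g x))"
proof -
  have "smooth_on_open U (\<lambda>x. (f x, 0) + (0, g x))"
    by (rule smooth_on_open_add[OF assms(1)
          smooth_on_open_linear_compose[OF assms(1) _ assms(2), of "\<lambda>y. (y, 0)"]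
          smooth_on_open_linear_compose[OF assms(1) _ assms(3), of "\<lambda>y. (0, y)"]])
      (auto intro!: linearI)
  then show ?thesis by simp
qed

lemma smooth_mapI:
  assumes "open U" "X \<subseteq> U" "smooth_on_open U F" "\<And>x. x \<in> X \<Longrightarrow> F x = f x"
  shows "smooth_map X f"
  unfolding smooth_map_def using assms by blast

lemma smooth_map_cong: "smooth_map X f \<Longrightarrow> (\<And>x. x \<in> X \<Longrightarrow> f x = g x) \<Longrightarrow> smooth_map X g"
  unfolding smooth_map_def by (metis IntD1)

lemma diffeomorphismI:
  assumes "smooth_map X f" "smooth_map Y g" "f ` X \<subseteq> Y" "g ` Y \<subseteq> X"
    and gf: "\<And>x. x \<in> X \<Longrightarrow> g (f x) = x" and fg: "\<And>y. y \<in> Y \<Longrightarrow> f (g y) = y"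
  shows "diffeomorphism X Y f"
proof -
  have bij: "bij_betw f X Y" using assms by (intro bij_betw_byWitness[of _ g]) auto
  have "inv_into X f y = g y" if "y \<in> Y" for y
    using that assms by (intro inv_into_f_eq) (auto intro: bij_betw_imp_inj_on[OF bij])
  then have "smooth_map Y (inv_into X f)" by (intro smooth_map_cong[OF assms(2)]) simp
  with bij assms(1) show ?thesis by (simp add: diffeomorphism_def)
qed

section \<open>Complex coordinates\<close>

lemma UNIV_6: "UNIV = {1, 2, 3, 4, 5, 6 :: 6}"
  using exhaust_6 by auto

lemma sum_6: "sum f (UNIV :: 6 set) = f 1 + f 2 + f 3 + f 4 + f 5 + f 6"
  unfolding UNIV_6 by (simp add: ac_simps)

definition cvec :: "real^6 \<Rightarrow> complex^3" where
  "cvec x = vector [Complex (x$1) (x$2), Complex (x$3) (x$4), Complex (x$5) (x$6)]"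

definition rvec :: "complex^3 \<Rightarrow> real^6" where
  "rvec z = vector [Re (z$1), Im (z$1), Re (z$2), Im (z$2), Re (z$3), Im (z$3)]"

lemma cvec_rvec [simp]: "cvec (rvec z) = z"
  by (simp add: cvec_def rvec_def vec_eq_iff forall_3)

lemma rvec_cvec [simp]: "rvec (cvec x) = x"
  by (simp add: cvec_def rvec_def vec_eq_iff forall_6)

lemma linear_cvec: "linear cvec"
  by (rule linearI) (simp_all add: cvec_def vec_eq_iff forall_3 complex_eq_iff)

lemma linear_rvec: "linear rvec"
  by (rule linearI) (simp_all add: rvec_def vec_eq_iff forall_6)

lemmas cvec_simps = linear_0[OF linear_cvec] linear_add[OF linear_cvec] linear_diff[OF linear_cvec]
  linear_neg[OF linear_cvec] linear_scale[OF linear_cvec]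
lemmas rvec_simps = linear_0[OF linear_rvec] linear_add[OF linear_rvec] linear_diff[OF linear_rvec]
  linear_neg[OF linear_rvec] linear_scale[OF linear_rvec]

lemma inner_rvec: "rvec z \<bullet> rvec w = Re (z$1 * cnj (w$1) + z$2 * cnj (w$2) + z$3 * cnj (w$3))"
  by (simp add: inner_vec_def sum_6 rvec_def)

lemma inner_cvec: "x \<bullet> y = Re (cvec x$1 * cnj (cvec y$1) + cvec x$2 * cnj (cvec y$2) + cvec x$3 * cnj (cvec y$3))"
  using inner_rvec[of "cvec x" "cvec y"] by simp

lemma norm_rvec: "norm (rvec z) = norm z"
  by (simp add: norm_eq_sqrt_inner inner_rvec) (simp add: inner_vec_def sum_3 inner_complex_def)

definition realify :: "complex^3^3 \<Rightarrow> real^6^6" where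
  "realify K = matrix (\<lambda>x. rvec (K *v cvec x))"

lemma linear_cmatrix: "linear (\<lambda>z::complex^'n. (K::complex^'n^'m) *v z)"
  by (rule linearI) (simp_all add: matrix_vector_right_distrib,
    simp add: matrix_vector_mult_def vec_eq_iff scaleR_sum_right)

lemma realify_mult_vec: "realify K *v x = rvec (K *v cvec x)"
proof -
  have "linear (rvec \<circ> ((*v) K \<circ> cvec))"
    by (intro linear_compose linear_rvec linear_cvec linear_cmatrix)
  from fun_cong[OF matrix_vector_mul(2)[OF this], of x] show ?thesis by (simp add: realify_def o_def)
qed

lemma realify_mult: "realify (K ** L) = realify K ** realify L"
  by (simp add: matrix_eq realify_mult_vec matrix_vector_mul_assoc[symmetric])

lemma mat_mult_nth: "(mat c ** A) $ i $ j = c * A $ i $ j" for A :: "complex^'n^'m"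
proof -
  have "(mat c ** A) $ i $ j = (\<Sum>k\<in>UNIV. if k = i then c * A $ k $ j else 0)"
    unfolding matrix_matrix_mult_def mat_def vec_lambda_beta by (rule sum.cong) auto
  then show ?thesis by simp
qed

lemma realify_1 [simp]: "realify (mat 1) = mat 1"
  by (simp add: matrix_eq realify_mult_vec)

lemma realify_add: "realify (K + L) = realify K + realify L"
  by (simp add: matrix_eq realify_mult_vec matrix_vector_mult_add_rdistrib rvec_simps)

lemma scaleR_matrix_vector: "(r *\<^sub>R K) *v z = r *\<^sub>R (K *v (z::complex^'n))"
  by (simp add: matrix_vector_mult_def vec_eq_iff scaleR_sum_right)

lemma realify_scaleR: "realify (r *\<^sub>R K) = r *\<^sub>R realify K"
  by (simp add: matrix_eq realify_mult_vec scaleR_matrix_vector rvec_simps scaleR_matrix_vector_assoc[symmetric])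

lemma linear_realify: "linear realify"
  by (intro linearI realify_add realify_scaleR)

lemma realify_nth: "realify K $ i $ j = rvec (K *v cvec (axis j 1)) $ i"
  by (simp add: realify_mult_vec[symmetric] matrix_vector_mult_basis column_def)

definition conj_transpose :: "complex^'n^'m \<Rightarrow> complex^'m^'n" where
  "conj_transpose A = (\<chi> i j. cnj (A $ j $ i))"

lemma realify_conj_transpose: "realify (conj_transpose K) = transpose (realify K)"
  by (simp add: vec_eq_iff forall_6 realify_nth transpose_def conj_transpose_def rvec_def cvec_def
      matrix_vector_mult_def sum_3 axis_def)

text \<open>The inequality holds because the invertible complex matrices are connected: on the complex
  line from the identity to \<open>K\<close> the complex determinant is a nonzero polynomial, so that off a finite
  set, which does not disconnect the plane, the real determinant does not vanish and keeps its sign.\<close>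

lemma det_realify_nonneg: "det (realify K) \<ge> 0"
proof (rule ccontr)
  assume neg: "\<not> det (realify K) \<ge> 0"
  define L where "L z = mat 1 + mat z ** (K - mat 1)" for z
  define p where "p = det (\<chi> i j. [:(mat 1 :: complex^3^3) $ i $ j, (K - mat 1) $ i $ j:])"
  have L: "L z $ i $ j = mat 1 $ i $ j + z * (K - mat 1) $ i $ j" for z i j
  proof -
    show ?thesis by (simp add: L_def mat_mult_nth)
  qed
  have p: "poly p z = det (L z)" for z
    unfolding p_def det_def poly_sum poly_mult poly_prod
    by (intro sum.cong refl) (simp add: L)
  have L01: "L 0 = mat 1" "L 1 = K" by (simp_all add: vec_eq_iff L)
  have "poly p 0 = 1" unfolding p L01 by simp
  then have "p \<noteq> 0" by auto
  then have S: "countable {z. poly p z = 0}" by (intro countable_finite poly_roots_finite)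
  have inv: "det (realify (L z)) \<noteq> 0" if "poly p z \<noteq> 0" for z
  proof -
    have "invertible (L z)" using that by (simp add: p invertible_det_nz)
    then obtain B where "L z ** B = mat 1" by (auto simp: invertible_def)
    then have "realify (L z) ** realify B = mat 1" by (simp flip: realify_mult)
    then have "det (realify (L z)) * det (realify B) = 1" by (simp flip: det_mul)
    then show ?thesis by auto
  qed
  define g where "g z = det (realify (L z))" for z
  define Z where "Z = {z. g z = 0}"
  have "Z \<subseteq> {z. poly p z = 0}" using inv by (auto simp: Z_def g_def)
  then have "countable Z" using S by (rule countable_subset)
  then have conn: "connected (- Z)"
    using path_connected_complement_countable[of Z] by (intro path_connected_imp_connected) simp
  have "continuous_on (- Z) (\<lambda>z. realify (L z) $ i $ j)" for i j
  proof -
    have eq: "L = (\<lambda>z. \<chi> i j. mat 1 $ i $ j + z * (K - mat 1) $ i $ j)"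
      by (simp add: fun_eq_iff vec_eq_iff L)
    have "continuous_on (- Z) L"
      unfolding eq by (intro continuous_on_vec_lambda continuous_intros)
    then have "continuous_on (- Z) (\<lambda>z. realify (L z))"
      by (intro linear_continuous_on_compose[OF _ linear_realify])
    then show ?thesis by (intro continuous_on_component)
  qed
  then have "continuous_on (- Z) g"
    unfolding g_def det_def by (intro continuous_on_sum continuous_on_mult continuous_on_prod continuous_on_const)
  then have "connected (g ` (- Z))" using conn by (intro connected_continuous_image)
  moreover have "g 0 = 1" "g 1 < 0" using neg by (simp_all add: g_def L01)
  then have "1 \<in> g ` (- Z)" "g 1 \<in> g ` (- Z)" by (auto simp: Z_def image_iff intro!: exI[of _ 0])
  ultimately have "0 \<in> g ` (- Z)"
    using \<open>g 1 < 0\<close> connectedD_interval[of "g ` (- Z)" "g 1" 1 0] by simp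
  then show False by (auto simp: Z_def)
qed

section \<open>Complex structures and the orientation\<close>

abbreviation J0 :: "real^6^6" where "J0 \<equiv> realify (mat \<i>)"

lemma matrix_mult_transpose_rows: "M ** transpose W = (\<chi> i. W *v (M $ i))" for W :: "real^'n^'m"
  by (simp add: vec_eq_iff matrix_matrix_mult_def matrix_vector_mult_def transpose_def mult.commute)

lemma det_standard_basis_nonneg:
  "det (vector [v1, J0 *v v1, v2, J0 *v v2, v3, J0 *v v3] :: real^6^6) \<ge> 0"
proof -
  have "vector [v1, J0 *v v1, v2, J0 *v v2, v3, J0 *v v3] =
      transpose (realify (transpose (vector [cvec v1, cvec v2, cvec v3])))"
    unfolding realify_mult_vec
    by (simp add: vec_eq_iff forall_6 realify_nth transpose_def rvec_def cvec_def
      matrix_vector_mult_def sum_3 axis_def mat_def)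
  then show ?thesis by (simp add: det_realify_nonneg)
qed

text \<open>A complex structure that is conjugate to the standard one by \<open>W\<close> carries the orientation of the
  standard one to that of \<open>W\<close>, so only the sign of \<open>det W\<close> matters.\<close>

lemma positive_iff_det_pos:
  fixes J :: "real^6^6"
  assumes JW: "J ** W = W ** J0" and W: "det W \<noteq> 0"
  shows "(\<forall>v1 v2 v3. let d = det (vector [v1, J *v v1, v2, J *v v2, v3, J *v v3] :: real^6^6)
        in d \<noteq> 0 \<longrightarrow> d > 0) \<longleftrightarrow> det W > 0"
proof -
  define f where "f J v1 v2 v3 = det (vector [v1, J *v v1, v2, J *v v2, v3, J *v v3] :: real^6^6)"
    for J :: "real^6^6" and v1 v2 v3
  have fW: "f J (W *v v1) (W *v v2) (W *v v3) = f J0 v1 v2 v3 * det W" for v1 v2 v3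
  proof -
    have "J *v (W *v v) = W *v (J0 *v v)" for v
      by (simp add: matrix_vector_mul_assoc JW)
    then have "(vector [W *v v1, J *v (W *v v1), W *v v2, J *v (W *v v2), W *v v3, J *v (W *v v3)] :: real^6^6) =
        vector [v1, J0 *v v1, v2, J0 *v v2, v3, J0 *v v3] ** transpose W"
      unfolding matrix_mult_transpose_rows by (intro vec_eq_iff[THEN iffD2]) (simp add: forall_6)
    then show ?thesis unfolding f_def by (simp add: det_mul)
  qed
  have surj: "\<exists>u. v = W *v u" for v
  proof -
    obtain W' where "W ** W' = mat 1" using W invertible_det_nz invertible_def by metis
    then have "W *v (W' *v v) = v" by (simp add: matrix_vector_mul_assoc)
    then show ?thesis by metis
  qed
  have "f J0 (axis 1 1) (axis 3 1) (axis 5 1) = det (mat 1 :: real^6^6)"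
    unfolding f_def realify_mult_vec by (rule arg_cong[where f = det])
      (simp add: vec_eq_iff forall_6 rvec_def cvec_def
        matrix_vector_mult_def sum_3 axis_def mat_def)
  then have one: "f J0 (axis 1 1) (axis 3 1) (axis 5 1) = 1" by simp
  have "(\<forall>v1 v2 v3. f J v1 v2 v3 \<ge> 0) \<longleftrightarrow> det W > 0"
  proof
    assume "\<forall>v1 v2 v3. f J v1 v2 v3 \<ge> 0"
    then have "0 \<le> f J0 (axis 1 1) (axis 3 1) (axis 5 1) * det W" by (metis fW)
    then show "det W > 0" using W by (simp add: one)
  next
    assume "det W > 0"
    then have "f J (W *v v1) (W *v v2) (W *v v3) \<ge> 0" for v1 v2 v3
      unfolding fW using det_standard_basis_nonneg by (simp add: f_def)
    then show "\<forall>v1 v2 v3. f J v1 v2 v3 \<ge> 0" by (metis surj)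
  qed
  then show ?thesis unfolding f_def Let_def by (metis less_eq_real_def)
qed

section \<open>The Lie algebra and the Nijenhuis tensor\<close>

text \<open>The bracket of left-invariant fields in frame coordinates: the structure equation is
  \<open>d(e\<^sup>5 + \<i> e\<^sup>6) = dz\<^sup>1 \<and> dz\<^sup>2\<close>, and the sign is that of \<open>d\<theta>(X, Y) = - \<theta>([X, Y])\<close>.\<close>

definition bracket :: "real^6 \<Rightarrow> real^6 \<Rightarrow> real^6" where
  "bracket x y = rvec (vector [0, 0, cvec y $ 1 * cvec x $ 2 - cvec x $ 1 * cvec y $ 2])"

lemma cvec_frame: "frame p x $ 1 = cvec x $ 1" "frame p x $ 2 = cvec x $ 2"
  by (simp_all add: frame_def cvec_def)

lemma coframe_variation_frame:
  "coframe_variation (frame p x) (frame p y) = rvec (vector [0, 0, cvec x $ 1 * cvec y $ 2])"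
  by (simp add: coframe_variation_def cvec_frame rvec_def vec_eq_iff forall_6)

lemma bracket_eq_variation:
  "bracket x y = coframe_variation (frame p y) (frame p x) - coframe_variation (frame p x) (frame p y)"
  unfolding coframe_variation_frame bracket_def by (simp add: vec_eq_iff forall_6 rvec_def)

lemma frame_has_derivative:
  assumes "(\<xi> has_derivative \<xi>') (at p)"
  shows "((\<lambda>q. frame q (\<xi> q)) has_derivative
    (\<lambda>t. frame p (\<xi>' t - coframe_variation t (frame p (\<xi> p))))) (at p)"
proof -
  define B :: "complex^3 \<Rightarrow> real^6 \<Rightarrow> complex^3" where "B q x = vector [0, 0, q$1 * cvec x $ 2]" for q x
  have "bilinear B"
    by (auto simp: bilinear_def B_def vec_eq_iff forall_3 cvec_simps algebra_simps intro!: linearI)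
  then have B: "bounded_bilinear B" by (simp add: bilinear_conv_bounded_bilinear)
  have F: "bounded_linear (frame 0)" using frame_linear by (simp add: linear_conv_bounded_linear)
  have frame_B: "frame q x = frame 0 x + B q x" for q x
    by (simp add: frame_def B_def vec_eq_iff forall_3 cvec_def)
  have "((\<lambda>q. frame 0 (\<xi> q) + B q (\<xi> q)) has_derivative
      (\<lambda>t. frame 0 (\<xi>' t) + (B p (\<xi>' t) + B t (\<xi> p)))) (at p)"
    by (intro has_derivative_add bounded_linear.has_derivative[OF F assms]
        bounded_bilinear.FDERIV[OF B has_derivative_ident assms])
  moreover have "frame 0 (\<xi>' t) + (B p (\<xi>' t) + B t (\<xi> p)) =
      frame p (\<xi>' t - coframe_variation t (frame p (\<xi> p)))" for t
    by (simp add: frame_def B_def vec_eq_iff forall_3 cvec_def coframe_variation_def complex_eq_iff algebra_simps)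
  ultimately show ?thesis unfolding frame_B[symmetric] by simp
qed

text \<open>For fields with arbitrary coefficient functions, the derivatives of the frame itself contribute exactly
  the bracket of the Lie algebra.\<close>

lemma lie_bracket_frame:
  assumes "(\<xi> has_derivative \<xi>') (at p)" "(\<eta> has_derivative \<eta>') (at p)"
  shows "lie_bracket (\<lambda>q. frame q (\<xi> q)) (\<lambda>q. frame q (\<eta> q)) p =
    frame p (\<eta>' (frame p (\<xi> p)) - \<xi>' (frame p (\<eta> p)) + bracket (\<xi> p) (\<eta> p))"
  unfolding lie_bracket_def frechet_derivative_at[OF frame_has_derivative[OF assms(1)], symmetric]
    frechet_derivative_at[OF frame_has_derivative[OF assms(2)], symmetric]
    bracket_eq_variation[of _ _ p]
  by (simp add: linear_diff[OF frame_linear] linear_add[OF frame_linear])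

definition nij :: "real^6^6 \<Rightarrow> real^6 \<Rightarrow> real^6 \<Rightarrow> real^6" where
  "nij J x y = bracket (J *v x) (J *v y) - bracket x y - J *v bracket (J *v x) y - J *v bracket x (J *v y)"

lemma complex_structure_square:
  fixes J :: "real^'n^'n"
  assumes "J ** J = - mat 1"
  shows "J *v (J *v x) = - x"
proof -
  have "J *v (J *v x) + mat 1 *v x = (- mat 1 + mat 1) *v x"
    unfolding matrix_vector_mul_assoc assms matrix_vector_mult_add_rdistrib ..
  then have "J *v (J *v x) + x = 0" by (simp only: add.left_inverse matrix_vector_mult_0 matrix_vector_mul_lid)
  then show ?thesis by (simp add: eq_neg_iff_add_eq_0)
qed

text \<open>Tensoriality: the terms with derivatives of the coefficient functions cancel because \<open>J\<^sup>2 = - 1\<close>, so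
  the Nijenhuis tensor on arbitrary fields is the algebraic expression \<open>nij\<close> in their values.\<close>

lemma nijenhuis_eq_nij:
  assumes J: "J ** J = - mat 1" and X: "X differentiable (at p)" and Y: "Y differentiable (at p)"
  shows "nijenhuis J X Y p = frame p (nij J (coframe p (X p)) (coframe p (Y p)))"
proof -
  define \<xi> where "\<xi> q = coframe q (X q)" for q
  define \<eta> where "\<eta> q = coframe q (Y q)" for q
  have X_eq: "X = (\<lambda>q. frame q (\<xi> q))" and Y_eq: "Y = (\<lambda>q. frame q (\<eta> q))"
    by (simp_all add: \<xi>_def \<eta>_def frame_coframe)
  have JX: "invariant_endo J X = (\<lambda>q. frame q (J *v \<xi> q))" and JY: "invariant_endo J Y = (\<lambda>q. frame q (J *v \<eta> q))"
    by (simp_all add: fun_eq_iff invariant_endo_def \<xi>_def \<eta>_def)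
  obtain X' Y' where "(X has_derivative X') (at p)" "(Y has_derivative Y') (at p)"
    using X Y by (auto simp: differentiable_def)
  from this[THEN coframe_base_deriv] obtain \<xi>' \<eta>'
    where d: "(\<xi> has_derivative \<xi>') (at p)" "(\<eta> has_derivative \<eta>') (at p)"
    unfolding \<xi>_def[abs_def, symmetric] \<eta>_def[abs_def, symmetric] by blast
  have Jd: "((\<lambda>q. J *v \<xi> q) has_derivative (\<lambda>t. J *v \<xi>' t)) (at p)"
    "((\<lambda>q. J *v \<eta> q) has_derivative (\<lambda>t. J *v \<eta>' t)) (at p)"
    by (rule bounded_linear.has_derivative[OF matrix_vector_mul_bounded_linear], rule d)+
  show ?thesis
    unfolding nijenhuis_def Let_def invariant_endo_def[of J "lie_bracket _ _"] JX JY
    unfolding X_eq Y_eq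
    unfolding lie_bracket_frame[OF d] lie_bracket_frame[OF Jd] lie_bracket_frame[OF Jd(1) d(2)]
      lie_bracket_frame[OF d(1) Jd(2)] coframe_frame nij_def
    by (simp add: linear_diff[OF frame_linear, symmetric] matrix_vector_right_distrib matrix_vector_mult_diff_distrib
      complex_structure_square[OF J] algebra_simps)
qed

lemma class_W34_iff:
  assumes J: "J ** J = - mat 1"
  shows "class_W34 J \<longleftrightarrow> (\<forall>x y. nij J x y = 0)"
proof
  assume W: "class_W34 J"
  have smooth: "smooth_on_open UNIV (\<lambda>q. frame q x)" for x
  proof -
    have "smooth_on_open UNIV (\<lambda>q :: complex^3. frame 0 x + vector [0, 0, q$1 * cvec x $ 2])"
      by (intro smooth_on_open_add smooth_on_open_const smooth_on_open_linear linearI)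
        (simp_all add: vec_eq_iff forall_3 algebra_simps)
    moreover have "(\<lambda>q :: complex^3. frame 0 x + vector [0, 0, q$1 * cvec x $ 2]) = (\<lambda>q. frame q x)"
      by (simp add: fun_eq_iff frame_def vec_eq_iff forall_3 cvec_def)
    ultimately show ?thesis by simp
  qed
  show "\<forall>x y. nij J x y = 0"
  proof (intro allI)
    fix x y
    have diff: "(\<lambda>q. frame q x) differentiable (at 0)" for x
      using frame_has_derivative[OF has_derivative_const] by (auto simp: differentiable_def)
    have "frame 0 (nij J x y) = 0"
      using W smooth nijenhuis_eq_nij[OF J diff diff, of x y] unfolding class_W34_def coframe_frame by metis
    then show "nij J x y = 0" by (metis coframe_frame linear_0[OF coframe_linear])
  qed
next
  assume N: "\<forall>x y. nij J x y = 0"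
  have "X differentiable (at p)" if "smooth_on_open UNIV X" for X :: vfield and p
    using that[unfolded smooth_on_open_def, rule_format, of "Suc 0"] by simp
  then show "class_W34 J"
    unfolding class_W34_def using N nijenhuis_eq_nij[OF J] by (simp add: linear_0[OF frame_linear])
qed

section \<open>The intrinsic torsion\<close>

text \<open>The Koszul formula for left-invariant fields, whose inner products are constant.\<close>

lemma connection_form_eq:
  "connection_form p x y z = (bracket x y \<bullet> z - bracket x z \<bullet> y - bracket y z \<bullet> x) / 2"
proof -
  let ?c = "\<lambda>x y. coframe_variation (frame p x) (frame p y)"
  have d: "frechet_derivative (\<lambda>q. frame q y) (at p) = (\<lambda>t. frame p (- coframe_variation t (frame p y)))"
    using frechet_derivative_at[OF frame_has_derivative[OF has_derivative_const[of y]], of p] by simp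
  have "connection_form p x y z = - (?c x y \<bullet> z) + metric p (christoffel p (frame p x) (frame p y)) (frame p z)"
    unfolding connection_form_def levi_civita_def d metric_def
    by (simp add: linear_add[OF coframe_linear] coframe_frame inner_diff_left inner_add_left linear_neg[OF coframe_linear])
  also have "\<dots> = (bracket x y \<bullet> z - bracket x z \<bullet> y - bracket y z \<bullet> x) / 2"
    unfolding christoffel_metric metric_deriv_eq coframe_frame bracket_eq_variation[of _ _ p]
    by (simp add: inner_diff_left inner_diff_right inner_commute field_simps)
  finally show ?thesis .
qed

lemma linear_bracket: "linear (bracket x)"
  by (rule linearI) (simp_all add: bracket_def rvec_def vec_eq_iff forall_6 cvec_simps algebra_simps)

lemma bracket_swap: "bracket y x = - bracket x y"
  by (simp add: bracket_def rvec_def vec_eq_iff forall_6)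

lemma skew_part_connection:
  "skew_part (connection_form p) x y z = bracket x y \<bullet> z / 2"
  unfolding skew_part_def connection_form_eq bracket_swap[of y x] by (simp add: field_simps)

lemma sym_part_connection:
  "(connection_form p x y z + connection_form p y x z) / 2 = (bracket z x \<bullet> y + bracket z y \<bullet> x) / 2"
  unfolding connection_form_eq bracket_swap[of y x] bracket_swap[of z] by (simp add: field_simps)

lemma diagonal_connection: "connection_form p b b z = bracket z b \<bullet> b"
  using sym_part_connection[of p b b z] by simp

lemma orthonormal_basis_of_finite:
  assumes "orthonormal_basis_of W B"
  shows "finite B" "card B = dim W"
proof -
  have "independent B"
    using assms by (intro pairwise_orthogonal_independent) (auto simp: orthonormal_basis_of_def)
  then show "finite B" "card B = dim W"
    using assms dim_span_eq_card_independent[of B]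
    by (simp_all add: orthonormal_basis_of_def independent_imp_finite)
qed

lemma orthonormal_basis_of_SOME:
  assumes "subspace W"
  shows "orthonormal_basis_of W (SOME B. orthonormal_basis_of W B)"
  by (rule someI_ex) (use orthonormal_basis_subspace[OF assms] in \<open>metis orthonormal_basis_of_def\<close>)

lemma trace_orthonormal_basis:
  fixes f :: "real^6 \<Rightarrow> real^6"
  assumes f: "linear f" and B: "orthonormal_basis_of UNIV B"
  shows "(\<Sum>b\<in>B. f b \<bullet> b) = (\<Sum>i\<in>Basis. f i \<bullet> i)"
proof -
  have expand: "(\<Sum>b\<in>B. (x \<bullet> b) *\<^sub>R b) = x" for x
    using B by (intro orthonormal_basis_expand orthonormal_basis_of_finite) (auto simp: orthonormal_basis_of_def)
  have "f b \<bullet> b = (\<Sum>i\<in>Basis. f i \<bullet> ((i \<bullet> b) *\<^sub>R b))" for b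
  proof -
    have "f b = f (\<Sum>i\<in>Basis. (b \<bullet> i) *\<^sub>R i)" by (simp add: euclidean_representation)
    then show ?thesis
      by (simp add: linear_sum[OF f] linear_scale[OF f] inner_sum_left inner_sum_right inner_commute)
  qed
  then have "(\<Sum>b\<in>B. f b \<bullet> b) = (\<Sum>b\<in>B. \<Sum>i\<in>Basis. f i \<bullet> ((i \<bullet> b) *\<^sub>R b))" by simp
  also have "\<dots> = (\<Sum>i\<in>Basis. f i \<bullet> (\<Sum>b\<in>B. (i \<bullet> b) *\<^sub>R b))"
    unfolding inner_sum_right by (rule sum.swap)
  finally show ?thesis by (simp only: expand)
qed

text \<open>The operator \<open>bracket x\<close> maps into the centre and kills it, so its diagonal in the standard
  basis vanishes.\<close>

lemma trace_bracket:
  assumes "orthonormal_basis_of UNIV B"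
  shows "(\<Sum>b\<in>B. bracket x b \<bullet> b) = 0"
proof -
  have "bracket x (axis i 1) \<bullet> axis i 1 = 0" for i
    using exhaust_6[of i] unfolding inner_axis
    by (auto simp: bracket_def rvec_def cvec_def axis_def)
  then have "bracket x i \<bullet> i = 0" if "i \<in> Basis" for i
    using that by (auto simp: Basis_vec_def)
  then show ?thesis unfolding trace_orthonormal_basis[OF linear_bracket assms] by simp
qed

lemma orthonormal_basis_of_Un_comp:
  assumes "orthonormal_basis_of W B" "orthonormal_basis_of (orthogonal_comp W) C"
  shows "orthonormal_basis_of UNIV (B \<union> C)" "B \<inter> C = {}"
proof -
  have sB: "span B = W" and sC: "span C = orthogonal_comp W"
    using assms by (simp_all add: orthonormal_basis_of_def)
  have BW: "B \<subseteq> W" and CW: "C \<subseteq> orthogonal_comp W" and W: "subspace W"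
    using span_superset[of B] span_superset[of C] subspace_span[of B] unfolding sB sC by simp_all
  have orth: "orthogonal b c" if "b \<in> B" "c \<in> C" for b c
    using that BW CW by (auto simp: orthogonal_comp_def)
  have "pairwise orthogonal (B \<union> C)"
    using assms orth unfolding orthonormal_basis_of_def pairwise_def by (metis UnE orthogonal_commute)
  moreover have "span (B \<union> C) = UNIV"
    using subspace_sum_orthogonal_comp[OF W] unfolding span_Un sB sC set_plus_def by blast
  ultimately show "orthonormal_basis_of UNIV (B \<union> C)"
    using assms by (auto simp: orthonormal_basis_of_def)
  show "B \<inter> C = {}" using orth assms unfolding orthonormal_basis_of_def
    by (metis disjoint_iff norm_zero orthogonal_self zero_neq_one)
qed

lemma J0_mult: "J0 *v v = rvec (\<i> *s cvec v)"
proof -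
  have "mat \<i> *v z = \<i> *s z" for z :: "complex^3"
    by (simp add: vec_eq_iff forall_3 matrix_vector_mult_def mat_def sum_3)
  then show ?thesis by (simp add: realify_mult_vec)
qed

lemma in_span_pair:
  assumes "x \<in> span {v, w}"
  obtains a b where "x = a *\<^sub>R v + b *\<^sub>R w"
proof -
  obtain a b where "x - a *\<^sub>R v = b *\<^sub>R w"
    using assms unfolding span_breakdown_eq span_singleton by auto
  then have "x = a *\<^sub>R v + b *\<^sub>R w" by (metis add.commute diff_add_cancel)
  then show ?thesis by (rule that)
qed

lemma complex_line_span:
  assumes "x \<in> span {v, J0 *v v}"
  obtains c where "cvec x = c *s cvec v"
proof -
  obtain a b where "x = a *\<^sub>R v + b *\<^sub>R (J0 *v v)"
    using assms by (rule in_span_pair)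
  then have "cvec x = Complex a b *s cvec v"
    by (simp add: cvec_simps J0_mult) (simp add: vec_eq_iff complex_eq_iff algebra_simps)
  then show ?thesis by (rule that)
qed

text \<open>On a complex line the bracket vanishes since it is complex bilinear and skew. For the same reason, with
  \<open>x = c v\<close> and \<open>y = d v\<close>, the numbers \<open>\<langle>[z, x], y\<rangle>\<close> and \<open>\<langle>[z, y], x\<rangle>\<close> are the
  real parts of \<open>c d\<^sup>* t\<close> and \<open>c\<^sup>* d t\<close> for one complex number \<open>t\<close>; their sum is
  \<open>2 Re (c d\<^sup>*) Re t\<close>, a multiple of the metric. This is the vanishing of the tracefree symmetric part.\<close>

lemma bracket_complex_line:
  assumes x: "x \<in> span {v, J0 *v v}" and y: "y \<in> span {v, J0 *v v}" and v: "norm v = 1"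
  shows "bracket x y = 0"
    and "bracket z x \<bullet> y + bracket z y \<bullet> x = 2 * (x \<bullet> y) * (bracket z v \<bullet> v)"
proof -
  obtain c d where c: "cvec x = c *s cvec v" and d: "cvec y = d *s cvec v"
    using complex_line_span[OF x] complex_line_span[OF y] by metis
  show "bracket x y = 0" by (simp add: bracket_def c d rvec_def vec_eq_iff forall_6)
  define w where "w = cvec v"
  have "v \<bullet> v = 1" using v by (simp add: norm_eq_1)
  then have one: "Re (w$1 * cnj (w$1) + w$2 * cnj (w$2) + w$3 * cnj (w$3)) = 1" by (simp add: inner_cvec w_def)
  have "w$1 * cnj (w$1) + w$2 * cnj (w$2) + w$3 * cnj (w$3) = 1"
    using one by (simp add: complex_eq_iff)
  then have "c * cnj d = c * cnj d * (w$1 * cnj (w$1) + w$2 * cnj (w$2) + w$3 * cnj (w$3))" by simp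
  also have "\<dots> = (c * w$1) * cnj (d * w$1) + (c * w$2) * cnj (d * w$2) + (c * w$3) * cnj (d * w$3)"
    by (simp add: algebra_simps)
  finally have xy: "x \<bullet> y = Re (c * cnj d)" unfolding inner_cvec c d w_def by simp
  define t where "t = (w$1 * cvec z $ 2 - cvec z $ 1 * w $ 2) * cnj (w $ 3)"
  have "bracket z x \<bullet> y + bracket z y \<bullet> x = Re (c * cnj d * t) + Re (d * cnj c * t)"
    unfolding inner_cvec c d bracket_def cvec_rvec by (simp add: t_def w_def[symmetric] algebra_simps)
  also have "\<dots> = 2 * Re (c * cnj d) * Re t" by (simp add: algebra_simps)
  also have "Re t = bracket z v \<bullet> v"
    unfolding inner_cvec bracket_def cvec_rvec by (simp add: t_def w_def[symmetric])
  finally show "bracket z x \<bullet> y + bracket z y \<bullet> x = 2 * (x \<bullet> y) * (bracket z v \<bullet> v)"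
    by (simp only: xy)
qed

lemma class_V_complex_line:
  assumes v: "norm v = 1"
  shows "class_V {3, 4, 5} (span {v, J0 *v v})"
proof -
  define W where "W = span {v, J0 *v v}"
  have W: "subspace W" by (simp add: W_def)
  have "v \<in> W" by (simp add: W_def span_base)
  moreover have "v \<noteq> 0" using v by auto
  ultimately have dim: "dim W \<noteq> 0" by auto
  have 1: "vanishes_on W (orthogonal_comp W) (skew_part (connection_form p))" for p
    using bracket_complex_line(1)[OF _ _ v] by (simp add: vanishes_on_def skew_part_connection W_def)
  have trace: "trace_part W (connection_form p) x y z = (x \<bullet> y) * (bracket z v \<bullet> v)" for p x y z
  proof -
    define B where "B = (SOME B. orthonormal_basis_of W B)"
    have B: "orthonormal_basis_of W B" unfolding B_def by (rule orthonormal_basis_of_SOME[OF W])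
    have "connection_form p b b z = bracket z v \<bullet> v" if "b \<in> B" for b
    proof -
      have "b \<in> W" "norm b = 1" using that B span_base by (auto simp: orthonormal_basis_of_def)
      then show ?thesis using bracket_complex_line(2)[of b v b z] v
        by (simp add: diagonal_connection W_def norm_eq_1)
    qed
    then have "(\<Sum>b\<in>B. connection_form p b b z) = dim W * (bracket z v \<bullet> v)"
      by (simp add: orthonormal_basis_of_finite[OF B])
    then show ?thesis using dim by (simp add: trace_part_def B_def[symmetric])
  qed
  have 2: "vanishes_on W (orthogonal_comp W) (tracefree_sym_part W (connection_form p))" for p
    unfolding vanishes_on_def tracefree_sym_part_def trace sym_part_connection
    using bracket_complex_line(2)[OF _ _ v] by (simp add: W_def)
  \<comment> \<open>On \<open>W\<close> itself \<open>bracket z\<close> vanishes for \<open>z\<close> in \<open>W\<close>, so its trace over the complement is its full trace.\<close>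
  have 6: "vanishes_on (orthogonal_comp W) W (trace_part (orthogonal_comp W) (connection_form p))" for p
    unfolding vanishes_on_def
  proof (intro ballI)
    fix x y z assume z: "z \<in> W"
    define B where "B = (SOME B. orthonormal_basis_of W B)"
    define C where "C = (SOME B. orthonormal_basis_of (orthogonal_comp W) B)"
    have B: "orthonormal_basis_of W B" and C: "orthonormal_basis_of (orthogonal_comp W) C"
      unfolding B_def C_def by (intro orthonormal_basis_of_SOME W subspace_orthogonal_comp)+
    have "bracket z b = 0" if "b \<in> B" for b
    proof -
      have "b \<in> W" using that B span_base by (auto simp: orthonormal_basis_of_def)
      then show ?thesis using bracket_complex_line(1)[OF _ _ v] z by (simp add: W_def)
    qed
    then have "(\<Sum>b\<in>C. bracket z b \<bullet> b) = (\<Sum>b\<in>B \<union> C. bracket z b \<bullet> b)"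
      using orthonormal_basis_of_Un_comp(2)[OF B C]
      by (simp add: sum.union_disjoint orthonormal_basis_of_finite(1)[OF B] orthonormal_basis_of_finite(1)[OF C])
    also have "\<dots> = 0" by (rule trace_bracket[OF orthonormal_basis_of_Un_comp(1)[OF B C]])
    finally show "trace_part (orthogonal_comp W) (connection_form p) x y z = 0"
      by (simp add: trace_part_def C_def[symmetric] diagonal_connection)
  qed
  from 1 2 6 show ?thesis by (simp add: class_V_def Let_def W_def)
qed

text \<open>For orthogonal \<open>x\<close> and \<open>y\<close> the trace part drops out of the tracefree symmetric part, so the
  off-diagonal conditions are free of traces.\<close>

lemma class_V_necessary:
  assumes "class_V {3, 4, 5} W" "x \<in> W" "y \<in> W" "z \<in> orthogonal_comp W"
  shows "bracket x y \<bullet> z = 0" "x \<bullet> y = 0 \<Longrightarrow> bracket z x \<bullet> y + bracket z y \<bullet> x = 0"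
proof -
  have "skew_part (connection_form 0) x y z = 0" "tracefree_sym_part W (connection_form 0) x y z = 0"
    using assms by (auto simp: class_V_def Let_def vanishes_on_def)
  then show "bracket x y \<bullet> z = 0" "x \<bullet> y = 0 \<Longrightarrow> bracket z x \<bullet> y + bracket z y \<bullet> x = 0"
    unfolding skew_part_connection tracefree_sym_part_def sym_part_connection
    by (simp_all add: trace_part_def)
qed

section \<open>The integrable complex structures\<close>

lemma norm_sq_complex: "complex_of_real ((norm z)\<^sup>2) = (\<Sum>i\<in>UNIV. z$i * cnj (z$i))"
proof -
  have "(norm z)\<^sup>2 = (\<Sum>i\<in>UNIV. (cmod (z$i))\<^sup>2)" by (simp add: norm_vec_def L2_set_def sum_nonneg)
  then show ?thesis by (simp add: complex_norm_square del: of_real_power)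
qed

lemma unit_complex_2: "u$1 * cnj (u$1) + u$2 * cnj (u$2) = 1" if "norm u = 1" for u :: "complex^2"
  using norm_sq_complex[of u] that by (simp add: sum_2)

lemma line_proj_unit: "norm z = 1 \<Longrightarrow> line_proj z $ i $ j = z$i * cnj (z$j)"
  by (simp add: line_proj_def)

lemma projective_space_unit:
  assumes "P \<in> projective_space"
  obtains u where "norm u = 1" "P = line_proj u"
proof -
  obtain z where z: "z \<noteq> 0" "P = line_proj z" using assms by (auto simp: projective_space_def)
  define c where "c = complex_of_real (1 / norm z)"
  have "c *s z = (1 / norm z) *\<^sub>R z"
    by (simp add: vec_eq_iff c_def scaleR_conv_of_real[where 'a = complex])
  then have n: "norm (c *s z) = 1" using z by simp
  then have "c *s z \<noteq> 0" by auto
  moreover have "c \<noteq> 0" using z by (simp add: c_def)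
  ultimately have "line_proj z = line_proj (c *s z)" using line_proj_eq_iff z(1) by blast
  with n z show ?thesis using that by metis
qed

lemma line_proj_in_projective_space: "z \<noteq> 0 \<Longrightarrow> line_proj z \<in> projective_space"
  by (simp add: projective_space_def)

lemma conj_transpose_mult: "conj_transpose (A ** B) = conj_transpose B ** conj_transpose A"
  by (simp add: conj_transpose_def matrix_matrix_mult_def vec_eq_iff mult.commute)

lemma J0_positive: "J0 \<in> positive_ocs" and J0_square: "J0 ** J0 = - mat 1"
proof -
  have "mat \<i> ** mat \<i> = (- mat 1 :: complex^3^3)" "conj_transpose (mat \<i>) ** mat \<i> = (mat 1 :: complex^3^3)"
    by (simp_all add: vec_eq_iff forall_3 matrix_matrix_mult_def sum_3 mat_def conj_transpose_def)
  moreover have "realify (- mat 1) = - mat 1" using linear_neg[OF linear_realify, of "mat 1"] by simp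
  ultimately show sq: "J0 ** J0 = - mat 1" and "J0 \<in> positive_ocs"
    using positive_iff_det_pos[of J0 "mat 1"] unfolding positive_ocs_def orthogonal_matrix
    by (simp_all flip: realify_mult realify_conj_transpose)
qed

text \<open>The structure \<open>\<i> (1 - 2 Q)\<close> on the first two coordinates, plus \<open>\<epsilon> \<i>\<close> on the centre. If \<open>Q\<close> is the
  projection onto a line, it is \<open>- \<i>\<close> on this line and \<open>\<i>\<close> on the orthogonal line of \<open>complex^2\<close>.\<close>

definition twisted_ocs :: "real \<Rightarrow> complex^2^2 \<Rightarrow> real^6^6" where
  "twisted_ocs \<epsilon> Q = realify (vector [vector [\<i> * (1 - 2 * Q$1$1), - 2 * \<i> * Q$1$2, 0],
     vector [- 2 * \<i> * Q$2$1, \<i> * (1 - 2 * Q$2$2), 0], vector [0, 0, \<epsilon> * \<i>]])"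

lemma det_diag6:
  "det (vector [axis 1 a, axis 2 b, axis 3 c, axis 4 d, axis 5 e, axis 6 f] :: real^6^6) = a * b * c * d * e * f"
proof -
  have "det (vector [axis 1 a, axis 2 b, axis 3 c, axis 4 d, axis 5 e, axis 6 f] :: real^6^6) =
      (\<Prod>i\<in>UNIV. (vector [axis 1 a, axis 2 b, axis 3 c, axis 4 d, axis 5 e, axis 6 f] :: real^6^6) $ i $ i)"
  proof (rule det_diagonal)
    show "(vector [axis 1 a, axis 2 b, axis 3 c, axis 4 d, axis 5 e, axis 6 f] :: real^6^6) $ i $ j = 0" if "i \<noteq> j" for i j :: 6
      using exhaust_6[of i] that by (auto simp: axis_def)
  qed
  then show ?thesis unfolding UNIV_6 by (simp add: axis_def ac_simps)
qed

text \<open>The unitary matrix \<open>U\<close> with columns an orthogonal vector of \<open>u\<close>, \<open>u\<close> itself and the last basis vector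
  diagonalizes the structure to \<open>D = diag (\<i>, - \<i>, \<epsilon> \<i>)\<close>, and the reflection \<open>R\<close> takes \<open>D\<close> to
  \<open>J0\<close>. Its determinant \<open>- \<epsilon>\<close> decides the orientation, since unitary matrices have positive real
  determinant.\<close>

lemma twisted_ocs_properties:
  assumes u: "norm u = 1" and \<epsilon>: "\<epsilon> = 1 \<or> \<epsilon> = - 1"
  defines "J \<equiv> twisted_ocs \<epsilon> (line_proj u)"
  shows "J \<in> positive_ocs \<longleftrightarrow> \<epsilon> = - 1" "J ** J = - mat 1"
proof -
  define U :: "complex^3^3" where
    "U = vector [vector [- cnj (u$2), u$1, 0], vector [cnj (u$1), u$2, 0], vector [0, 0, 1]]"
  define D :: "complex^3^3" where
    "D = vector [vector [\<i>, 0, 0], vector [0, - \<i>, 0], vector [0, 0, \<epsilon> * \<i>]]"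
  define K where "K = U ** D ** conj_transpose U"
  have u1: "u$1 * cnj (u$1) + u$2 * cnj (u$2) = 1" by (rule unit_complex_2[OF u])
  have J: "J = realify K"
    unfolding J_def twisted_ocs_def line_proj_unit[OF u] K_def
    by (rule arg_cong[where f = realify])
      (simp add: vec_eq_iff forall_3 matrix_matrix_mult_def sum_3 U_def D_def conj_transpose_def, use u1 in algebra)
  have UU: "U ** conj_transpose U = mat 1"
    by (simp add: vec_eq_iff forall_3 matrix_matrix_mult_def sum_3 U_def conj_transpose_def mat_def)
      (use u1 in algebra)
  then have UU': "conj_transpose U ** U = mat 1" by (simp add: matrix_left_right_inverse)
  have DD: "D ** D = - mat 1" "conj_transpose D ** D = mat 1"
    using \<epsilon> by (auto simp: vec_eq_iff forall_3 matrix_matrix_mult_def sum_3 D_def conj_transpose_def mat_def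
      simp flip: of_real_mult)
  have neg: "A ** (- mat 1) = - A" for A :: "complex^3^3"
    by (simp add: vec_eq_iff forall_3 matrix_matrix_mult_def sum_3 mat_def)
  have "K ** K = U ** (D ** (conj_transpose U ** U) ** D) ** conj_transpose U"
    by (simp add: K_def matrix_mul_assoc)
  also have "\<dots> = - (U ** conj_transpose U)"
    by (simp add: UU' DD neg) (simp add: matrix_matrix_mult_def vec_eq_iff sum_3)
  finally have "K ** K = - mat 1" by (simp add: UU)
  moreover have "conj_transpose (conj_transpose U) = U" by (simp add: conj_transpose_def vec_eq_iff)
  then have "conj_transpose K ** K = U ** (conj_transpose D ** (conj_transpose U ** U) ** D) ** conj_transpose U"
    by (simp add: K_def matrix_mul_assoc conj_transpose_mult)
  then have "conj_transpose K ** K = mat 1" by (simp add: UU' DD UU)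
  ultimately have KK: "K ** K = - mat 1" "conj_transpose K ** K = mat 1" by blast+
  have sq: "realify K ** realify K = - mat 1"
    using KK linear_neg[OF linear_realify, of "mat 1"] by (simp flip: realify_mult)
  then show "J ** J = - mat 1" by (simp add: J)
  have orth: "orthogonal_matrix J"
    using KK unfolding orthogonal_matrix J by (simp flip: realify_mult realify_conj_transpose)
  define R :: "real^6^6" where "R = vector [axis 1 1, axis 2 1, axis 3 1, axis 4 (-1), axis 5 1, axis 6 \<epsilon>]"
  have "\<epsilon> * \<epsilon> = 1" using \<epsilon> by auto
  then have DR: "realify D ** R = R ** J0"
    by (simp add: vec_eq_iff forall_6 matrix_matrix_mult_def sum_6 D_def R_def realify_nth rvec_def
      matrix_vector_mult_def sum_3 cvec_def axis_def mat_def)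
  define W where "W = realify U ** R"
  have JW: "J ** W = W ** J0"
  proof -
    have "J ** W = realify (U ** D ** (conj_transpose U ** U)) ** R"
      by (simp add: J K_def W_def realify_mult matrix_mul_assoc)
    then show ?thesis by (simp add: UU' realify_mult W_def DR flip: matrix_mul_assoc)
  qed
  have "det (realify U) * det (realify (conj_transpose U)) = 1"
    using UU by (simp flip: det_mul realify_mult)
  then have "det (realify U) \<noteq> 0" by auto
  then have "det (realify U) > 0" using det_realify_nonneg[of U] by simp
  moreover have "det W = det (realify U) * - \<epsilon>"
    by (simp add: W_def R_def det_mul det_diag6)
  ultimately have "det W \<noteq> 0" "det W > 0 \<longleftrightarrow> \<epsilon> = - 1" using \<epsilon> by auto
  then show "J \<in> positive_ocs \<longleftrightarrow> \<epsilon> = - 1"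
    using positive_iff_det_pos[OF JW] orth \<open>J ** J = - mat 1\<close> by (simp add: positive_ocs_def)
qed

lemma nij_J0: "nij J0 x y = 0"
  by (simp add: nij_def bracket_def J0_mult vec_eq_iff forall_6 rvec_def cvec_def)

text \<open>On \<open>complex^2\<close> the structure is complex linear with determinant \<open>1\<close> and trace \<open>0\<close>, so
  \<open>[J x, J y] = [x, y]\<close> and \<open>[J x, y] + [x, J y] = 0\<close>.\<close>

lemma nij_twisted_ocs:
  assumes u: "norm u = 1"
  shows "nij (twisted_ocs (-1) (line_proj u)) x y = 0"
proof -
  have u1: "u$1 * cnj (u$1) + u$2 * cnj (u$2) = 1" by (rule unit_complex_2[OF u])
  define z w where "z = cvec x" and "w = cvec y"
  define K :: "complex^3^3" where "K = vector [vector [\<i> * (1 - 2 * line_proj u$1$1), - 2 * \<i> * line_proj u$1$2, 0],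
     vector [- 2 * \<i> * line_proj u$2$1, \<i> * (1 - 2 * line_proj u$2$2), 0], vector [0, 0, - \<i>]]"
  have J: "twisted_ocs (-1) (line_proj u) *v t = rvec (K *v cvec t)" for t
    by (simp add: twisted_ocs_def realify_mult_vec K_def)
  define br where "br z w = w$1 * z$2 - z$1 * w$2" for z w :: "complex^3"
  have br: "bracket s t = rvec (vector [0, 0, br (cvec s) (cvec t)])" for s t
    by (simp add: bracket_def br_def)
  have K1: "(K *v z)$1 = \<i> * (1 - 2 * (u$1 * cnj (u$1))) * z$1 - 2 * \<i> * (u$1 * cnj (u$2)) * z$2"
    and K2: "(K *v z)$2 = - 2 * \<i> * (u$2 * cnj (u$1)) * z$1 + \<i> * (1 - 2 * (u$2 * cnj (u$2))) * z$2" for z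
    by (simp_all add: K_def matrix_vector_mult_def sum_3 line_proj_unit[OF u])
  have K3: "K *v vector [0, 0, c] = vector [0, 0, - \<i> * c]" for c
    by (simp add: K_def matrix_vector_mult_def sum_3 vec_eq_iff forall_3)
  have det: "br (K *v z) (K *v w) = br z w"
    unfolding br_def K1 K2 using u1 i_squared by algebra
  have tr: "br (K *v z) w + br z (K *v w) = 0"
    unfolding br_def K1 K2 using u1 by algebra
  have "nij (twisted_ocs (-1) (line_proj u)) x y = rvec (vector [0, 0, br (K *v z) (K *v w) - br z w
      + \<i> * (br (K *v z) w + br z (K *v w))])"
    unfolding nij_def J br cvec_rvec K3 z_def[symmetric] w_def[symmetric]
    by (simp add: vec_eq_iff forall_6 rvec_def algebra_simps)
  also have "\<dots> = 0" unfolding det tr by (simp add: vec_eq_iff forall_6 rvec_def)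
  finally show ?thesis .
qed

lemma ocs_skew:
  assumes "orthogonal_matrix J" "J ** J = - mat 1"
  shows "transpose J = - (J :: real^6^6)"
proof -
  have neg: "A ** (- mat 1) = - A" for A :: "real^6^6"
  proof -
    have "A ** (- mat 1) + A ** mat 1 = 0" unfolding matrix_add_ldistrib[symmetric] by simp
    then show ?thesis by (simp add: eq_neg_iff_add_eq_0)
  qed
  have "- transpose J = transpose J ** (J ** J)" by (simp add: assms neg)
  also have "\<dots> = (transpose J ** J) ** J" by (rule matrix_mul_assoc)
  also have "\<dots> = J" using assms(1) by (simp add: orthogonal_matrix)
  finally show ?thesis by (metis minus_minus)
qed

text \<open>For \<open>z\<close> in the centre, integrability reads \<open>J [x, J z] = [J x, J z]\<close>. If \<open>J z\<close> were not central,
  \<open>x\<close> could be chosen with \<open>[x, J z] = z\<close>, and \<open>J z\<close> would be a bracket and hence central after all.\<close>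

lemma integrable_preserves_centre:
  assumes N: "\<And>x y. nij J x y = 0" and z: "cvec z $ 1 = 0" "cvec z $ 2 = 0"
  shows "cvec (J *v z) $ 1 = 0 \<and> cvec (J *v z) $ 2 = 0"
proof (rule ccontr)
  define y where "y = cvec (J *v z)"
  assume "\<not> ?thesis"
  then have y: "y$1 \<noteq> 0 \<or> y$2 \<noteq> 0" by (simp add: y_def)
  define x where "x = rvec (if y$1 \<noteq> 0 then vector [0, cvec z $ 3 / y$1, 0] else vector [- (cvec z $ 3) / y$2, 0, 0])"
  have central: "bracket t z = 0" for t
    by (simp add: bracket_def z rvec_def vec_eq_iff forall_6)
  have "bracket x (J *v z) = rvec (cvec z)"
    unfolding bracket_def y_def[symmetric] x_def cvec_rvec
    by (rule arg_cong[where f = rvec]) (use y z in \<open>auto simp: vec_eq_iff forall_3\<close>)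
  then have "J *v z = bracket (J *v x) (J *v z)"
    using N[of x z] by (simp add: nij_def central)
  then have "y = cvec (bracket (J *v x) (J *v z))" by (simp add: y_def)
  then show False using y by (simp add: bracket_def)
qed

lemma minus_J0_not_positive: "- J0 \<notin> positive_ocs"
proof -
  define W :: "real^6^6" where "W = vector [axis 1 1, axis 2 (-1), axis 3 1, axis 4 (-1), axis 5 1, axis 6 (-1)]"
  have "- J0 ** W = W ** J0"
    by (simp add: vec_eq_iff forall_6 matrix_matrix_mult_def sum_6 W_def realify_nth rvec_def
      matrix_vector_mult_def sum_3 cvec_def axis_def mat_def)
  moreover have "det W = -1" by (simp add: W_def det_diag6)
  ultimately show ?thesis using positive_iff_det_pos[of "- J0" W] by (simp add: positive_ocs_def)
qed

text \<open>Once the centre splits off, \<open>J\<close> is given on the first four coordinates by the skew entries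
  \<open>a, \<dots>, f\<close>, and \<open>J\<^sup>2 = - 1\<close> says that \<open>(a, b, c)\<close> and \<open>(f, - e, d)\<close> are parallel unit vectors, hence equal
  (self-dual) or opposite (anti-self-dual). The sign between them is the Pfaffian \<open>pf\<close>.\<close>

lemma integrable_positive_ocs:
  assumes J: "J \<in> positive_ocs" and N: "\<And>x y. nij J x y = 0"
  shows "J = J0 \<or> (\<exists>u. norm u = 1 \<and> J = twisted_ocs (-1) (line_proj u))"
proof -
  have orth: "orthogonal_matrix J" and JJ: "J ** J = - mat 1"
    using J by (auto simp: positive_ocs_def)
  have skew: "J $ i $ j = - J $ j $ i" for i j
    using arg_cong[OF ocs_skew[OF orth JJ], of "\<lambda>M. M $ j $ i"] by (simp add: transpose_def)
  have diag: "J $ i $ i = 0" for i using skew[of i i] by simp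
  have centre: "J $ k $ j = 0" if "j = 5 \<or> j = 6" "k = 1 \<or> k = 2 \<or> k = 3 \<or> k = 4" for j k
  proof -
    have "cvec (axis j 1) $ 1 = 0" "cvec (axis j 1) $ 2 = 0"
      using that(1) by (auto simp: cvec_def axis_def complex_eq_iff)
    from integrable_preserves_centre[OF N this] have "(J *v axis j 1) $ k = 0"
      using that(2) by (auto simp: cvec_def complex_eq_iff)
    then show ?thesis by (simp add: matrix_vector_mult_basis column_def)
  qed
  have centre': "J $ k $ j = 0" if "k = 5 \<or> k = 6" "j = 1 \<or> j = 2 \<or> j = 3 \<or> j = 4" for j k
    using skew[of k j] centre[OF that] by simp
  define a b c d e f \<epsilon> where abc: "a = J$2$1" "b = J$3$1" "c = J$4$1" "d = J$3$2" "e = J$4$2" "f = J$4$3" "\<epsilon> = J$6$5"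
  have Jent: "J$1$2 = - a" "J$1$3 = - b" "J$1$4 = - c" "J$2$3 = - d" "J$2$4 = - e" "J$3$4 = - f" "J$5$6 = - \<epsilon>"
    "J$2$1 = a" "J$3$1 = b" "J$4$1 = c" "J$3$2 = d" "J$4$2 = e" "J$4$3 = f" "J$6$5 = \<epsilon>"
    "J$5$1 = 0" "J$5$2 = 0" "J$5$3 = 0" "J$5$4 = 0" "J$6$1 = 0" "J$6$2 = 0" "J$6$3 = 0" "J$6$4 = 0"
    unfolding abc by (rule skew)+ (simp_all add: centre')
  note Jent = Jent diag centre
  have sq: "(\<Sum>k\<in>UNIV. J $ i $ k * J $ k $ j) = (if i = j then - 1 else 0)" for i j
    using arg_cong[OF JJ, of "\<lambda>M. M $ i $ j"] by (simp add: matrix_matrix_mult_def mat_def)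
  have q: "a*a + b*b + c*c = 1" "a*a + d*d + e*e = 1" "b*b + d*d + f*f = 1" "c*c + e*e + f*f = 1"
    "b*d + c*e = 0" "a*d = c*f" "a*e + b*f = 0" "\<epsilon>*\<epsilon> = 1"
    using sq[of 1 1] sq[of 2 2] sq[of 3 3] sq[of 4 4] sq[of 1 2] sq[of 1 3] sq[of 1 4] sq[of 5 5]
    by (simp_all add: sum_6 Jent)
  define pf where "pf = a*f - b*e + c*d"
  have pf: "f = pf*a" "e = - (pf*b)" "d = pf*c"
  proof -
    have *: "a*e = - (b*f)" "c*e = - (b*d)" using q(5,7) by linarith+
    have "pf*a = a*a*f - b*(a*e) + c*(a*d)" by (simp add: pf_def algebra_simps)
    also have "\<dots> = f*(a*a + b*b + c*c)" unfolding * q(6) by (simp add: algebra_simps)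
    finally show "f = pf*a" by (simp add: q(1))
    have "pf*b = - a*(- (b*f)) - b*b*e - c*(- (b*d))" by (simp add: pf_def algebra_simps)
    also have "\<dots> = - e*(a*a + b*b + c*c)" unfolding *[symmetric] by (simp add: algebra_simps)
    finally show "e = - (pf*b)" by (simp add: q(1))
    have "pf*c = a*(c*f) - b*(c*e) + c*c*d" by (simp add: pf_def algebra_simps)
    also have "\<dots> = d*(a*a + b*b + c*c)" unfolding * q(6)[symmetric] by (simp add: algebra_simps)
    finally show "d = pf*c" by (simp add: q(1))
  qed
  have "pf*pf = pf*pf*(a*a + b*b + c*c)" using q(1) by simp
  also have "\<dots> = d*d + e*e + f*f" by (simp add: pf algebra_simps)
  also have "\<dots> = 1" using q(1-4) by linarith
  finally have "pf*pf = 1" .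
  then have pf1: "pf = 1 \<or> pf = -1" by (simp only: square_eq_1_iff)
  have \<epsilon>1: "\<epsilon> = 1 \<or> \<epsilon> = -1" using q(8) by (simp only: square_eq_1_iff)
  show ?thesis
  proof (cases "pf = 1")
    case True
    \<comment> \<open>The self-dual case. Evaluating the Nijenhuis tensor on two pairs of basis vectors suffices.\<close>
    define B where "B = Complex b c"
    have J1: "cvec (J *v axis 1 1) = vector [\<i> * a, B, 0]" "cvec (J *v axis 2 1) = vector [- a, - \<i> * B, 0]"
      "cvec (J *v axis 3 1) = vector [- B, \<i> * a, 0]"
      by (simp_all add: cvec_def matrix_vector_mult_basis column_def Jent vec_eq_iff forall_3 complex_eq_iff B_def pf True)
    have J5: "J *v rvec (vector [0, 0, t]) = rvec (vector [0, 0, \<epsilon> * \<i> * t])" for t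
      by (simp add: vec_eq_iff forall_6 matrix_vector_mult_def sum_6 rvec_def Jent)
    have ax: "cvec (axis 1 1) = vector [1, 0, 0]" "cvec (axis 2 1) = vector [\<i>, 0, 0]" "cvec (axis 3 1) = vector [0, 1, 0]"
      by (simp_all add: cvec_def axis_def vec_eq_iff forall_3 complex_eq_iff)
    define br where "br z w = w$1 * z$2 - z$1 * w$2" for z w :: "complex^3"
    have br: "bracket x y = rvec (vector [0, 0, br (cvec x) (cvec y)])" for x y
      by (simp add: bracket_def br_def)
    have N3: "br (cvec (J *v x)) (cvec (J *v y)) - br (cvec x) (cvec y)
        - \<epsilon> * \<i> * (br (cvec (J *v x)) (cvec y) + br (cvec x) (cvec (J *v y))) = 0" for x y
      using arg_cong[OF N[of x y], of "\<lambda>v. cvec v $ 3"]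
      unfolding nij_def br J5 cvec_simps by (simp add: algebra_simps)
    have "(a - \<epsilon>) * B = 0"
      using N3[of "axis 1 1" "axis 2 1"] unfolding J1 ax br_def by (auto simp: algebra_simps)
    moreover have "(a - \<epsilon>) * (a - \<epsilon>) = B * B"
      using N3[of "axis 1 1" "axis 3 1"] arg_cong[OF q(8), of complex_of_real] unfolding J1 ax br_def
      by (simp add: algebra_simps)
    ultimately have "a = \<epsilon>" "B = 0" by auto
    then have bc: "b = 0" "c = 0" by (simp_all add: B_def complex_eq_iff)
    have "J = \<epsilon> *\<^sub>R J0"
      by (simp add: vec_eq_iff forall_6 Jent \<open>a = \<epsilon>\<close> bc pf True realify_nth rvec_def
        matrix_vector_mult_def sum_3 cvec_def axis_def mat_def)
    then show ?thesis using \<epsilon>1 minus_J0_not_positive J by auto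
  next
    case False
    then have pf: "f = - a" "e = b" "d = - c" using pf pf1 by auto
    \<comment> \<open>The projection \<open>Q = (1 + \<i> A) / 2\<close> is spanned by its first column unless that column is zero.\<close>
    obtain u :: "complex^2" where u: "norm u = 1" and lu: "line_proj u $ 1 $ 1 = (1 - a) / 2" "line_proj u $ 1 $ 2 = - \<i> * cnj (Complex b c) / 2"
      "line_proj u $ 2 $ 1 = \<i> * Complex b c / 2" "line_proj u $ 2 $ 2 = (1 + a) / 2"
    proof (cases "a = 1")
      case True
      then have "b*b + c*c = 0" using q(1) by simp
      then have "b = 0" "c = 0" by (simp_all add: sum_squares_eq_zero_iff)
      moreover have "norm (vector [0, 1] :: complex^2) = 1" by (simp add: norm_vec_def L2_set_def sum_2)
      ultimately show ?thesis using True that[of "vector [0, 1]"] by (simp add: line_proj_unit complex_eq_iff)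
    next
      case False
      have "a*a \<le> 1" using q(1) zero_le_square[of b] zero_le_square[of c] by linarith
      then have "a < 1" using False by (metis abs_le_square_iff abs_le_D1 abs_one less_eq_real_def mult_1 power2_eq_square)
      define r where "r = 1 / sqrt (2 - 2 * a)"
      have rr: "r * r = 1 / (2 - 2 * a)" using \<open>a < 1\<close> by (simp add: r_def)
      define u :: "complex^2" where "u = vector [complex_of_real ((1 - a) * r), \<i> * Complex b c * r]"
      have "(norm u)\<^sup>2 = ((1 - a) * (1 - a) + b*b + c*c) * (r * r)"
        by (simp add: norm_vec_def L2_set_def sum_2 u_def norm_mult power_mult_distrib cmod_power2)
          (simp add: power2_eq_square algebra_simps)
      also have "(1 - a) * (1 - a) + b*b + c*c = 2 - 2 * a" using q(1) by (simp add: algebra_simps)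
      finally have u: "norm u = 1" using \<open>a < 1\<close> power2_eq_1_iff[of "norm u"] norm_ge_zero[of u]
        by (auto simp: rr)
      have 1: "(1 - a) * (1 - a) * (r * r) = (1 - a) / 2" unfolding rr using \<open>a < 1\<close> by (simp add: field_simps)
      have 2: "(1 - a) * (r * r) = 1 / 2" unfolding rr using \<open>a < 1\<close> by (simp add: field_simps)
      have 3: "(b*b + c*c) * (r * r) = (1 + a) / 2"
      proof -
        have "b*b + c*c = (1 + a) * (1 - a)" using q(1) by (simp add: algebra_simps)
        then show ?thesis unfolding rr using \<open>a < 1\<close> by (simp add: field_simps)
      qed
      have u12: "u $ 1 = complex_of_real ((1 - a) * r)" "u $ 2 = \<i> * Complex b c * r"
        by (simp_all add: u_def)
      show ?thesis
      proof (rule that[OF u])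
        show "line_proj u $ 1 $ 1 = (1 - a) / 2" "line_proj u $ 2 $ 2 = (1 + a) / 2"
          unfolding line_proj_unit[OF u] u12 using 1 3 by (simp_all add: complex_eq_iff algebra_simps)
        show "line_proj u $ 1 $ 2 = - \<i> * cnj (Complex b c) / 2" "line_proj u $ 2 $ 1 = \<i> * Complex b c / 2"
          unfolding line_proj_unit[OF u] u12 using arg_cong[OF 2, of "\<lambda>x. x * b"] arg_cong[OF 2, of "\<lambda>x. x * c"]
          by (simp_all add: complex_eq_iff algebra_simps)
      qed
    qed
    have "J = twisted_ocs \<epsilon> (line_proj u)"
      unfolding twisted_ocs_def lu
      by (simp add: vec_eq_iff forall_6 Jent pf realify_nth rvec_def
        matrix_vector_mult_def sum_3 cvec_def axis_def) (simp add: field_simps)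
    then show ?thesis using twisted_ocs_properties(1)[OF u \<epsilon>1] J u by auto
  qed
qed

section \<open>Mixed structures and their forms\<close>

lemma mixed_structure_of_unit_vector:
  assumes J: "J \<in> positive_ocs" and v: "norm v = 1"
  defines "V \<equiv> positive_bases v (J *v v)"
  shows "(J, V) \<in> mixed_structures" "plane_of V = span {v, J *v v}"
    "ms_form \<alpha> (J, V) = fundamental_form J + \<alpha> *\<^sub>R wedge v (J *v v)"
proof -
  define w where "w = J *v v"
  have orth: "orthogonal_matrix J" and sq: "J ** J = - mat 1"
    using J by (auto simp: positive_ocs_def)
  have Jw: "J *v w = - v" unfolding w_def by (rule complex_structure_square[OF sq])
  have iso: "(J *v x) \<bullet> (J *v y) = x \<bullet> y" for x y
    using orth by (metis orthogonal_transformation_matrix orthogonal_transformation_def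
        matrix_of_matrix_vector_mul matrix_vector_mul_linear)
  have "v \<bullet> w = - (v \<bullet> w)" using iso[of v w] by (simp add: Jw w_def[symmetric] inner_commute)
  then have vw: "v \<bullet> w = 0" by simp
  have n: "v \<bullet> v = 1" "w \<bullet> w = 1" using v iso[of v v] by (simp_all add: w_def norm_eq_1)
  have ne: "v \<noteq> w" using vw n by auto
  have "v \<noteq> 0" "w \<noteq> 0" using n by auto
  then have ind: "independent {v, w}"
    by (intro pairwise_orthogonal_independent) (auto simp: pairwise_def orthogonal_def vw inner_commute)
  have mem: "(x, y) \<in> V \<longleftrightarrow> (\<exists>a b c d. x = a *\<^sub>R v + b *\<^sub>R w \<and> y = c *\<^sub>R v + d *\<^sub>R w \<and> a * d - b * c > 0)" for x y
    unfolding V_def positive_bases_def w_def[symmetric] by blast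
  have "(v, w) \<in> V" unfolding mem by (intro exI[of _ 1] exI[of _ 0] exI[of _ 0] exI[of _ 1]) simp
  moreover have "(w, - v) \<in> V" unfolding mem by (intro exI[of _ 0] exI[of _ 1] exI[of _ "-1"] exI[of _ 0]) simp
  ultimately have "{v, w} \<subseteq> fst ` V" by force
  moreover have "fst ` V \<subseteq> span {v, w}"
    by (auto simp: mem intro!: span_add span_mul intro: span_base)
  ultimately have plane: "plane_of V = span {v, w}"
    unfolding plane_of_def by (intro antisym span_minimal span_mono) auto
  then show "plane_of V = span {v, J *v v}" by (simp add: w_def)
  have coords: "\<exists>a b. x = a *\<^sub>R v + b *\<^sub>R w" if "x \<in> plane_of V" for x
    using that unfolding plane by (metis in_span_pair)
  have Jx: "J *v (a *\<^sub>R v + b *\<^sub>R w) = (- b) *\<^sub>R v + a *\<^sub>R w" for a b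
    by (simp add: matrix_vector_right_distrib matrix_vector_mult_scaleR Jw w_def[symmetric])
  show MS: "(J, V) \<in> mixed_structures"
    unfolding mixed_structures_def mem_Collect_eq prod.case
  proof (intro conjI ballI impI J)
    show "V \<in> oriented_planes"
      unfolding oriented_planes_def V_def w_def[symmetric] using ne ind by blast
    fix x assume x: "x \<in> plane_of V"
    then obtain a b where ab: "x = a *\<^sub>R v + b *\<^sub>R w" using coords by blast
    show "J *v x \<in> plane_of V" unfolding ab Jx plane by (intro span_add span_mul span_base) auto
    assume "x \<noteq> 0"
    then have "a \<noteq> 0 \<or> b \<noteq> 0" using ab by auto
    then have "a * a - b * - b > 0" by (simp add: sum_squares_gt_zero_iff)
    then show "(x, J *v x) \<in> V" unfolding mem ab Jx by blast
  qed
  obtain x where x: "x \<in> plane_of V" "norm x = 1"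
    and form: "ms_form \<alpha> (J, V) = fundamental_form J + \<alpha> *\<^sub>R wedge x (J *v x)"
    using ms_unit[OF MS] by metis
  obtain a b where ab: "x = a *\<^sub>R v + b *\<^sub>R w" using coords[OF x(1)] by blast
  have "x \<bullet> x = a * a + b * b"
    by (simp add: ab inner_add_left inner_add_right n vw inner_commute[of w v])
  then have 1: "a * a + b * b = 1" using x(2) by (simp add: norm_eq_1)
  have "wedge x (J *v x) = (a * a + b * b) *\<^sub>R wedge v w"
    unfolding ab Jx by (simp add: wedge_def vec_eq_iff algebra_simps)
  then show "ms_form \<alpha> (J, V) = fundamental_form J + \<alpha> *\<^sub>R wedge v (J *v v)"
    by (simp add: form 1 w_def)
qed

text \<open>A mixed structure is the same as a structure \<open>J\<close> together with the plane of a unit vector and its image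
  under \<open>J\<close>. The orientation of the plane is determined, and the form does not depend on the unit vector.\<close>

lemma ms_form_image:
  "ms_form \<alpha> ` {(J, V) \<in> mixed_structures. P J \<and> C (plane_of V)} =
   {fundamental_form J + \<alpha> *\<^sub>R wedge v (J *v v) | J v.
      J \<in> positive_ocs \<and> norm v = 1 \<and> P J \<and> C (span {v, J *v v})}" (is "?L = ?R")
proof
  show "?L \<subseteq> ?R"
  proof clarify
    fix J V assume MS: "(J, V) \<in> mixed_structures" and PC: "P J" "C (plane_of V)"
    obtain v where v: "v \<in> plane_of V" "norm v = 1"
      and form: "ms_form \<alpha> (J, V) = fundamental_form J + \<alpha> *\<^sub>R wedge v (J *v v)"
      using ms_unit[OF MS] by metis
    have "J \<in> positive_ocs" using MS by (simp add: mixed_structures_def)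
    then show "\<exists>J' v. ms_form \<alpha> (J, V) = fundamental_form J' + \<alpha> *\<^sub>R wedge v (J' *v v) \<and>
      J' \<in> positive_ocs \<and> norm v = 1 \<and> P J' \<and> C (span {v, J' *v v})"
      using PC v form ms_plane(2)[OF MS v] by (intro exI[of _ J] exI[of _ v]) simp
  qed
  show "?R \<subseteq> ?L"
  proof clarify
    fix J v assume J: "J \<in> positive_ocs" and v: "norm v = 1" and PC: "P J" "C (span {v, J *v v})"
    from mixed_structure_of_unit_vector[OF J v]
    show "fundamental_form J + \<alpha> *\<^sub>R wedge v (J *v v) \<in> ?L"
      using PC by (intro image_eqI[of _ _ "(J, positive_bases v (J *v v))"]) simp_all
  qed
qed

text \<open>The 2-form of the skew-Hermitian endomorphism \<open>\<i> X\<close>, as a real linear function of the Hermitian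
  matrix \<open>X\<close>. In particular \<open>J0\<close> corresponds to the identity matrix and the area form of a complex
  line to the projection onto this line.\<close>

definition form_of :: "complex^3^3 \<Rightarrow> real^6^6" where
  "form_of X = fundamental_form (realify (mat \<i> ** X))"

text \<open>The block sums \<open>Q \<oplus> 1\<close> and \<open>p \<oplus> 0\<close> along the splitting into \<open>complex^2\<close> and the centre.\<close>

definition block1 :: "complex^2^2 \<Rightarrow> complex^3^3" where
  "block1 Q = vector [vector [Q$1$1, Q$1$2, 0], vector [Q$2$1, Q$2$2, 0], vector [0, 0, 1]]"

definition block0 :: "complex^2^2 \<Rightarrow> complex^3^3" where
  "block0 p = vector [vector [p$1$1, p$1$2, 0], vector [p$2$1, p$2$2, 0], vector [0, 0, 0]]"

lemma fundamental_form_eq_transpose: "fundamental_form J = transpose J"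
  by (simp add: fundamental_form_def transpose_def matrix_vector_mult_basis column_def inner_axis)

lemma form_of_nth: "form_of X $ i $ j = rvec (\<i> *s (X *v cvec (axis i 1))) $ j"
proof -
  have "(mat \<i> ** X) *v z = \<i> *s (X *v z)" for z
    by (simp add: matrix_vector_mult_def vec_eq_iff mat_mult_nth sum_distrib_left mult.assoc)
  then show ?thesis by (simp add: form_of_def fundamental_form_eq_transpose transpose_def realify_nth)
qed

lemma linear_form_of: "linear form_of"
  by (intro linearI) (simp_all add: vec_eq_iff form_of_nth matrix_vector_mult_add_rdistrib
    scaleR_matrix_vector linear_add[OF linear_rvec] linear_scale[OF linear_rvec] vector_add_ldistrib
    forall_6 rvec_def)

lemmas form_of_simps = linear_add[OF linear_form_of] linear_diff[OF linear_form_of] linear_scale[OF linear_form_of]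

lemma fundamental_form_J0: "fundamental_form J0 = form_of (mat 1)"
  by (simp add: form_of_def)

lemma fundamental_form_twisted: "fundamental_form (twisted_ocs (-1) Q) = form_of (mat 1 - 2 *\<^sub>R block1 Q)"
  unfolding form_of_def twisted_ocs_def
  by (rule arg_cong[where f = "\<lambda>K. fundamental_form (realify K)"])
    (simp add: vec_eq_iff forall_3 mat_mult_nth block1_def, simp add: mat_def algebra_simps scaleR_conv_of_real)

lemma wedge_J0:
  assumes "norm v = 1"
  shows "wedge v (J0 *v v) = form_of (line_proj (cvec v))"
proof -
  have "norm (cvec v) = 1" using assms norm_rvec[of "cvec v"] by simp
  note lp = line_proj_unit[OF this]
  show ?thesis
    unfolding J0_mult
    by (simp add: vec_eq_iff forall_6 form_of_nth wedge_def rvec_def matrix_vector_mult_def sum_3 lp)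
      (simp add: cvec_def axis_def)
qed

lemma wedge_minus: "wedge v (- w) = - wedge v w"
  by (simp add: wedge_def vec_eq_iff)

lemma twisted_mult:
  assumes u: "norm u = 1"
  defines "c \<equiv> \<lambda>z::complex^3. z$1 * cnj (u$1) + z$2 * cnj (u$2)"
  shows "cvec (twisted_ocs (-1) (line_proj u) *v x) =
    vector [\<i> * cvec x $ 1 - 2 * \<i> * c (cvec x) * u$1, \<i> * cvec x $ 2 - 2 * \<i> * c (cvec x) * u$2, - \<i> * cvec x $ 3]"
  unfolding twisted_ocs_def line_proj_unit[OF u] realify_mult_vec cvec_rvec
  by (simp add: vec_eq_iff forall_3 matrix_vector_mult_def sum_3 c_def algebra_simps)

lemma cvec_bracket: "cvec (bracket x y) = vector [0, 0, cvec y $ 1 * cvec x $ 2 - cvec x $ 1 * cvec y $ 2]"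
  by (simp add: bracket_def)

text \<open>Let \<open>z\<close> be the complex coordinates of \<open>v\<close>, \<open>a\<close> its projection to \<open>complex^2\<close> and \<open>V\<close> the plane of
  \<open>v\<close> and \<open>J v\<close>. Vanishing of the skew part puts the bracket \<open>[v, J v]\<close> in \<open>V\<close>. If it were nonzero, then \<open>V\<close>, being
  \<open>J\<close>-invariant, would be the centre and the bracket zero. So \<open>a\<close> and \<open>J a\<close> are complex dependent: \<open>a\<close> is
  a multiple of \<open>u\<close> or orthogonal to it. In the second case \<open>h = g u\<close> is orthogonal to \<open>V\<close> for every complex \<open>g\<close>,
  and the symmetric condition with \<open>g = 1, \<i>\<close> leaves no component of \<open>z\<close> in the centre.\<close>

lemma twisted_class_V_necessary:
  assumes u: "norm u = 1" and v: "norm v = 1"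
  defines "J \<equiv> twisted_ocs (-1) (line_proj u)" and "z \<equiv> cvec v"
  assumes C: "class_V {3, 4, 5} (span {v, J *v v})"
  shows "(\<exists>s. z$1 = s * u$1 \<and> z$2 = s * u$2) \<or> (z$3 = 0 \<and> z$1 * cnj (u$1) + z$2 * cnj (u$2) = 0)"
proof -
  define c \<delta> where "c = z$1 * cnj (u$1) + z$2 * cnj (u$2)" and "\<delta> = z$1 * u$2 - z$2 * u$1"
  have u1: "u$1 * cnj (u$1) + u$2 * cnj (u$2) = 1" by (rule unit_complex_2[OF u])
  have JJ: "J *v (J *v x) = - x" for x
    unfolding J_def using twisted_ocs_properties(2)[OF u] by (intro complex_structure_square) simp
  have Jcentral: "cvec (J *v x) $ 1 = 0 \<and> cvec (J *v x) $ 2 = 0" if "cvec x $ 1 = 0" "cvec x $ 2 = 0" for x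
    unfolding J_def using that by (simp add: twisted_mult[OF u])
  define W where "W = span {v, J *v v}"
  have vW: "v \<in> W" and JvW: "J *v v \<in> W" by (simp_all add: W_def span_base)
  have Jv: "cvec (J *v v) = vector [\<i> * z$1 - 2 * \<i> * c * u$1, \<i> * z$2 - 2 * \<i> * c * u$2, - \<i> * z$3]"
    unfolding J_def twisted_mult[OF u] z_def c_def by simp
  note nec = class_V_necessary[OF C, folded W_def]
  define r where "r = bracket v (J *v v)"
  have r0: "r = 0"
  proof (rule ccontr)
    assume "r \<noteq> 0"
    have "r \<in> orthogonal_comp (orthogonal_comp W)"
      using nec(1)[OF vW JvW] by (auto simp: r_def orthogonal_comp_def[of "orthogonal_comp W"] orthogonal_def inner_commute)
    then have "r \<in> W" by (simp add: orthogonal_comp_self W_def)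
    then obtain a b where r: "r = a *\<^sub>R v + b *\<^sub>R (J *v v)"
      unfolding W_def by (rule in_span_pair)
    have Jr: "J *v r = a *\<^sub>R (J *v v) - b *\<^sub>R v"
      by (simp add: r matrix_vector_right_distrib matrix_vector_mult_scaleR JJ)
    have "a *\<^sub>R r - b *\<^sub>R (J *v r) = (a * a + b * b) *\<^sub>R v"
      unfolding Jr unfolding r by (simp add: algebra_simps)
    then have eq: "a *\<^sub>R cvec r - b *\<^sub>R cvec (J *v r) = (a * a + b * b) *\<^sub>R z"
      unfolding z_def by (metis cvec_simps(3,5))
    have central: "cvec r $ 1 = 0" "cvec r $ 2 = 0" by (simp_all add: r_def cvec_bracket)
    have "a \<noteq> 0 \<or> b \<noteq> 0" using r \<open>r \<noteq> 0\<close> by auto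
    then have ab: "a * a + b * b \<noteq> 0" by (simp add: sum_squares_eq_zero_iff)
    have "(a * a + b * b) *\<^sub>R z $ 1 = 0" "(a * a + b * b) *\<^sub>R z $ 2 = 0"
      using arg_cong[OF eq, of "\<lambda>v. v $ 1"] arg_cong[OF eq, of "\<lambda>v. v $ 2"] central Jcentral[OF central]
      by simp_all
    then have "z$1 = 0" "z$2 = 0" using ab by auto
    then have "cvec r = 0" by (simp add: r_def cvec_bracket vec_eq_iff forall_3 flip: z_def)
    then have "rvec (cvec r) = rvec 0" by simp
    with \<open>r \<noteq> 0\<close> show False by (simp add: rvec_simps)
  qed
  have "2 * \<i> * (c * \<delta>) = cvec r $ 3"
    unfolding r_def cvec_bracket Jv z_def[symmetric] by (simp add: \<delta>_def algebra_simps)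
  then have "c * \<delta> = 0" by (simp add: r0 cvec_simps)
  show ?thesis
  proof (cases "\<delta> = 0")
    case True
    then have "z$1 * u$2 = z$2 * u$1" by (simp add: \<delta>_def)
    then have "z$1 = c * u$1" "z$2 = c * u$2" using u1 unfolding c_def by algebra+
    then show ?thesis by blast
  next
    case False
    then have c0: "c = 0" using \<open>c * \<delta> = 0\<close> by simp
    then have w: "cvec (J *v v) = vector [\<i> * z$1, \<i> * z$2, - \<i> * z$3]" by (simp add: Jv)
    have "Re (\<i> * g * \<delta> * cnj (z$3)) = 0" for g
    proof -
      define h where "h = rvec (vector [g * u$1, g * u$2, 0])"
      have "h \<bullet> v = Re (g * cnj c)" "h \<bullet> (J *v v) = Re (- \<i> * g * cnj c)"
        unfolding inner_cvec w by (simp_all add: h_def z_def[symmetric] c_def algebra_simps)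
      then have "orthogonal h v" "orthogonal h (J *v v)" by (simp_all add: c0 orthogonal_def)
      then have "orthogonal h y" if "y \<in> W" for y
        using orthogonal_to_span[OF that[unfolded W_def], of h] by blast
      then have h: "h \<in> orthogonal_comp W"
        by (simp add: orthogonal_comp_def orthogonal_commute[of _ h])
      have "v \<bullet> (J *v v) = 0" unfolding inner_cvec w z_def[symmetric] by (simp add: algebra_simps)
      from nec(2)[OF vW JvW h this]
      have "Re (\<i> * g * \<delta> * cnj (z$3)) + Re (\<i> * g * \<delta> * cnj (z$3)) = 0"
        unfolding inner_cvec cvec_bracket w z_def[symmetric] by (simp add: h_def \<delta>_def algebra_simps)
      then show ?thesis by linarith
    qed
    from this[of 1] this[of \<i>] have "\<delta> * cnj (z$3) = 0" by (simp add: complex_eq_iff)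
    then show ?thesis using False c0 by (simp add: c_def)
  qed
qed

lemma J0_mult_cvec: "cvec (J0 *v x) = vector [\<i> * cvec x $ 1, \<i> * cvec x $ 2, \<i> * cvec x $ 3]"
  by (simp add: J0_mult vec_eq_iff forall_3)

lemma cvec_inject: "cvec x = cvec y \<longleftrightarrow> x = y"
  by (metis rvec_cvec)

lemma class_V_minus: "class_V S (span {v, - w}) \<longleftrightarrow> class_V S (span {v, w})"
proof -
  have "span {v, - w} \<subseteq> span {v, w}" for w
    by (intro span_minimal) (auto intro: span_base span_neg)
  from this[of w] this[of "- w"] have "span {v, - w} = span {v, w}" by simp
  then show ?thesis by simp
qed

text \<open>The forms of the three families. In the first, \<open>V\<close> is a line in \<open>complex^2\<close>, in the second an arbitrary complex line with \<open>J = J0\<close>, and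
  in the third a line in the sum of \<open>u\<close> and the centre, where \<open>J = - J0\<close> and the area form
  changes sign.\<close>

definition line_forms :: "real \<Rightarrow> (real^6^6) set" where
  "line_forms \<alpha> = (\<lambda>p. form_of (- mat 1 + (2 + \<alpha>) *\<^sub>R block0 p)) ` CP1"

definition plane_forms :: "real \<Rightarrow> (real^6^6) set" where
  "plane_forms \<alpha> = (\<lambda>P. form_of (mat 1 + \<alpha> *\<^sub>R P)) ` CP2"

definition flag_forms :: "real \<Rightarrow> (real^6^6) set" where
  "flag_forms \<alpha> = {form_of (mat 1 - 2 *\<^sub>R block1 (line_proj u) - \<alpha> *\<^sub>R line_proj (vector [s * u$1, s * u$2, t])) | u s t.
     norm u = 1 \<and> (cmod s)\<^sup>2 + (cmod t)\<^sup>2 = 1}"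

lemma norm_complex_2: "(norm (z::complex^2))\<^sup>2 = (cmod (z$1))\<^sup>2 + (cmod (z$2))\<^sup>2"
  by (simp add: norm_vec_def L2_set_def sum_2)

lemma norm_complex_3: "(norm (z::complex^3))\<^sup>2 = (cmod (z$1))\<^sup>2 + (cmod (z$2))\<^sup>2 + (cmod (z$3))\<^sup>2"
  by (simp add: norm_vec_def L2_set_def sum_3)

lemma norm_flag_vector:
  fixes u :: "complex^2"
  assumes "norm u = 1"
  shows "(norm (vector [s * u$1, s * u$2, t] :: complex^3))\<^sup>2 = (cmod s)\<^sup>2 + (cmod t)\<^sup>2"
proof -
  have "(norm (vector [s * u$1, s * u$2, t] :: complex^3))\<^sup>2 = (cmod s)\<^sup>2 * (norm u)\<^sup>2 + (cmod t)\<^sup>2"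
    unfolding norm_complex_3 norm_complex_2 by (simp add: norm_mult power_mult_distrib algebra_simps)
  then show ?thesis by (simp add: assms)
qed

lemma norm_eq_1_sq: "norm x = 1 \<longleftrightarrow> (norm x)\<^sup>2 = 1"
  by (metis norm_ge_zero one_power2 power2_eq_iff_nonneg zero_le_one)

text \<open>The projections onto two orthogonal lines of \<open>complex^2\<close> add up to the identity: the matrix with these
  columns is unitary.\<close>

lemma orthonormal_pair_projections:
  fixes u w :: "complex^2"
  assumes u: "norm u = 1" and w: "norm w = 1" and orth: "w$1 * cnj (u$1) + w$2 * cnj (u$2) = 0"
  shows "block1 (line_proj u) = mat 1 - block0 (line_proj w)"
proof -
  define U :: "complex^2^2" where "U = vector [vector [u$1, w$1], vector [u$2, w$2]]"
  have 1: "u$1 * cnj (u$1) + u$2 * cnj (u$2) = 1" "w$1 * cnj (w$1) + w$2 * cnj (w$2) = 1"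
    by (rule unit_complex_2[OF u], rule unit_complex_2[OF w])
  have "u$1 * cnj (w$1) + u$2 * cnj (w$2) = 0" using arg_cong[OF orth, of cnj] by (simp add: mult.commute)
  then have "conj_transpose U ** U = mat 1"
    using 1 orth by (simp add: vec_eq_iff forall_2 matrix_matrix_mult_def sum_2 U_def conj_transpose_def mat_def mult.commute)
  then have "U ** conj_transpose U = mat 1" by (simp add: matrix_left_right_inverse)
  then have "u$1 * cnj (u$1) + w$1 * cnj (w$1) = 1" "u$1 * cnj (u$2) + w$1 * cnj (w$2) = 0"
    "u$2 * cnj (u$1) + w$2 * cnj (w$1) = 0" "u$2 * cnj (u$2) + w$2 * cnj (w$2) = 1"
    by (simp_all add: vec_eq_iff forall_2 matrix_matrix_mult_def sum_2 U_def conj_transpose_def mat_def)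
  then show ?thesis
    by (simp add: vec_eq_iff forall_3 block1_def block0_def line_proj_unit[OF u] line_proj_unit[OF w] mat_def
      algebra_simps)
qed

lemma block0_line_proj:
  assumes "norm w = 1"
  shows "line_proj (vector [w$1, w$2, 0]) = block0 (line_proj w)"
proof -
  have n: "norm (vector [w$1, w$2, 0] :: complex^3) = 1"
    using assms unfolding norm_eq_1_sq norm_complex_2 norm_complex_3 by simp
  show ?thesis
    by (simp add: vec_eq_iff forall_3 block0_def line_proj_unit[OF assms] line_proj_unit[OF n])
qed

text \<open>When \<open>V\<close> is the orthogonal line of \<open>u\<close>, the structure \<open>J\<close> can be expressed by the projection onto \<open>V\<close>.\<close>

lemma line_forms_eq:
  assumes u: "norm u = 1" and w: "norm w = 1" and orth: "w$1 * cnj (u$1) + w$2 * cnj (u$2) = 0"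
  shows "form_of (mat 1 - 2 *\<^sub>R block1 (line_proj u)) + \<alpha> *\<^sub>R form_of (line_proj (vector [w$1, w$2, 0]))
    = form_of (- mat 1 + (2 + \<alpha>) *\<^sub>R block0 (line_proj w))"
  unfolding orthonormal_pair_projections[OF assms] block0_line_proj[OF w] form_of_simps[symmetric]
  by (rule arg_cong[where f = form_of]) (simp add: algebra_simps scaleR_2)

lemma invariant_mixed_structures_forms:
  "ms_form \<alpha> ` {(J, V) \<in> mixed_structures. class_W34 J \<and> class_V {3, 4, 5} (plane_of V)}
     = line_forms \<alpha> \<union> plane_forms \<alpha> \<union> flag_forms \<alpha>"
  unfolding ms_form_image
proof (intro subset_antisym subsetI)
  let ?S = "{fundamental_form J + \<alpha> *\<^sub>R wedge v (J *v v) |J v.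
      J \<in> positive_ocs \<and> norm v = 1 \<and> class_W34 J \<and> class_V {3, 4, 5} (span {v, J *v v})}"
  fix \<omega> assume "\<omega> \<in> ?S"
  then obtain J v where \<omega>: "\<omega> = fundamental_form J + \<alpha> *\<^sub>R wedge v (J *v v)" and J: "J \<in> positive_ocs"
    and v: "norm v = 1" and W: "class_W34 J" and C: "class_V {3, 4, 5} (span {v, J *v v})" by blast
  have nz: "norm (cvec v) = 1" using v norm_rvec[of "cvec v"] by simp
  then have z0: "cvec v \<noteq> 0" by auto
  have "J ** J = - mat 1" using J by (simp add: positive_ocs_def)
  then have N: "nij J x y = 0" for x y using W class_W34_iff by blast
  show "\<omega> \<in> line_forms \<alpha> \<union> plane_forms \<alpha> \<union> flag_forms \<alpha>"
  proof (cases "J = J0")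
    case True
    have "\<omega> = form_of (mat 1 + \<alpha> *\<^sub>R line_proj (cvec v))"
      by (simp add: \<omega> True fundamental_form_J0 wedge_J0[OF v] form_of_simps)
    then have "\<omega> \<in> plane_forms \<alpha>"
      unfolding plane_forms_def using line_proj_in_projective_space[OF z0] by blast
    then show ?thesis by blast
  next
    case False
    then obtain u where u: "norm u = 1" and Ju: "J = twisted_ocs (-1) (line_proj u)"
      using integrable_positive_ocs[OF J N] by blast
    define z where "z = cvec v"
    have Jv: "cvec (J *v v) = vector [\<i> * z$1 - 2 * \<i> * (z$1 * cnj (u$1) + z$2 * cnj (u$2)) * u$1,
        \<i> * z$2 - 2 * \<i> * (z$1 * cnj (u$1) + z$2 * cnj (u$2)) * u$2, - \<i> * z$3]"
      unfolding Ju twisted_mult[OF u] z_def by simp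
    consider (flag) s where "z$1 = s * u$1" "z$2 = s * u$2"
      | (line) "z$3 = 0" "z$1 * cnj (u$1) + z$2 * cnj (u$2) = 0"
      using twisted_class_V_necessary[OF u v] C unfolding Ju z_def by blast
    then show ?thesis
    proof cases
      case flag
      have "u$1 * cnj (u$1) + u$2 * cnj (u$2) = 1" by (rule unit_complex_2[OF u])
      then have "s * u$1 * cnj (u$1) + s * u$2 * cnj (u$2) = s" by (simp add: mult.assoc flip: distrib_left)
      then have "cvec (J *v v) = cvec (- (J0 *v v))"
        unfolding Jv cvec_simps J0_mult_cvec z_def[symmetric] flag by (simp add: vec_eq_iff forall_3)
      then have "J *v v = - (J0 *v v)" by (simp only: cvec_inject)
      moreover have zeq: "z = vector [s * u$1, s * u$2, z$3]" by (simp add: vec_eq_iff forall_3 flag)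
      ultimately have "\<omega> = form_of (mat 1 - 2 *\<^sub>R block1 (line_proj u) - \<alpha> *\<^sub>R line_proj (vector [s * u$1, s * u$2, z$3]))"
        using wedge_J0[OF v] by (simp add: \<omega> Ju fundamental_form_twisted wedge_minus form_of_simps flip: z_def)
      moreover have "(cmod s)\<^sup>2 + (cmod (z$3))\<^sup>2 = 1"
        using norm_flag_vector[OF u, of s "z$3"] nz zeq by (simp flip: z_def)
      ultimately have "\<omega> \<in> flag_forms \<alpha>" unfolding flag_forms_def using u by blast
      then show ?thesis by blast
    next
      case line
      define w :: "complex^2" where "w = vector [z$1, z$2]"
      have zw: "z = vector [w$1, w$2, 0]" by (simp add: w_def line vec_eq_iff forall_3)
      have w: "norm w = 1"
        using nz unfolding norm_eq_1_sq norm_complex_2 norm_complex_3 z_def[symmetric] by (simp add: w_def line)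
      have "cvec (J *v v) = cvec (J0 *v v)"
        unfolding Jv J0_mult_cvec z_def[symmetric] line by (simp add: vec_eq_iff forall_3)
      then have "J *v v = J0 *v v" by (simp only: cvec_inject)
      then have "\<omega> = form_of (mat 1 - 2 *\<^sub>R block1 (line_proj u)) + \<alpha> *\<^sub>R form_of (line_proj (vector [w$1, w$2, 0]))"
        using wedge_J0[OF v] zw by (simp add: \<omega> Ju fundamental_form_twisted flip: z_def)
      also have "\<dots> = form_of (- mat 1 + (2 + \<alpha>) *\<^sub>R block0 (line_proj w))"
        by (rule line_forms_eq[OF u w]) (simp add: w_def line)
      finally have \<omega>w: "\<omega> = form_of (- mat 1 + (2 + \<alpha>) *\<^sub>R block0 (line_proj w))" .
      have "w \<noteq> 0" using w by auto
      then have "\<omega> \<in> line_forms \<alpha>"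
        unfolding line_forms_def \<omega>w using line_proj_in_projective_space[of w] by blast
      then show ?thesis by blast
    qed
  qed
next
  let ?S = "{fundamental_form J + \<alpha> *\<^sub>R wedge v (J *v v) |J v.
      J \<in> positive_ocs \<and> norm v = 1 \<and> class_W34 J \<and> class_V {3, 4, 5} (span {v, J *v v})}"
  have SI: "fundamental_form J + \<alpha> *\<^sub>R wedge v w \<in> ?S"
    if "J \<in> positive_ocs" "norm v = 1" "class_W34 J" "J *v v = w" "w = J0 *v v \<or> w = - (J0 *v v)" for J v w
  proof -
    have "class_V {3, 4, 5} (span {v, J *v v})"
      using that(4,5) class_V_complex_line[OF that(2)] class_V_minus[of "{3, 4, 5}" v "J0 *v v"] by metis
    then show ?thesis
      using that by (intro CollectI exI[of _ J] exI[of _ v]) simp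
  qed
  have twisted: "twisted_ocs (-1) (line_proj u) \<in> positive_ocs" "class_W34 (twisted_ocs (-1) (line_proj u))"
    if "norm u = 1" for u
    using class_W34_iff[OF twisted_ocs_properties(2)[OF that]] nij_twisted_ocs[OF that]
      twisted_ocs_properties(1)[OF that] by simp_all
  fix \<omega> assume "\<omega> \<in> line_forms \<alpha> \<union> plane_forms \<alpha> \<union> flag_forms \<alpha>"
  then consider (line) "\<omega> \<in> line_forms \<alpha>" | (plane) "\<omega> \<in> plane_forms \<alpha>" | (flag) "\<omega> \<in> flag_forms \<alpha>" by blast
  then show "\<omega> \<in> ?S"
  proof cases
    case plane
    then obtain z where z: "norm z = 1" "\<omega> = form_of (mat 1 + \<alpha> *\<^sub>R line_proj z)"
      unfolding plane_forms_def by (auto elim: projective_space_unit)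
    have v: "norm (rvec z) = 1" using z by (simp add: norm_rvec)
    have "class_W34 J0" using class_W34_iff[OF J0_square] nij_J0 by simp
    from SI[OF J0_positive v this refl] wedge_J0[OF v] show ?thesis
      by (simp add: z fundamental_form_J0 form_of_simps)
  next
    case line
    then obtain w where w: "norm w = 1" and \<omega>: "\<omega> = form_of (- mat 1 + (2 + \<alpha>) *\<^sub>R block0 (line_proj w))"
      unfolding line_forms_def by (auto elim: projective_space_unit)
    define u :: "complex^2" where "u = vector [- cnj (w$2), cnj (w$1)]"
    have u: "norm u = 1" using w unfolding norm_eq_1_sq norm_complex_2 by (simp add: u_def)
    have orth: "w$1 * cnj (u$1) + w$2 * cnj (u$2) = 0" by (simp add: u_def)
    define v where "v = rvec (vector [w$1, w$2, 0])"
    have v: "norm v = 1"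
      using w unfolding v_def norm_rvec norm_eq_1_sq norm_complex_2 norm_complex_3 by simp
    have "cvec (twisted_ocs (-1) (line_proj u) *v v) = cvec (J0 *v v)"
      unfolding twisted_mult[OF u] J0_mult_cvec using orth by (simp add: vec_eq_iff forall_3 v_def)
    then have Jv: "twisted_ocs (-1) (line_proj u) *v v = J0 *v v" by (simp only: cvec_inject)
    from SI[OF twisted(1)[OF u] v twisted(2)[OF u] Jv] show ?thesis
      using line_forms_eq[OF u w orth] wedge_J0[OF v]
      by (simp add: \<omega> fundamental_form_twisted v_def)
  next
    case flag
    then obtain u s t where u: "norm u = 1" and st: "(cmod s)\<^sup>2 + (cmod t)\<^sup>2 = 1"
      and \<omega>: "\<omega> = form_of (mat 1 - 2 *\<^sub>R block1 (line_proj u) - \<alpha> *\<^sub>R line_proj (vector [s * u$1, s * u$2, t]))"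
      unfolding flag_forms_def by blast
    define v where "v = rvec (vector [s * u$1, s * u$2, t])"
    have v: "norm v = 1" using norm_flag_vector[OF u, of s t] st unfolding v_def norm_rvec norm_eq_1_sq by simp
    have "u$1 * cnj (u$1) + u$2 * cnj (u$2) = 1" by (rule unit_complex_2[OF u])
    then have "s * u$1 * cnj (u$1) + s * u$2 * cnj (u$2) = s" by (simp add: mult.assoc flip: distrib_left)
    then have "cvec (twisted_ocs (-1) (line_proj u) *v v) = cvec (- (J0 *v v))"
      unfolding twisted_mult[OF u] J0_mult_cvec cvec_simps by (simp add: vec_eq_iff forall_3 v_def)
    then have Jv: "twisted_ocs (-1) (line_proj u) *v v = - (J0 *v v)" by (simp only: cvec_inject)
    from SI[OF twisted(1)[OF u] v twisted(2)[OF u] Jv] show ?thesis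
      using wedge_J0[OF v] by (simp add: \<omega> fundamental_form_twisted wedge_minus form_of_simps v_def)
  qed
qed

section \<open>The three components\<close>

lemma moment_map_form_of: "moment_map (form_of X) = vector [Re (X$1$1), Re (X$2$2), Re (X$3$3)]"
  by (simp add: moment_map_def form_of_nth rvec_def cvec_def axis_def matrix_vector_mult_def sum_3
      vec_eq_iff forall_3)

definition matrix_of :: "real^6^6 \<Rightarrow> complex^3^3" where
  "matrix_of \<omega> = vector
    [vector [Complex (\<omega>$1$2) (- \<omega>$1$1), Complex (\<omega>$3$2) (- \<omega>$3$1), Complex (\<omega>$5$2) (- \<omega>$5$1)],
     vector [Complex (\<omega>$1$4) (- \<omega>$1$3), Complex (\<omega>$3$4) (- \<omega>$3$3), Complex (\<omega>$5$4) (- \<omega>$5$3)],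
     vector [Complex (\<omega>$1$6) (- \<omega>$1$5), Complex (\<omega>$3$6) (- \<omega>$3$5), Complex (\<omega>$5$6) (- \<omega>$5$5)]]"

lemma matrix_of_form_of [simp]: "matrix_of (form_of X) = X"
  by (simp add: matrix_of_def form_of_nth rvec_def cvec_def axis_def matrix_vector_mult_def sum_3
      vec_eq_iff forall_3 complex_eq_iff)

lemma linear_matrix_of: "linear matrix_of"
  by (rule linearI) (simp_all add: matrix_of_def vec_eq_iff forall_3 complex_eq_iff)

definition block2 :: "complex^3^3 \<Rightarrow> complex^2^2" where
  "block2 X = vector [vector [X$1$1, X$1$2], vector [X$2$1, X$2$2]]"

lemma block2_block0 [simp]: "block2 (block0 p) = p" and block2_block1 [simp]: "block2 (block1 p) = p"
  by (simp_all add: block2_def block0_def block1_def vec_eq_iff forall_2)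

lemma linear_block2: "linear block2"
  by (rule linearI) (simp_all add: block2_def vec_eq_iff forall_2)

lemma linear_block0: "linear block0"
  by (rule linearI) (simp_all add: block0_def vec_eq_iff forall_3)

lemma smooth_on_open_block1:
  assumes U: "open U" and f: "smooth_on_open U f"
  shows "smooth_on_open U (\<lambda>x. block1 (f x))"
proof -
  have "block0 q + block1 0 = block1 q" for q
    by (simp add: block0_def block1_def vec_eq_iff forall_3)
  then show ?thesis
    using smooth_on_open_add[OF U smooth_on_open_linear_compose[OF U linear_block0 f] smooth_on_open_const[of _ "block1 0"]]
    by simp
qed

lemma diffeomorphic_affine_image:
  assumes "linear L" "linear M" "\<And>p. p \<in> Y \<Longrightarrow> M (L p + c - c) = p"
  shows "diffeomorphic ((\<lambda>p. L p + c) ` Y) Y"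
  unfolding diffeomorphic_def
proof (intro exI diffeomorphismI)
  show "smooth_map ((\<lambda>p. L p + c) ` Y) (\<lambda>x. M (x - c))"
    by (rule smooth_mapI[of UNIV, OF _ _ smooth_on_open_linear_compose[OF open_UNIV assms(2)
      smooth_on_open_diff[OF open_UNIV smooth_on_open_linear[OF open_UNIV linear_ident] smooth_on_open_const]]]) simp_all
  show "smooth_map Y (\<lambda>p. L p + c)"
    by (rule smooth_mapI[of UNIV, OF _ _ smooth_on_open_add[OF open_UNIV
      smooth_on_open_linear[OF open_UNIV assms(1)] smooth_on_open_const]]) simp_all
qed (use assms(3) in auto)

lemma line_forms_diffeomorphic:
  assumes "\<alpha> > 0"
  shows "diffeomorphic (line_forms \<alpha>) CP1"
proof -
  have eq: "line_forms \<alpha> = (\<lambda>p. form_of ((2 + \<alpha>) *\<^sub>R block0 p) + form_of (- mat 1)) ` CP1"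
    by (simp add: line_forms_def form_of_simps(1)[symmetric])
  show ?thesis unfolding eq
  proof (rule diffeomorphic_affine_image)
    show "linear (\<lambda>p. form_of ((2 + \<alpha>) *\<^sub>R block0 p))"
      using linear_compose[OF linear_compose_scale_right[OF linear_block0] linear_form_of] by (simp add: o_def)
    show "linear (\<lambda>\<omega>. (1 / (2 + \<alpha>)) *\<^sub>R block2 (matrix_of \<omega>))"
      using linear_compose_scale_right[OF linear_compose[OF linear_matrix_of linear_block2]] by (simp add: o_def)
  qed (use assms in \<open>simp add: linear_scale[OF linear_block2]\<close>)
qed

lemma plane_forms_diffeomorphic:
  assumes "\<alpha> > 0"
  shows "diffeomorphic (plane_forms \<alpha>) CP2"
proof -
  have eq: "plane_forms \<alpha> = (\<lambda>P. form_of (\<alpha> *\<^sub>R P) + form_of (mat 1)) ` CP2"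
    by (simp add: plane_forms_def form_of_simps(1)[symmetric] add.commute)
  show ?thesis unfolding eq
  proof (rule diffeomorphic_affine_image)
    show "linear (\<lambda>P. form_of (\<alpha> *\<^sub>R P))"
      using linear_compose[OF linear_compose_scale_right[OF linear_ident] linear_form_of] by (simp add: o_def)
    show "linear (\<lambda>\<omega>. (1 / \<alpha>) *\<^sub>R matrix_of \<omega>)"
      using linear_compose_scale_right[OF linear_matrix_of] by (simp add: o_def)
  qed (use assms in simp)
qed

lemma line_proj_diag: "norm u = 1 \<Longrightarrow> Re (line_proj u $ i $ i) = (cmod (u $ i))\<^sup>2"
  by (simp add: line_proj_unit complex_mult_cnj cmod_power2)

lemma unit_2: "norm u = 1 \<longleftrightarrow> (cmod (u$1))\<^sup>2 + (cmod (u$2))\<^sup>2 = 1" for u :: "complex^2"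
  unfolding norm_eq_1_sq norm_complex_2 ..

lemma unit_3: "norm u = 1 \<longleftrightarrow> (cmod (u$1))\<^sup>2 + (cmod (u$2))\<^sup>2 + (cmod (u$3))\<^sup>2 = 1" for u :: "complex^3"
  unfolding norm_eq_1_sq norm_complex_3 ..

lemma CP_unit: "projective_space = line_proj ` {u. norm u = 1}"
  by (auto elim: projective_space_unit intro!: line_proj_in_projective_space)

lemma moment_line_forms_point:
  assumes "norm u = 1"
  shows "moment_map (form_of (- mat 1 + (2 + \<alpha>) *\<^sub>R block0 (line_proj u))) =
    (1 - (cmod (u$2))\<^sup>2) *\<^sub>R vector [1 + \<alpha>, -1, -1] + (cmod (u$2))\<^sup>2 *\<^sub>R vector [-1, 1 + \<alpha>, -1]"
proof -
  have 1: "(cmod (u$1))\<^sup>2 = 1 - (cmod (u$2))\<^sup>2" using assms unit_2[of u] by simp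
  show ?thesis
    by (simp add: moment_map_form_of vec_eq_iff forall_3 mat_def block0_def line_proj_diag[OF assms] 1 algebra_simps)
qed

lemma moment_line_forms:
  "moment_map ` line_forms \<alpha> = closed_segment (vector [1 + \<alpha>, -1, -1]) (vector [-1, 1 + \<alpha>, -1])"
proof (intro subset_antisym subsetI)
  fix x assume "x \<in> moment_map ` line_forms \<alpha>"
  then obtain u where u: "norm u = 1" "x = moment_map (form_of (- mat 1 + (2 + \<alpha>) *\<^sub>R block0 (line_proj u)))"
    unfolding line_forms_def CP_unit by blast
  moreover have "(cmod (u$2))\<^sup>2 \<le> 1" using u(1) unfolding unit_2 by (smt (verit) zero_le_power2)
  ultimately show "x \<in> closed_segment (vector [1 + \<alpha>, -1, -1]) (vector [-1, 1 + \<alpha>, -1])"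
    unfolding closed_segment_def moment_line_forms_point[OF u(1)] by auto
next
  fix x assume "x \<in> closed_segment (vector [1 + \<alpha>, -1, -1]) (vector [-1, 1 + \<alpha>, -1] :: real^3)"
  then obtain t where t: "0 \<le> t" "t \<le> 1" and x: "x = (1 - t) *\<^sub>R vector [1 + \<alpha>, -1, -1] + t *\<^sub>R vector [-1, 1 + \<alpha>, -1]"
    unfolding closed_segment_def by blast
  define u :: "complex^2" where "u = vector [of_real (sqrt (1 - t)), of_real (sqrt t)]"
  have u: "norm u = 1" unfolding unit_2 u_def using t by simp
  have "x = moment_map (form_of (- mat 1 + (2 + \<alpha>) *\<^sub>R block0 (line_proj u)))"
    unfolding moment_line_forms_point[OF u] using t by (simp add: x u_def)
  then show "x \<in> moment_map ` line_forms \<alpha>" using u unfolding line_forms_def CP_unit by blast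
qed

lemma moment_plane_forms_point:
  assumes "norm z = 1"
  shows "moment_map (form_of (mat 1 + \<alpha> *\<^sub>R line_proj z)) = (cmod (z$1))\<^sup>2 *\<^sub>R vector [1 + \<alpha>, 1, 1]
    + (cmod (z$2))\<^sup>2 *\<^sub>R vector [1, 1 + \<alpha>, 1] + (cmod (z$3))\<^sup>2 *\<^sub>R vector [1, 1, 1 + \<alpha>]"
proof -
  have 1: "(cmod (z$1))\<^sup>2 = 1 - (cmod (z$2))\<^sup>2 - (cmod (z$3))\<^sup>2" using assms unit_3[of z] by simp
  show ?thesis
    by (simp add: moment_map_form_of vec_eq_iff forall_3 mat_def line_proj_diag[OF assms] 1 algebra_simps)
qed

lemma moment_plane_forms:
  "moment_map ` plane_forms \<alpha> = convex hull
       {vector [1 + \<alpha>, 1, 1], vector [1, 1 + \<alpha>, 1], vector [1, 1, 1 + \<alpha>]}"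
  unfolding convex_hull_3
proof (intro subset_antisym subsetI)
  fix x assume "x \<in> moment_map ` plane_forms \<alpha>"
  then obtain z where z: "norm z = 1" "x = moment_map (form_of (mat 1 + \<alpha> *\<^sub>R line_proj z))"
    unfolding plane_forms_def CP_unit by blast
  show "x \<in> {a *\<^sub>R vector [1 + \<alpha>, 1, 1] + b *\<^sub>R vector [1, 1 + \<alpha>, 1] + c *\<^sub>R vector [1, 1, 1 + \<alpha>] | a b c.
      0 \<le> a \<and> 0 \<le> b \<and> 0 \<le> c \<and> a + b + c = 1}"
    unfolding z(2) moment_plane_forms_point[OF z(1)] using z(1)[unfolded unit_3]
    by (intro CollectI exI[of _ "(cmod (z$1))\<^sup>2"] exI[of _ "(cmod (z$2))\<^sup>2"] exI[of _ "(cmod (z$3))\<^sup>2"]) simp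
next
  fix x :: "real^3" assume "x \<in> {a *\<^sub>R vector [1 + \<alpha>, 1, 1] + b *\<^sub>R vector [1, 1 + \<alpha>, 1] + c *\<^sub>R vector [1, 1, 1 + \<alpha>] | a b c.
      0 \<le> a \<and> 0 \<le> b \<and> 0 \<le> c \<and> a + b + c = 1}"
  then obtain a b c where abc: "0 \<le> a" "0 \<le> b" "0 \<le> c" "a + b + c = 1"
    and x: "x = a *\<^sub>R vector [1 + \<alpha>, 1, 1] + b *\<^sub>R vector [1, 1 + \<alpha>, 1] + c *\<^sub>R vector [1, 1, 1 + \<alpha>]" by blast
  define z :: "complex^3" where "z = vector [of_real (sqrt a), of_real (sqrt b), of_real (sqrt c)]"
  have z: "norm z = 1" unfolding unit_3 z_def using abc by simp
  have "x = moment_map (form_of (mat 1 + \<alpha> *\<^sub>R line_proj z))"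
    unfolding moment_plane_forms_point[OF z] using abc by (simp add: x z_def)
  then show "x \<in> moment_map ` plane_forms \<alpha>" using z unfolding plane_forms_def CP_unit by blast
qed

lemma moment_flag_forms_point:
  assumes u: "norm u = 1" and st: "(cmod s)\<^sup>2 + (cmod t)\<^sup>2 = 1"
  defines "q \<equiv> (cmod (u$1))\<^sup>2" and "\<sigma> \<equiv> (cmod s)\<^sup>2"
  shows "moment_map (form_of (mat 1 - 2 *\<^sub>R block1 (line_proj u) - \<alpha> *\<^sub>R line_proj (vector [s * u$1, s * u$2, t]))) =
    vector [1 - 2 * q - \<alpha> * \<sigma> * q, 1 - 2 * (1 - q) - \<alpha> * \<sigma> * (1 - q), - 1 - \<alpha> * (1 - \<sigma>)]"
proof -
  have n: "norm (vector [s * u$1, s * u$2, t] :: complex^3) = 1"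
    using norm_flag_vector[OF u] st unfolding norm_eq_1_sq by simp
  have 1: "(cmod (u$2))\<^sup>2 = 1 - q" "(cmod t)\<^sup>2 = 1 - \<sigma>" using u st unfolding unit_2 by (simp_all add: q_def \<sigma>_def)
  show ?thesis
    by (simp add: moment_map_form_of vec_eq_iff forall_3 mat_def block1_def line_proj_diag[OF u] line_proj_diag[OF n]
      norm_mult power_mult_distrib 1 q_def[symmetric] \<sigma>_def[symmetric] algebra_simps)
qed

text \<open>In the parameters \<open>q = \<bar>u\<^sub>1\<bar>\<^sup>2\<close> and \<open>\<sigma> = \<bar>s\<bar>\<^sup>2\<close> of the unit square the moment map is affine in each
  of them, so it interpolates the four vertices, which gives one inclusion. For the other, a convex combination
  with weights \<open>w\<^sub>1, \<dots>, w\<^sub>4\<close> determines \<open>\<sigma> = w\<^sub>1 + w\<^sub>3\<close> through the third coordinate, and then the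
  first coordinate is an equation for \<open>q\<close> that is linear with positive coefficient \<open>2 + \<alpha> \<sigma>\<close>.\<close>

lemma moment_flag_forms:
  assumes "\<alpha> > 0"
  shows "moment_map ` flag_forms \<alpha> = convex hull
       {vector [1, -1 - \<alpha>, -1], vector [1, -1, -1 - \<alpha>], vector [-1 - \<alpha>, 1, -1], vector [-1, 1, -1 - \<alpha>]}"
    (is "_ = convex hull ?V")
proof (intro subset_antisym subsetI)
  fix x assume "x \<in> moment_map ` flag_forms \<alpha>"
  then obtain u s t where u: "norm u = 1" and st: "(cmod s)\<^sup>2 + (cmod t)\<^sup>2 = 1"
    and x: "x = moment_map (form_of (mat 1 - 2 *\<^sub>R block1 (line_proj u) - \<alpha> *\<^sub>R line_proj (vector [s * u$1, s * u$2, t])))"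
    unfolding flag_forms_def by blast
  define q \<sigma> where "q = (cmod (u$1))\<^sup>2" and "\<sigma> = (cmod s)\<^sup>2"
  have q: "0 \<le> q" "q \<le> 1" and \<sigma>: "0 \<le> \<sigma>" "\<sigma> \<le> 1"
    using u st unfolding unit_2 q_def \<sigma>_def by (smt (verit) zero_le_power2)+
  have conv: "(1 - r) *\<^sub>R a + r *\<^sub>R b \<in> convex hull ?V" if "0 \<le> r" "r \<le> 1" "a \<in> convex hull ?V" "b \<in> convex hull ?V" for r a b
    using convexD_alt[OF convex_convex_hull that(3,4,1,2)] .
  have "x = (1 - q) *\<^sub>R ((1 - \<sigma>) *\<^sub>R vector [1, -1, -1 - \<alpha>] + \<sigma> *\<^sub>R vector [1, -1 - \<alpha>, -1])
     + q *\<^sub>R ((1 - \<sigma>) *\<^sub>R vector [-1, 1, -1 - \<alpha>] + \<sigma> *\<^sub>R vector [-1 - \<alpha>, 1, -1])"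
    unfolding x moment_flag_forms_point[OF u st] q_def[symmetric] \<sigma>_def[symmetric]
    by (simp add: vec_eq_iff forall_3 algebra_simps)
  also have "\<dots> \<in> convex hull ?V"
    by (intro conv q \<sigma> hull_inc) auto
  finally show "x \<in> convex hull ?V" .
next
  fix x assume "x \<in> convex hull ?V"
  then obtain w1 w v2 v3 v4 where w: "0 \<le> w1" "0 \<le> w" "w1 + w = 1" and v: "0 \<le> v2" "0 \<le> v3" "0 \<le> v4" "v2 + v3 + v4 = 1"
    and x: "x = w1 *\<^sub>R vector [1, -1 - \<alpha>, -1] + w *\<^sub>R (v2 *\<^sub>R vector [1, -1, -1 - \<alpha>]
      + v3 *\<^sub>R vector [-1 - \<alpha>, 1, -1] + v4 *\<^sub>R vector [-1, 1, -1 - \<alpha>])"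
    by (subst (asm) convex_hull_insert, simp, subst (asm) convex_hull_3) blast
  define w2 w3 w4 where "w2 = w * v2" and "w3 = w * v3" and "w4 = w * v4"
  have w0: "0 \<le> w2" "0 \<le> w3" "0 \<le> w4" using w v by (simp_all add: w2_def w3_def w4_def)
  have "w2 + w3 + w4 = w * (v2 + v3 + v4)" by (simp add: w2_def w3_def w4_def algebra_simps)
  then have sum: "w1 + w2 + w3 + w4 = 1" using w v by simp
  define \<sigma> where "\<sigma> = w1 + w3"
  define q where "q = (2 * (w3 + w4) + \<alpha> * w3) / (2 + \<alpha> * \<sigma>)"
  have \<sigma>: "0 \<le> \<sigma>" "\<sigma> \<le> 1" using w w0 sum by (simp_all add: \<sigma>_def)
  have pos: "2 + \<alpha> * \<sigma> > 0" using assms \<sigma> by (simp add: add_pos_nonneg)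
  have "\<alpha> * w3 \<le> \<alpha> * \<sigma>" using assms w by (simp add: \<sigma>_def)
  moreover have "2 * (w3 + w4) \<le> 2" using w0 w sum by simp
  ultimately have "2 * (w3 + w4) + \<alpha> * w3 \<le> 2 + \<alpha> * \<sigma>" by (rule add_mono[rotated])
  moreover have "0 \<le> 2 * (w3 + w4) + \<alpha> * w3" using assms w0 by simp
  ultimately have q: "0 \<le> q" "q \<le> 1" using pos by (simp_all add: q_def)
  have qeq: "q * (2 + \<alpha> * \<sigma>) = 2 * (w3 + w4) + \<alpha> * w3" using pos by (simp add: q_def)
  define u :: "complex^2" where "u = vector [of_real (sqrt q), of_real (sqrt (1 - q))]"
  define s t where "s = complex_of_real (sqrt \<sigma>)" and "t = complex_of_real (sqrt (1 - \<sigma>))"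
  have u: "norm u = 1" unfolding unit_2 u_def using q by simp
  have st: "(cmod s)\<^sup>2 + (cmod t)\<^sup>2 = 1" using \<sigma> by (simp add: s_def t_def)
  have qs: "(cmod (u$1))\<^sup>2 = q" "(cmod s)\<^sup>2 = \<sigma>" using q \<sigma> by (simp_all add: u_def s_def)
  have x': "x = w1 *\<^sub>R vector [1, -1 - \<alpha>, -1] + w2 *\<^sub>R vector [1, -1, -1 - \<alpha>]
      + w3 *\<^sub>R vector [-1 - \<alpha>, 1, -1] + w4 *\<^sub>R vector [-1, 1, -1 - \<alpha>]"
    by (simp add: x w2_def w3_def w4_def algebra_simps)
  have c1: "1 - 2 * q - \<alpha> * \<sigma> * q = w1 + w2 - (1 + \<alpha>) * w3 - w4" using qeq sum by (simp add: algebra_simps)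
  have c2: "1 - 2 * (1 - q) - \<alpha> * \<sigma> * (1 - q) = - (1 + \<alpha>) * w1 - w2 + w3 + w4"
    using qeq sum by (simp add: algebra_simps \<sigma>_def)
  have c3: "- 1 - \<alpha> * (1 - \<sigma>) = - w1 - (1 + \<alpha>) * w2 - w3 - (1 + \<alpha>) * w4"
  proof -
    have *: "1 - \<sigma> = w2 + w4" using sum by (simp add: \<sigma>_def)
    show ?thesis unfolding * using sum by (simp add: algebra_simps)
  qed
  have "x = moment_map (form_of (mat 1 - 2 *\<^sub>R block1 (line_proj u) - \<alpha> *\<^sub>R line_proj (vector [s * u$1, s * u$2, t])))"
    unfolding moment_flag_forms_point[OF u st] qs c1 c2 c3 x' by (simp add: vec_eq_iff forall_3 algebra_simps)
  then show "x \<in> moment_map ` flag_forms \<alpha>" using u st unfolding flag_forms_def by blast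
qed

section \<open>The bundle structure of the third component\<close>

lemma bilinear_matrix_mult: "bilinear ((**) :: complex^'n^'m \<Rightarrow> complex^'p^'n \<Rightarrow> complex^'p^'m)"
  unfolding bilinear_def
  by (auto intro!: linearI simp: matrix_matrix_mult_def vec_eq_iff sum.distrib scaleR_sum_right algebra_simps)

lemma linear_conj_transpose: "linear conj_transpose"
  by (rule linearI) (simp_all add: conj_transpose_def vec_eq_iff)

lemmas matrix_simps = bilinear_ladd[OF bilinear_matrix_mult] bilinear_radd[OF bilinear_matrix_mult]
  bilinear_lsub[OF bilinear_matrix_mult] bilinear_rsub[OF bilinear_matrix_mult]
  bilinear_lmul[OF bilinear_matrix_mult] bilinear_rmul[OF bilinear_matrix_mult]

lemma conj_transpose_conj_transpose [simp]: "conj_transpose (conj_transpose A) = A"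
  by (simp add: conj_transpose_def vec_eq_iff)

lemma conj_transpose_adjoint:
  "(\<Sum>i\<in>UNIV. (V *v z)$i * cnj (w$i)) = (\<Sum>k\<in>UNIV. z$k * cnj ((conj_transpose V *v w)$k))"
proof -
  have "(\<Sum>i\<in>UNIV. (V *v z)$i * cnj (w$i)) = (\<Sum>i\<in>UNIV. \<Sum>k\<in>UNIV. V$i$k * z$k * cnj (w$i))"
    by (simp add: matrix_vector_mult_def sum_distrib_right)
  also have "\<dots> = (\<Sum>k\<in>UNIV. \<Sum>i\<in>UNIV. V$i$k * z$k * cnj (w$i))" by (rule sum.swap)
  also have "\<dots> = (\<Sum>k\<in>UNIV. z$k * cnj ((conj_transpose V *v w)$k))"
    by (simp add: matrix_vector_mult_def conj_transpose_def sum_distrib_left mult_ac)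
  finally show ?thesis .
qed

lemma line_proj_isometry:
  assumes V: "conj_transpose V ** V = mat 1" and z: "norm z = 1"
  shows "norm (V *v z) = 1" "line_proj (V *v z) = V ** line_proj z ** conj_transpose V"
proof -
  have "complex_of_real ((norm (V *v z))\<^sup>2) = (\<Sum>k\<in>UNIV. z$k * cnj ((conj_transpose V *v (V *v z))$k))"
    unfolding norm_sq_complex by (rule conj_transpose_adjoint)
  also have "\<dots> = complex_of_real ((norm z)\<^sup>2)"
    unfolding norm_sq_complex matrix_vector_mul_assoc V by simp
  finally show n: "norm (V *v z) = 1" unfolding norm_eq_1_sq of_real_eq_iff z by simp
  have "(V ** line_proj z ** conj_transpose V) $ i $ j = (V *v z)$i * cnj ((V *v z)$j)" for i j
  proof -
    have "(V ** line_proj z) $ i $ k = (V *v z)$i * cnj (z$k)" for k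
      by (simp add: matrix_matrix_mult_def matrix_vector_mult_def line_proj_unit[OF z] sum_distrib_right mult.assoc)
    then have "(V ** line_proj z ** conj_transpose V) $ i $ j = (\<Sum>k\<in>UNIV. (V *v z)$i * cnj (z$k) * cnj (V$j$k))"
      by (simp add: matrix_matrix_mult_def[of "V ** line_proj z"] conj_transpose_def)
    then show ?thesis by (simp add: matrix_vector_mult_def sum_distrib_left mult_ac)
  qed
  then show "line_proj (V *v z) = V ** line_proj z ** conj_transpose V"
    by (simp add: vec_eq_iff line_proj_unit[OF n])
qed

lemma line_proj_idem: "norm z = 1 \<Longrightarrow> line_proj z ** line_proj z = line_proj z"
proof -
  assume z: "norm z = 1"
  have "(line_proj z ** line_proj z) $ i $ j = z$i * (\<Sum>k\<in>UNIV. z$k * cnj (z$k)) * cnj (z$j)" for i j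
    by (simp add: matrix_matrix_mult_def line_proj_unit[OF z] sum_distrib_left sum_distrib_right mult_ac)
  then show ?thesis unfolding norm_sq_complex[symmetric] by (simp add: vec_eq_iff line_proj_unit[OF z] z)
qed

text \<open>The columns are \<open>u\<close> and the basis vector of the centre, so for a unit vector \<open>u\<close> this is an isometry of
  \<open>complex^2\<close> onto the sum of the line of \<open>u\<close> and the centre. It transports lines in
  \<open>complex^2\<close> to the lines that occur in \<open>flag_forms\<close>.\<close>

definition flag_frame :: "complex^2 \<Rightarrow> complex^2^3" where
  "flag_frame u = vector [vector [u$1, 0], vector [u$2, 0], vector [0, 1]]"

lemma flag_frame:
  assumes "norm u = 1"
  shows "conj_transpose (flag_frame u) ** flag_frame u = mat 1"
    "flag_frame u ** conj_transpose (flag_frame u) = block1 (line_proj u)"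
proof -
  have "u$1 * cnj (u$1) + u$2 * cnj (u$2) = 1" using assms by (rule unit_complex_2)
  then show "conj_transpose (flag_frame u) ** flag_frame u = mat 1"
    by (simp add: vec_eq_iff forall_2 matrix_matrix_mult_def sum_3 flag_frame_def conj_transpose_def mat_def mult.commute)
  show "flag_frame u ** conj_transpose (flag_frame u) = block1 (line_proj u)"
    by (simp add: vec_eq_iff forall_3 matrix_matrix_mult_def sum_2 flag_frame_def conj_transpose_def block1_def
      line_proj_unit[OF assms])
qed

definition flag_form :: "real \<Rightarrow> complex^2 \<Rightarrow> complex^2^2 \<Rightarrow> real^6^6" where
  "flag_form \<alpha> u p = form_of (mat 1 - 2 *\<^sub>R block1 (line_proj u)
     - \<alpha> *\<^sub>R (flag_frame u ** p ** conj_transpose (flag_frame u)))"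

lemma flag_forms_eq: "flag_forms \<alpha> = {flag_form \<alpha> u p | u p. norm u = 1 \<and> p \<in> CP1}"
proof -
  have eq: "line_proj (vector [s * u$1, s * u$2, t]) = flag_frame u ** line_proj (vector [s, t]) ** conj_transpose (flag_frame u)"
    if "norm u = 1" "(cmod s)\<^sup>2 + (cmod t)\<^sup>2 = 1" for u :: "complex^2" and s t
  proof -
    have "flag_frame u *v vector [s, t] = vector [s * u$1, s * u$2, t]"
      by (simp add: flag_frame_def matrix_vector_mult_def sum_2 vec_eq_iff forall_3 mult.commute)
    moreover have "norm (vector [s, t] :: complex^2) = 1" using that by (simp add: unit_2)
    ultimately show ?thesis using line_proj_isometry(2)[OF flag_frame(1)[OF that(1)]] by metis
  qed
  show ?thesis
  proof (intro subset_antisym subsetI)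
    fix \<omega> assume "\<omega> \<in> flag_forms \<alpha>"
    then obtain u s t where u: "norm u = 1" and st: "(cmod s)\<^sup>2 + (cmod t)\<^sup>2 = 1"
      and \<omega>: "\<omega> = form_of (mat 1 - 2 *\<^sub>R block1 (line_proj u) - \<alpha> *\<^sub>R line_proj (vector [s * u$1, s * u$2, t]))"
      unfolding flag_forms_def by blast
    have "\<omega> = flag_form \<alpha> u (line_proj (vector [s, t]))" by (simp add: \<omega> flag_form_def eq[OF u st])
    moreover have "line_proj (vector [s, t]) \<in> CP1" using st unfolding CP_unit by (auto simp: unit_2)
    ultimately show "\<omega> \<in> {flag_form \<alpha> u p | u p. norm u = 1 \<and> p \<in> CP1}" using u by blast
  next
    fix \<omega> assume "\<omega> \<in> {flag_form \<alpha> u p | u p. norm u = 1 \<and> p \<in> CP1}"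
    then obtain u z where u: "norm u = 1" and z: "norm z = 1" and \<omega>: "\<omega> = flag_form \<alpha> u (line_proj z)"
      unfolding CP_unit by blast
    have zeq: "z = vector [z$1, z$2]" by (simp add: vec_eq_iff forall_2)
    have st: "(cmod (z$1))\<^sup>2 + (cmod (z$2))\<^sup>2 = 1" using z by (simp add: unit_2)
    have "\<omega> = form_of (mat 1 - 2 *\<^sub>R block1 (line_proj u) - \<alpha> *\<^sub>R line_proj (vector [z$1 * u$1, z$1 * u$2, z$2]))"
      unfolding eq[OF u st] zeq[symmetric] by (simp add: \<omega> flag_form_def)
    then show "\<omega> \<in> flag_forms \<alpha>" unfolding flag_forms_def using u st by blast
  qed
qed

text \<open>With \<open>X = 1 - 2 S - \<alpha> P\<close> as in \<open>spectral_projection\<close>, the polynomial \<open>(X + 1) (X + 1 + \<alpha>)\<close> vanishes on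
  the range of \<open>S\<close>, where \<open>X\<close> has the eigenvalues \<open>- 1\<close> and \<open>- 1 - \<alpha>\<close>, and equals \<open>4 + 2 \<alpha>\<close> on the kernel of
  \<open>S\<close>, where \<open>X = 1\<close>. So \<open>S\<close>, and with it the line of \<open>u\<close>, is a polynomial in the form.\<close>

definition flag_base :: "real \<Rightarrow> real^6^6 \<Rightarrow> complex^2^2" where
  "flag_base \<alpha> \<omega> = block2 (mat 1 - (1 / (4 + 2 * \<alpha>)) *\<^sub>R
     ((matrix_of \<omega> + mat 1) ** (matrix_of \<omega> + (1 + \<alpha>) *\<^sub>R mat 1)))"

definition flag_plane :: "real \<Rightarrow> real^6^6 \<Rightarrow> complex^3^3" where
  "flag_plane \<alpha> \<omega> = (1 / \<alpha>) *\<^sub>R (mat 1 - 2 *\<^sub>R block1 (flag_base \<alpha> \<omega>) - matrix_of \<omega>)"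

lemma spectral_projection:
  fixes S P :: "complex^'n^'n" and \<alpha> :: real
  assumes "S ** S = S" "P ** P = P" "S ** P = P" "P ** S = P"
  defines "X \<equiv> mat 1 - 2 *\<^sub>R S - \<alpha> *\<^sub>R P"
  shows "(X + mat 1) ** (X + (1 + \<alpha>) *\<^sub>R mat 1) = (4 + 2 * \<alpha>) *\<^sub>R (mat 1 - S)"
proof -
  have "(X + mat 1) ** (X + (1 + \<alpha>) *\<^sub>R mat 1) =
      (2 *\<^sub>R mat 1 - 2 *\<^sub>R S - \<alpha> *\<^sub>R P) ** ((2 + \<alpha>) *\<^sub>R mat 1 - 2 *\<^sub>R S - \<alpha> *\<^sub>R P)"
    by (simp add: X_def algebra_simps scaleR_2)
  also have "\<dots> = (4 + 2 * \<alpha>) *\<^sub>R (mat 1 - S)"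
    unfolding matrix_simps assms matrix_mul_lid matrix_mul_rid by (simp add: algebra_simps vec_eq_iff)
  finally show ?thesis .
qed

lemma flag_form_recover:
  assumes \<alpha>: "\<alpha> > 0" and u: "norm u = 1" and p: "p \<in> CP1"
  shows "flag_base \<alpha> (flag_form \<alpha> u p) = line_proj u"
    "flag_plane \<alpha> (flag_form \<alpha> u p) = flag_frame u ** p ** conj_transpose (flag_frame u)"
proof -
  define T where "T = flag_frame u"
  define S where "S = block1 (line_proj u)"
  define P where "P = T ** p ** conj_transpose T"
  have TT: "conj_transpose T ** T = mat 1" and TS: "T ** conj_transpose T = S"
    using flag_frame[OF u] by (simp_all add: T_def S_def)
  have pp: "p ** p = p" using p line_proj_idem unfolding CP_unit by auto
  have "S ** S = T ** (conj_transpose T ** T) ** conj_transpose T" by (simp add: TS[symmetric] matrix_mul_assoc)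
  then have 1: "S ** S = S" by (simp add: TT TS)
  have "P ** P = T ** (p ** (conj_transpose T ** T) ** p) ** conj_transpose T" by (simp add: P_def matrix_mul_assoc)
  then have 2: "P ** P = P" by (simp add: TT pp P_def)
  have "S ** P = T ** (conj_transpose T ** T) ** p ** conj_transpose T" by (simp add: TS[symmetric] P_def matrix_mul_assoc)
  then have 3: "S ** P = P" by (simp add: TT P_def)
  have "P ** S = T ** p ** (conj_transpose T ** T) ** conj_transpose T" by (simp add: TS[symmetric] P_def matrix_mul_assoc)
  then have 4: "P ** S = P" by (simp add: TT P_def)
  have X: "matrix_of (flag_form \<alpha> u p) = mat 1 - 2 *\<^sub>R S - \<alpha> *\<^sub>R P"
    by (simp add: flag_form_def S_def P_def T_def)
  show base: "flag_base \<alpha> (flag_form \<alpha> u p) = line_proj u"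
    unfolding flag_base_def X spectral_projection[OF 1 2 3 4] using \<alpha> by (simp add: S_def)
  show "flag_plane \<alpha> (flag_form \<alpha> u p) = flag_frame u ** p ** conj_transpose (flag_frame u)"
    unfolding flag_plane_def base X using \<alpha> by (simp add: S_def[symmetric] P_def[symmetric] T_def[symmetric])
qed

lemma smooth_flag_base:
  assumes U: "open U"
  shows "smooth_on_open U (flag_base \<alpha>)"
proof -
  have m: "smooth_on_open U (\<lambda>\<omega>. matrix_of \<omega> + c)" for c
    by (rule smooth_on_open_add[OF U smooth_on_open_linear[OF U linear_matrix_of] smooth_on_open_const])
  show ?thesis
    unfolding flag_base_def[abs_def]
    by (rule smooth_on_open_linear_compose[OF U linear_block2 smooth_on_open_diff[OF U smooth_on_open_const
      smooth_on_open_scaleR[OF U smooth_on_open_const smooth_on_open_bilinear[OF U bilinear_matrix_mult m m]]]])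
qed

lemma smooth_flag_plane:
  assumes U: "open U"
  shows "smooth_on_open U (flag_plane \<alpha>)"
  unfolding flag_plane_def[abs_def]
  by (rule smooth_on_open_scaleR[OF U smooth_on_open_const smooth_on_open_diff[OF U smooth_on_open_diff[OF U
      smooth_on_open_const smooth_on_open_scaleR[OF U smooth_on_open_const smooth_on_open_block1[OF U smooth_flag_base[OF U]]]]
      smooth_on_open_linear[OF U linear_matrix_of]]])

text \<open>A unit vector in the line \<open>Q\<close>: its \<open>i\<close>-th column, which has squared norm \<open>Q $ i $ i\<close>. It depends smoothly on
  \<open>Q\<close> where this number is positive, although no such section exists on all of \<open>CP1\<close>.\<close>

definition column_section :: "2 \<Rightarrow> complex^2^2 \<Rightarrow> complex^2" where
  "column_section i Q = (1 / sqrt (Re (Q $ i $ i))) *\<^sub>R (\<chi> k. Q $ k $ i)"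

lemma column_section:
  assumes Q: "Q \<in> CP1" and i: "Q $ i $ i \<noteq> 0"
  shows "norm (column_section i Q) = 1" "line_proj (column_section i Q) = Q"
proof -
  obtain u where u: "norm u = 1" and Qu: "Q = line_proj u" using Q unfolding CP_unit by blast
  have ui: "u $ i \<noteq> 0" using i by (auto simp: Qu line_proj_unit[OF u])
  define c where "c = cnj (u $ i) / of_real (cmod (u $ i))"
  have c: "cmod c = 1" using ui by (simp add: c_def norm_divide)
  have "column_section i Q = c *s u"
    unfolding column_section_def Qu line_proj_diag[OF u]
    by (simp add: vec_eq_iff line_proj_unit[OF u] c_def scaleR_conv_of_real[where 'a = complex])
  moreover have "norm (c *s u) = 1"
    using u c unfolding unit_2 by (simp add: norm_mult)
  moreover have "line_proj (c *s u) = line_proj u"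
  proof -
    have "c \<noteq> 0" "u \<noteq> 0" "c *s u \<noteq> 0" using c u calculation(2) by auto
    then show ?thesis using line_proj_eq_iff by metis
  qed
  ultimately show "norm (column_section i Q) = 1" "line_proj (column_section i Q) = Q" by (simp_all add: Qu)
qed

lemma CP1_diag_pos:
  assumes Q: "Q \<in> CP1" and i: "Q $ i $ i \<noteq> 0"
  shows "Re (Q $ i $ i) > 0"
proof -
  obtain u where u: "norm u = 1" and Qu: "Q = line_proj u" using Q unfolding CP_unit by blast
  have "u $ i \<noteq> 0" using i by (auto simp: Qu line_proj_unit[OF u])
  then show ?thesis by (simp add: Qu line_proj_diag[OF u])
qed

lemma smooth_flag_frame_section:
  assumes U: "open U" and f: "smooth_on_open U f" and pos: "\<And>x. x \<in> U \<Longrightarrow> Re (f x $ i $ i) > 0"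
  shows "smooth_on_open U (\<lambda>x. flag_frame (column_section i (f x)))"
proof -
  define L where "L u = flag_frame u - flag_frame 0" for u
  have L: "linear L"
    by (rule linearI) (simp_all add: L_def flag_frame_def vec_eq_iff forall_3 forall_2)
  have "linear (\<lambda>Q::complex^2^2. Re (Q $ i $ i))" "linear (\<lambda>Q::complex^2^2. \<chi> k. Q $ k $ i)"
    by (auto intro!: linearI simp: vec_eq_iff)
  note lin = this[THEN smooth_on_open_linear_compose[OF U _ f]]
  have "smooth_on_open U (\<lambda>x. column_section i (f x))"
    unfolding column_section_def
    by (rule smooth_on_open_scaleR[OF U smooth_on_open_inverse_sqrt[OF U pos lin(1)] lin(2)])
  from smooth_on_open_add[OF U smooth_on_open_linear_compose[OF U L this] smooth_on_open_const[of _ "flag_frame 0"]]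
  show ?thesis by (simp add: L_def)
qed

lemma smooth_on_open_imp_continuous: "smooth_on_open U f \<Longrightarrow> continuous_on U f"
  unfolding smooth_on_open_def by (metis Ck_on.simps(1))

text \<open>A line in the sum of \<open>u\<close> and the centre is described by its coordinates in the orthonormal basis consisting of the
  unit section and the basis vector of the centre. On projections this is \<open>P \<mapsto> T\<^sup>* P T\<close> with inverse
  \<open>p \<mapsto> T p T\<^sup>*\<close>.\<close>

lemma flag_forms_local_trivialization:
  assumes \<alpha>: "\<alpha> > 0"
  defines "T \<equiv> \<lambda>i Q. flag_frame (column_section i Q)"
  defines "U \<equiv> \<lambda>i. {Q \<in> CP1. Q $ i $ i \<noteq> 0}"
  shows "diffeomorphism {\<omega> \<in> flag_forms \<alpha>. flag_base \<alpha> \<omega> \<in> U i} (U i \<times> CP1)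
    (\<lambda>\<omega>. (flag_base \<alpha> \<omega>, conj_transpose (T i (flag_base \<alpha> \<omega>)) ** flag_plane \<alpha> \<omega> ** T i (flag_base \<alpha> \<omega>)))"
    (is "diffeomorphism ?E _ ?\<phi>")
proof (rule diffeomorphismI)
  define \<psi> where "\<psi> = (\<lambda>(Q, p). form_of (mat 1 - 2 *\<^sub>R block1 Q - \<alpha> *\<^sub>R (T i Q ** p ** conj_transpose (T i Q))))"
  have TT: "conj_transpose (T i Q) ** T i Q = mat 1" "T i Q ** conj_transpose (T i Q) = block1 Q"
    if "Q \<in> U i" for Q
    using flag_frame[OF column_section(1)] column_section(2) that by (simp_all add: T_def U_def)
  have \<psi>: "\<psi> (Q, p) = flag_form \<alpha> (column_section i Q) p" if "Q \<in> U i" for Q p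
    using that column_section(2) by (simp add: \<psi>_def flag_form_def T_def U_def)
  have E: "?\<phi> \<omega> \<in> U i \<times> CP1 \<and> \<psi> (?\<phi> \<omega>) = \<omega>" if "\<omega> \<in> ?E" for \<omega>
  proof -
    have "\<omega> \<in> flag_forms \<alpha>" and Q: "flag_base \<alpha> \<omega> \<in> U i" using that by auto
    then obtain u p where u: "norm u = 1" and "p \<in> CP1" "\<omega> = flag_form \<alpha> u p"
      unfolding flag_forms_eq by blast
    then obtain z where z: "norm z = 1" and \<omega>: "\<omega> = flag_form \<alpha> u (line_proj z)"
      by (metis projective_space_unit)
    have "line_proj z \<in> CP1" using z unfolding CP_unit by blast
    note rec = flag_form_recover[OF \<alpha> u this, folded \<omega>]
    define S where "S = flag_frame u"
    define W where "W = T i (line_proj u)"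
    have Wi: "conj_transpose W ** W = mat 1" "W ** conj_transpose W = block1 (line_proj u)"
      using TT Q unfolding rec W_def by blast+
    have Si: "conj_transpose S ** S = mat 1" "S ** conj_transpose S = block1 (line_proj u)"
      using flag_frame[OF u] by (simp_all add: S_def)
    define V where "V = conj_transpose W ** S"
    \<comment> \<open>\<open>S\<close> and \<open>W\<close> have the same range, so \<open>V\<close> is the unitary change of basis between them.\<close>
    have "conj_transpose V ** V = conj_transpose S ** (W ** conj_transpose W) ** S"
      by (simp add: V_def conj_transpose_mult matrix_mul_assoc)
    also have "\<dots> = (conj_transpose S ** S) ** (conj_transpose S ** S)" unfolding Wi Si(2)[symmetric] by (simp add: matrix_mul_assoc)
    finally have V: "conj_transpose V ** V = mat 1" by (simp add: Si)
    have fib: "conj_transpose W ** (S ** line_proj z ** conj_transpose S) ** W = line_proj (V *v z)"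
      unfolding line_proj_isometry(2)[OF V z] by (simp add: V_def conj_transpose_mult matrix_mul_assoc)
    have "W ** (conj_transpose W ** (S ** line_proj z ** conj_transpose S) ** W) ** conj_transpose W
        = (W ** conj_transpose W) ** S ** line_proj z ** (conj_transpose S ** (W ** conj_transpose W))"
      by (simp add: matrix_mul_assoc)
    also have "\<dots> = S ** (conj_transpose S ** S) ** line_proj z ** ((conj_transpose S ** S) ** conj_transpose S)"
      unfolding Wi Si(2)[symmetric] by (simp add: matrix_mul_assoc)
    finally have reconstruct: "W ** (conj_transpose W ** (S ** line_proj z ** conj_transpose S) ** W) ** conj_transpose W = S ** line_proj z ** conj_transpose S"
      by (simp add: Si)
    have \<phi>: "?\<phi> \<omega> = (line_proj u, conj_transpose W ** (S ** line_proj z ** conj_transpose S) ** W)"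
      by (simp add: rec W_def S_def)
    have "line_proj (V *v z) \<in> CP1" using line_proj_isometry(1)[OF V z] unfolding CP_unit by blast
    then have "?\<phi> \<omega> \<in> U i \<times> CP1" using Q unfolding \<phi> unfolding fib by (simp add: rec)
    moreover have "\<psi> (?\<phi> \<omega>) = \<omega>"
      unfolding \<phi> unfolding \<psi>_def prod.case W_def[symmetric] reconstruct by (simp add: \<omega> flag_form_def S_def)
    ultimately show ?thesis by blast
  qed
  have B: "\<psi> x \<in> ?E \<and> ?\<phi> (\<psi> x) = x" if mem: "x \<in> U i \<times> CP1" for x
  proof -
    obtain Q p where x: "x = (Q, p)" and Q: "Q \<in> U i" and p: "p \<in> CP1"
      using mem by blast
    have n: "norm (column_section i Q) = 1" and l: "line_proj (column_section i Q) = Q"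
      using column_section Q by (auto simp: U_def)
    note rec = flag_form_recover[OF \<alpha> n p, folded \<psi>[OF Q], unfolded l]
    have "\<psi> x \<in> flag_forms \<alpha>" unfolding x \<psi>[OF Q] flag_forms_eq using n p by blast
    then have 1: "\<psi> x \<in> ?E" using Q by (simp add: x rec)
    have "?\<phi> (\<psi> x) = (Q, (conj_transpose (T i Q) ** T i Q) ** p ** (conj_transpose (T i Q) ** T i Q))"
      by (simp add: x rec T_def matrix_mul_assoc)
    then have "?\<phi> (\<psi> x) = x" unfolding TT[OF Q] matrix_mul_lid matrix_mul_rid x .
    with 1 show ?thesis by (rule conjI)
  qed
  show "?\<phi> ` ?E \<subseteq> U i \<times> CP1" "\<psi> ` (U i \<times> CP1) \<subseteq> ?E" using E B by blast+
  show "\<psi> (?\<phi> \<omega>) = \<omega>" if "\<omega> \<in> ?E" for \<omega> using E[OF that] by blast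
  show "?\<phi> (\<psi> x) = x" if "x \<in> U i \<times> CP1" for x using B[OF that] by blast
  have cont: "open {x. f x > 0}" if "continuous_on UNIV f" for f :: "'z::topological_space \<Rightarrow> real"
    using open_Collect_less[OF continuous_on_const that] .
  show "smooth_map ?E ?\<phi>"
  proof -
    define A where "A = {\<omega>. Re (flag_base \<alpha> \<omega> $ i $ i) > 0}"
    have "continuous_on UNIV (\<lambda>\<omega>. Re (flag_base \<alpha> \<omega> $ i $ i))"
      using smooth_on_open_imp_continuous[OF smooth_flag_base[OF open_UNIV]] by (intro continuous_intros)
    then have A: "open A" unfolding A_def by (rule cont)
    have sub: "?E \<subseteq> A" using CP1_diag_pos by (auto simp: A_def U_def)
    have b: "smooth_on_open A (flag_base \<alpha>)" and p: "smooth_on_open A (flag_plane \<alpha>)"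
      by (rule smooth_flag_base[OF A], rule smooth_flag_plane[OF A])
    have t: "smooth_on_open A (\<lambda>\<omega>. T i (flag_base \<alpha> \<omega>))"
      unfolding T_def by (rule smooth_flag_frame_section[OF A b]) (simp add: A_def)
    show ?thesis
      by (rule smooth_mapI[OF A sub smooth_on_open_Pair[OF A b smooth_on_open_bilinear[OF A bilinear_matrix_mult
        smooth_on_open_bilinear[OF A bilinear_matrix_mult smooth_on_open_linear_compose[OF A linear_conj_transpose t] p] t]]]) simp
  qed
  show "smooth_map (U i \<times> CP1) \<psi>"
  proof -
    define A :: "((complex^2^2) \<times> (complex^2^2)) set" where "A = {x. Re (fst x $ i $ i) > 0}"
    have "continuous_on UNIV (\<lambda>x::(complex^2^2) \<times> (complex^2^2). Re (fst x $ i $ i))"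
      by (intro continuous_intros)
    then have A: "open A" unfolding A_def by (rule cont)
    have sub: "U i \<times> CP1 \<subseteq> A" using CP1_diag_pos by (auto simp: A_def U_def)
    have b: "smooth_on_open A fst" and p: "smooth_on_open A snd"
      using smooth_on_open_linear[OF A linear_fst] smooth_on_open_linear[OF A linear_snd] by auto
    have t: "smooth_on_open A (\<lambda>x. T i (fst x))"
      unfolding T_def by (rule smooth_flag_frame_section[OF A b]) (simp add: A_def)
    have "smooth_on_open A (\<lambda>x. form_of (mat 1 - 2 *\<^sub>R block1 (fst x) - \<alpha> *\<^sub>R (T i (fst x) ** snd x ** conj_transpose (T i (fst x)))))"
      by (rule smooth_on_open_linear_compose[OF A linear_form_of smooth_on_open_diff[OF A smooth_on_open_diff[OF A
        smooth_on_open_const smooth_on_open_scaleR[OF A smooth_on_open_const smooth_on_open_block1[OF A b]]]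
        smooth_on_open_scaleR[OF A smooth_on_open_const smooth_on_open_bilinear[OF A bilinear_matrix_mult
        smooth_on_open_bilinear[OF A bilinear_matrix_mult t p] smooth_on_open_linear_compose[OF A linear_conj_transpose t]]]]])
    then show ?thesis by (rule smooth_mapI[OF A sub]) (simp add: \<psi>_def case_prod_beta)
  qed
qed

lemma flag_forms_bundle:
  assumes "\<alpha> > 0"
  shows "smooth_fibre_bundle (flag_forms \<alpha>) (flag_base \<alpha>) CP1 CP1"
  unfolding smooth_fibre_bundle_def
proof (intro conjI ballI)
  show "smooth_map (flag_forms \<alpha>) (flag_base \<alpha>)"
    by (rule smooth_mapI[OF open_UNIV _ smooth_flag_base[OF open_UNIV]]) auto
  show "flag_base \<alpha> ` flag_forms \<alpha> = CP1"
  proof (intro subset_antisym subsetI)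
    fix Q assume "Q \<in> flag_base \<alpha> ` flag_forms \<alpha>"
    then show "Q \<in> CP1" unfolding flag_forms_eq using flag_form_recover(1)[OF assms] by (auto simp: CP_unit)
  next
    fix Q :: "complex^2^2" assume Q: "Q \<in> CP1"
    then obtain u where u: "norm u = 1" "Q = line_proj u" unfolding CP_unit by blast
    have "flag_form \<alpha> u Q \<in> flag_forms \<alpha>" unfolding flag_forms_eq using u Q by blast
    then show "Q \<in> flag_base \<alpha> ` flag_forms \<alpha>"
      using flag_form_recover(1)[OF assms u(1) Q] u(2) by (metis image_eqI)
  qed
  fix Q :: "complex^2^2" assume Q: "Q \<in> CP1"
  then obtain u where u: "norm u = 1" "Q = line_proj u" unfolding CP_unit by blast
  then have "u \<noteq> 0" by auto
  then obtain i where "u $ i \<noteq> 0" by (auto simp: vec_eq_iff)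
  then have i: "Q $ i $ i \<noteq> 0" by (simp add: u line_proj_unit)
  have "open {Q :: complex^2^2. Q $ i $ i \<noteq> 0}"
    by (intro open_Collect_neq continuous_intros)
  then have "openin (top_of_set CP1) {Q \<in> CP1. Q $ i $ i \<noteq> 0}"
    unfolding openin_open by blast
  then show "\<exists>U \<phi>. openin (top_of_set CP1) U \<and> Q \<in> U \<and>
      diffeomorphism {x \<in> flag_forms \<alpha>. flag_base \<alpha> x \<in> U} (U \<times> CP1) \<phi> \<and>
      (\<forall>x\<in>flag_forms \<alpha>. flag_base \<alpha> x \<in> U \<longrightarrow> fst (\<phi> x) = flag_base \<alpha> x)"
    using flag_forms_local_trivialization[OF assms, of i] Q i
    by (intro exI[of _ "{Q \<in> CP1. Q $ i $ i \<noteq> 0}"] exI conjI) (assumption | simp)+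
qed

lemma level_sets_separated:
  fixes f :: "'a::topological_space \<Rightarrow> real"
  assumes f: "continuous_on UNIV f" and M: "\<And>x. x \<in> M \<Longrightarrow> f x = c" and N: "\<And>x. x \<in> N \<Longrightarrow> f x \<noteq> c"
    and fin: "finite (f ` N)"
  shows "openin (top_of_set (M \<union> N)) M"
proof -
  have "open (f -` (- (f ` N)))" using fin by (intro open_vimage f) (simp add: finite_imp_closed open_Compl)
  moreover have "M = (M \<union> N) \<inter> f -` (- (f ` N))" using M N by (auto, metis)
  ultimately show ?thesis unfolding openin_open by blast
qed

text \<open>The sum of the moment coordinates, which is the trace of \<open>X\<close> on \<open>form_of X\<close>. It is constant on each of the three
  components.\<close>

definition moment_sum :: "real^6^6 \<Rightarrow> real" where
  "moment_sum \<omega> = \<omega>$1$2 + \<omega>$3$4 + \<omega>$5$6"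

lemma moment_sum_components:
  "\<omega> \<in> line_forms \<alpha> \<Longrightarrow> moment_sum \<omega> = \<alpha> - 1"
  "\<omega> \<in> plane_forms \<alpha> \<Longrightarrow> moment_sum \<omega> = 3 + \<alpha>"
  "\<omega> \<in> flag_forms \<alpha> \<Longrightarrow> moment_sum \<omega> = - 1 - \<alpha>"
proof -
  have m: "moment_sum \<omega> = moment_map \<omega> $ 1 + moment_map \<omega> $ 2 + moment_map \<omega> $ 3" for \<omega>
    by (simp add: moment_sum_def moment_map_def)
  show "\<omega> \<in> line_forms \<alpha> \<Longrightarrow> moment_sum \<omega> = \<alpha> - 1"
  proof -
    assume "\<omega> \<in> line_forms \<alpha>"
    then obtain u where u: "norm u = 1" "\<omega> = form_of (- mat 1 + (2 + \<alpha>) *\<^sub>R block0 (line_proj u))"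
      unfolding line_forms_def CP_unit by blast
    show ?thesis unfolding u(2) m moment_line_forms_point[OF u(1)] by (simp add: algebra_simps)
  qed
  show "\<omega> \<in> plane_forms \<alpha> \<Longrightarrow> moment_sum \<omega> = 3 + \<alpha>"
  proof -
    assume "\<omega> \<in> plane_forms \<alpha>"
    then obtain z where z: "norm z = 1" "\<omega> = form_of (mat 1 + \<alpha> *\<^sub>R line_proj z)"
      unfolding plane_forms_def CP_unit by blast
    define a b where "a = (cmod (z$1))\<^sup>2" and "b = (cmod (z$2))\<^sup>2"
    have c: "(cmod (z$3))\<^sup>2 = 1 - a - b" using z(1) unfolding unit_3 by (simp add: a_def b_def)
    show ?thesis
      unfolding z(2) m moment_plane_forms_point[OF z(1)] c by (simp add: a_def[symmetric] b_def[symmetric] algebra_simps)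
  qed
  show "\<omega> \<in> flag_forms \<alpha> \<Longrightarrow> moment_sum \<omega> = - 1 - \<alpha>"
  proof -
    assume "\<omega> \<in> flag_forms \<alpha>"
    then obtain u s t where u: "norm u = 1" and st: "(cmod s)\<^sup>2 + (cmod t)\<^sup>2 = 1"
      and \<omega>: "\<omega> = form_of (mat 1 - 2 *\<^sub>R block1 (line_proj u) - \<alpha> *\<^sub>R line_proj (vector [s * u$1, s * u$2, t]))"
      unfolding flag_forms_def by blast
    show ?thesis unfolding \<omega> m moment_flag_forms_point[OF u st] by (simp add: algebra_simps)
  qed
qed

theorem corollary35:
  fixes \<alpha> :: real
  assumes "\<alpha> > 0"
  shows "\<exists>M1 M2 M3 :: (real^6^6) set.
     ms_form \<alpha> ` {(J, V) \<in> mixed_structures. class_W34 J \<and> class_V {3, 4, 5} (plane_of V)}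
       = M1 \<union> M2 \<union> M3 \<and>
     M1 \<inter> M2 = {} \<and> M1 \<inter> M3 = {} \<and> M2 \<inter> M3 = {} \<and>
     (\<forall>M\<in>{M1, M2, M3}. openin (top_of_set (M1 \<union> M2 \<union> M3)) M) \<and>
     diffeomorphic M1 CP1 \<and>
     diffeomorphic M2 CP2 \<and>
     (\<exists>\<pi>. smooth_fibre_bundle M3 \<pi> CP1 CP1) \<and>
     moment_map ` M1 = closed_segment (vector [1 + \<alpha>, -1, -1]) (vector [-1, 1 + \<alpha>, -1]) \<and>
     moment_map ` M2 = convex hull
       {vector [1 + \<alpha>, 1, 1], vector [1, 1 + \<alpha>, 1], vector [1, 1, 1 + \<alpha>]} \<and>
     moment_map ` M3 = convex hull
       {vector [1, -1 - \<alpha>, -1], vector [1, -1, -1 - \<alpha>],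
        vector [-1 - \<alpha>, 1, -1], vector [-1, 1, -1 - \<alpha>]}"
proof -
  let ?M1 = "line_forms \<alpha>" and ?M2 = "plane_forms \<alpha>" and ?M3 = "flag_forms \<alpha>"
  note val = moment_sum_components[where \<alpha> = \<alpha>]
  have cont: "continuous_on UNIV moment_sum"
    unfolding moment_sum_def[abs_def] by (intro continuous_intros)
  have fin: "finite (moment_sum ` (?M1 \<union> ?M2))" "finite (moment_sum ` (?M1 \<union> ?M3))" "finite (moment_sum ` (?M2 \<union> ?M3))"
    by (rule finite_subset[of _ "{\<alpha> - 1, 3 + \<alpha>, - 1 - \<alpha>}"], use val in auto)+
  have disj: "?M1 \<inter> ?M2 = {}" "?M1 \<inter> ?M3 = {}" "?M2 \<inter> ?M3 = {}"
    using val assms by (fastforce simp: disjoint_iff)+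
  have "openin (top_of_set (?M1 \<union> (?M2 \<union> ?M3))) ?M1"
    by (rule level_sets_separated[OF cont val(1) _ fin(3)]) (use val assms in fastforce)+
  moreover have "openin (top_of_set (?M2 \<union> (?M1 \<union> ?M3))) ?M2"
    by (rule level_sets_separated[OF cont val(2) _ fin(2)]) (use val assms in fastforce)+
  moreover have "openin (top_of_set (?M3 \<union> (?M1 \<union> ?M2))) ?M3"
    by (rule level_sets_separated[OF cont val(3) _ fin(1)]) (use val assms in fastforce)+
  ultimately have open_M: "\<forall>M\<in>{?M1, ?M2, ?M3}. openin (top_of_set (?M1 \<union> ?M2 \<union> ?M3)) M"
    by (simp add: Un_ac)
  show ?thesis
    by (intro exI[of _ ?M1] exI[of _ ?M2] exI[of _ ?M3] conjI invariant_mixed_structures_forms disj open_M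
      line_forms_diffeomorphic plane_forms_diffeomorphic exI[of _ "flag_base \<alpha>"] flag_forms_bundle
      moment_line_forms moment_plane_forms moment_flag_forms assms)
qed

end
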